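(* Let $m>1$ be an integer. (Even case.) Let $F_1,\ldots,F_{2m}$ be distinct finite graphs, each with at least one edge, let $e_i$ be the number of edges of $F_i$, and assume $e_1>e_2>\cdots>e_{2m}>0$. Put $\lambda_i=e_i-2m+i$ for $i=1,\ldots,2m$. Then \[\mathrm{Vol}(\mathrm{conv}\, \{ ( p^{e_1}, p^{e_2}, \ldots,p^{e_{2m}} ) \mid 0 \leq p \leq 1 \} ) =\frac{1}{(2m)!\,m!}\int_{[0,1]^m} s_\lambda(x_1,x_1,x_2,x_2,\ldots,x_m,x_m) \prod_{1\le i<j\le m}(x_i-x_j)^4 \, \mathrm{d}x_1\cdots \mathrm{d}x_m .\] (Odd case.) Let $F_1,\ldots,F_{2m+1}$ be distinct finite graphs, each with at least one edge, with edge counts $e_1>e_2>\cdots>e_{2m+1}>0$, and put $\lambda_i=e_i-(2m+1)+i$ for $i=1,\ldots,2m+1$. Then \[\mathrm{Vol}(\mathrm{conv}\, \{ ( p^{e_1}, \ldots,p^{e_{2m+1}} ) \mid 0 \leq p \leq 1 \} )=\frac{1}{(2m+1)!\,m!}\int_{[0,1]^m} s_\lambda(x_1,x_1,\ldots,x_m,x_m,1) \prod_{1\le i<j\le m}(x_i-x_j)^4 \prod_{1\le i\le m}(1-x_i)^2\, \mathrm{d}x_1\cdots \mathrm{d}x_m .\]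
   Context: $\mathrm{Vol}$ denotes Lebesgue measure in the ambient dimension ($2m$ resp. $2m+1$) and $\mathrm{conv}$ the convex hull. For a partition $\lambda=(\lambda_1\ge\cdots\ge\lambda_N\ge 0)$ of length at most $N$, the Schur polynomial is the symmetric polynomial $s_\lambda(z_1,\ldots,z_N)=\det[z_i^{\lambda_j+N-j}]_{i,j=1}^N/\det[z_i^{N-j}]_{i,j=1}^N$; it is a polynomial, so it may be evaluated with repeated arguments. *)

theory Defs
  imports "HOL-Analysis.Analysis"
begin

definition fin_graph :: "'a set \<times> 'a set set \<Rightarrow> bool" where
  "fin_graph G \<longleftrightarrow> finite (fst G) \<and>
     snd G \<subseteq> {{u, v} | u v. u \<in> fst G \<and> v \<in> fst G \<and> u \<noteq> v}"

definition num_edges :: "'a set \<times> 'a set set \<Rightarrow> nat" where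
  "num_edges G = card (snd G)"

definition detN :: "nat \<Rightarrow> (nat \<Rightarrow> nat \<Rightarrow> real) \<Rightarrow> real" where
  "detN N M = (\<Sum>p \<in> {p. p permutes {..<N}}. of_int (sign p) * (\<Prod>i<N. M i (p i)))"

definition poly_fun :: "nat \<Rightarrow> ((nat \<Rightarrow> real) \<Rightarrow> real) \<Rightarrow> bool" where
  "poly_fun N f \<longleftrightarrow> (\<exists>S c. finite S \<and> S \<subseteq> ({..<N} \<rightarrow>\<^sub>E (UNIV :: nat set)) \<and>
      (\<forall>z. f z = (\<Sum>a\<in>S. c a * (\<Prod>i<N. z i ^ a i))))"

text \<open>Schur polynomial s_lam in N variables (partition lam 0-indexed: lam 0 \<ge> lam 1 \<ge> ...),
  defined as the polynomial equal to the bialternant ratio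
  det[z_i^(lam_j + N - 1 - j)] / det[z_i^(N - 1 - j)]; as a polynomial it can be
  evaluated at any argument, including repeated ones.\<close>
definition schur :: "nat \<Rightarrow> (nat \<Rightarrow> nat) \<Rightarrow> (nat \<Rightarrow> real) \<Rightarrow> real" where
  "schur N lam = (THE f. poly_fun N f \<and>
      (\<forall>z. f z * detN N (\<lambda>i j. z i ^ (N - 1 - j)) = detN N (\<lambda>i j. z i ^ (lam j + N - 1 - j))))"

definition curve_hull :: "(nat \<Rightarrow> real) set \<Rightarrow> (nat \<Rightarrow> real) set" where
  "curve_hull S = {y. \<exists>(k::nat) c v. (\<forall>j<k. 0 \<le> c j \<and> v j \<in> S) \<and> (\<Sum>j<k. c j) = 1 \<and>
       y = (\<lambda>i. \<Sum>j<k. c j * v j i)}"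

abbreviation lebN :: "nat \<Rightarrow> (nat \<Rightarrow> real) measure" where
  "lebN n \<equiv> PiM {..<n} (\<lambda>_. lborel)"

definition curve_pts :: "nat \<Rightarrow> (nat \<Rightarrow> nat) \<Rightarrow> (nat \<Rightarrow> real) set" where
  "curve_pts n e = {restrict (\<lambda>i. p ^ e i) {..<n} | p. 0 \<le> p \<and> p \<le> (1::real)}"

end

theory Submission
  imports Defs "Jordan_Normal_Form.Determinant"
begin

text \<open>
  Up to a null set, every point of the hull of the monomial curve \<open>\<gamma>\<close> is uniquely a sum
  \<open>\<Sum>i. w\<^sub>i \<gamma>(x\<^sub>i)\<close> with increasing nodes \<open>x\<^sub>i\<close> in \<open>(0, 1]\<close> and positive weights of sum at most \<open>1\<close>,
  the last node being \<open>1\<close> if the dimension is odd; the missing mass sits at \<open>\<gamma>(0) = 0\<close>.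
  Uniqueness holds because a sum of few powers has few positive roots, existence by following the
  ray from the origin to the boundary, where the nodes are double roots of a residual polynomial.
  The Jacobian of this parametrisation is the product of the weights of the free nodes times a confluent
  determinant, that is, a Schur polynomial with doubled arguments times a Vandermonde product. The weights
  integrate to \<open>1 / n!\<close> over the simplex, and forgetting the order of the \<open>m\<close> free nodes gives \<open>1 / m!\<close>.

  The dimension is a number and not a type, so the change of variables is done one
  coordinate at a time: the coordinates of the curve replace the parameters one by one, and
  the derivative of each step is a quotient of consecutive leading minors of the Jacobian.
\<close>

subsection \<open>Sums of few powers\<close>

text \<open>One fact serves uniqueness, regularity and existence alike: a nonzero combination of
  \<open>k\<close> powers with distinct exponents has fewer than \<open>k\<close> positive roots,
  double roots counted twice (\<open>card_roots_less\<close>). It makes representations unique and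
  the Jacobian minors nonzero, and it bounds the index of a nearest point. The count sees only how
  many exponents there are, so it applies to every initial segment of \<open>e\<close>, as the
  coordinatewise substitution requires. Derivatives come from exact secants: increments of
  \<open>Phi\<close> are linear in the increments of the parameters, with divided differences as
  coefficients (\<open>Phi_diff\<close>). Cramer's rule then applies to difference quotients, and
  only a limit remains. That limit uses a continuous inverse, hence the exhaustion of
  \<open>params\<close> by compact sets. Divided differences also supply the polynomial that
  \<open>schur\<close> selects by \<open>THE\<close>. The change of variables yields an absolute
  value of the Jacobian; it is removed by the nonnegativity of Schur polynomials at nonnegative
  arguments.\<close>

lemma Rolle_finite_set:
  fixes f :: "real \<Rightarrow> real"
  assumes "finite A" "A \<subseteq> {0<..}" "\<And>x. x \<in> A \<Longrightarrow> f x = 0"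
    and der: "\<And>x. 0 < x \<Longrightarrow> (f has_real_derivative f' x) (at x)"
  shows "\<exists>R. finite R \<and> R \<subseteq> {0<..} \<and> R \<inter> A = {} \<and> card A \<le> Suc (card R) \<and>
    (\<forall>x\<in>R. f' x = 0 \<and> (\<exists>a\<in>A. x < a))"
  using assms(1-3)
proof (induction rule: finite_linorder_max_induct)
  case empty
  show ?case by (rule exI[of _ "{}"]) auto
next
  case (insert b A)
  then obtain R where R: "finite R" "R \<subseteq> {0<..}" "R \<inter> A = {}" "card A \<le> Suc (card R)"
    "\<forall>x\<in>R. f' x = 0 \<and> (\<exists>a\<in>A. x < a)"
    by auto
  show ?case
  proof (cases "A = {}")
    case True
    then show ?thesis by (intro exI[of _ "{}"]) auto
  next
    case False
    define a where "a = Max A"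
    have a: "a \<in> A" "\<And>x. x \<in> A \<Longrightarrow> x \<le> a"
      using False insert.hyps by (auto simp: a_def)
    have "a < b" "0 < a" using a insert by auto
    have "\<exists>z>a. z < b \<and> DERIV f z :> 0"
    proof (rule Rolle)
      show "continuous_on {a..b} f"
      proof (intro continuous_at_imp_continuous_on ballI)
        fix x assume "x \<in> {a..b}"
        then show "isCont f x" using der[of x] \<open>0 < a\<close> by (auto intro: DERIV_isCont)
      qed
      show "f differentiable at x" if "a < x" "x < b" for x
        using der[of x] that \<open>0 < a\<close> by (auto simp: real_differentiable_def)
    qed (use a insert.prems \<open>a < b\<close> in auto)
    then obtain z where z: "a < z" "z < b" "DERIV f z :> 0" by blast
    have "f' z = 0" using z \<open>0 < a\<close> der[of z] DERIV_unique by force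
    \<comment> \<open>The clause \<open>\<exists>a\<in>A. x < a\<close> is carried through the
      induction for this: old roots lie below some element of \<open>A\<close>, the new one lies
      above \<open>Max A\<close>.\<close>
    have "x < z" if "x \<in> R" for x
    proof -
      obtain a' where "a' \<in> A" "x < a'" using R(5) \<open>x \<in> R\<close> by auto
      then show ?thesis using a(2)[of a'] z by simp
    qed
    then have "z \<notin> R" by blast
    show ?thesis
    proof (rule exI[of _ "insert z R"], intro conjI)
      show "insert z R \<inter> insert b A = {}"
        using R(3) R(5) z insert.hyps a by (force dest: bspec)
      show "card (insert b A) \<le> Suc (card (insert z R))"
        using R \<open>z \<notin> R\<close> insert.hyps by (auto simp: card_insert_if)
      show "\<forall>x\<in>insert z R. f' x = 0 \<and> (\<exists>a\<in>insert b A. x < a)"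
        using R z \<open>f' z = 0\<close> by auto
    qed (use R z \<open>0 < a\<close> in auto)
  qed
qed

text \<open>Dividing by the lowest power \<open>t ^ k\<close> turns one term into a constant, which
  differentiation removes. The derivative of the quotient still vanishes on the double roots
  \<open>B\<close>, and Rolle gives at least \<open>card A - 1\<close> further roots off
  \<open>A\<close>; so the number of terms drops by one and the count of roots by at most
  one.\<close>

lemma card_roots_less:
  fixes c :: "'j \<Rightarrow> real" and e :: "'j \<Rightarrow> nat"
  assumes "finite J" "inj_on e J" "\<exists>j\<in>J. c j \<noteq> 0"
    and "finite A" "A \<subseteq> {0<..}" "\<And>t. t \<in> A \<Longrightarrow> (\<Sum>j\<in>J. c j * t ^ e j) = 0"
    and "B \<subseteq> A" "\<And>t. t \<in> B \<Longrightarrow> (\<Sum>j\<in>J. c j * (real (e j) * t ^ (e j - 1))) = 0"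
  shows "card A + card B < card J"
  using assms
proof (induction "card J" arbitrary: J e c A B rule: less_induct)
  case less
  have "J \<noteq> {}" using less.prems by auto
  define k where "k = Min (e ` J)"
  have "k \<in> e ` J" using \<open>J \<noteq> {}\<close> less.prems(1) by (auto simp: k_def intro!: Min_in)
  then obtain i where i: "i \<in> J" "e i = k" by auto
  have i3: "k \<le> e j" if "j \<in> J" for j
    using that less.prems(1) by (simp add: k_def)
  have ik: "k < e j" if "j \<in> J - {i}" for j
    using that i i3[of j] less.prems(2) by (metis DiffE inj_onD insertI1 le_neq_implies_less)
  have cardJ: "card J = Suc (card (J - {i}))"
    using i less.prems(1) by (metis card_Suc_Diff1)
  have Jsum: "(\<Sum>j\<in>J. g j) = g i + (\<Sum>j\<in>J-{i}. g j)" for g :: "'j \<Rightarrow> real"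
    using i less.prems(1) by (simp add: sum.remove)
  have inj': "inj_on e (J - {i})" using less.prems(2) by (rule inj_on_diff)
  show ?case
  proof (cases "c i = 0")
    case True
    have "card A + card B < card (J - {i})"
    proof (rule less.hyps[of "J - {i}" e c A B])
      show "\<exists>j\<in>J - {i}. c j \<noteq> 0" using less.prems(3) True by auto
    qed (use less.prems True inj' cardJ Jsum[of "\<lambda>j. c j * _ ^ e j"]
        Jsum[of "\<lambda>j. c j * (real (e j) * _ ^ (e j - 1))"] in auto)
    then show ?thesis using cardJ by simp
  next
    case False
    define q where "q t = (\<Sum>j\<in>J. c j * t ^ (e j - k))" for t
    define q' where "q' t = (\<Sum>j\<in>J-{i}. (c j * real (e j - k)) * t ^ (e j - k - 1))" for t
    have q'_alt: "q' t = (\<Sum>j\<in>J. c j * (real (e j - k) * t ^ (e j - k - 1)))" for t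
      unfolding q'_def Jsum using i by (simp add: mult.assoc)
    have der: "(q has_real_derivative q' t) (at t)" for t
      unfolding q_def q'_alt by (auto intro!: derivative_eq_intros sum.cong simp: mult_ac)
    have p: "(\<Sum>j\<in>J. c j * t ^ e j) = t ^ k * q t" for t
      unfolding q_def sum_distrib_left
      by (intro sum.cong refl) (use i3 in \<open>auto simp: power_add[symmetric] mult_ac\<close>)
    have qA: "q t = 0" if "t \<in> A" for t
      using less.prems(5,6) that p[of t] by force
    have qB: "q' t = 0" if "t \<in> B" for t
    proof -
      have "((\<lambda>t. \<Sum>j\<in>J. c j * t ^ e j) has_real_derivative
          (\<Sum>j\<in>J. c j * (real (e j) * t ^ (e j - 1)))) (at t)"
        by (auto intro!: derivative_eq_intros sum.cong simp: mult_ac)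
      moreover have "((\<lambda>t. t ^ k * q t) has_real_derivative
          (real k * t ^ (k - 1)) * q t + q' t * t ^ k) (at t)"
        by (auto intro!: derivative_eq_intros der)
      ultimately have "(\<Sum>j\<in>J. c j * (real (e j) * t ^ (e j - 1))) =
          (real k * t ^ (k - 1)) * q t + q' t * t ^ k"
        unfolding p by (rule DERIV_unique)
      moreover have "t > 0" "t \<in> A" using less.prems(5,7) that by auto
      ultimately show ?thesis using less.prems(8)[OF that] qA[of t] by simp
    qed
    obtain R where R: "finite R" "R \<subseteq> {0<..}" "R \<inter> A = {}" "card A \<le> Suc (card R)"
      "\<forall>x\<in>R. q' x = 0 \<and> (\<exists>a\<in>A. x < a)"
      using Rolle_finite_set[OF less.prems(4,5) qA der] by auto
    have finB: "finite B" using less.prems(4,7) finite_subset by blast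
    have cRB: "card (R \<union> B) = card R + card B"
      using R finB less.prems(7) by (intro card_Un_disjoint) auto
    show ?thesis
    proof (cases "\<exists>j\<in>J-{i}. c j \<noteq> 0")
      case True
      \<comment> \<open>A double root of the original sum is only known to be a simple root of
        \<open>q'\<close>, so the recursive call has an empty set of double roots.\<close>
      have "card (R \<union> B) + card ({}::real set) < card (J - {i})"
      proof (rule less.hyps[of "J-{i}" "\<lambda>j. e j - k - 1" "\<lambda>j. c j * real (e j - k)"])
        show "inj_on (\<lambda>j. e j - k - 1) (J - {i})"
        proof (rule inj_onI)
          fix x y assume xy: "x \<in> J - {i}" "y \<in> J - {i}" "e x - k - 1 = e y - k - 1"
          then have "e x = e y" using ik[of x] ik[of y] by linarith
          then show "x = y" using inj' xy by (auto dest: inj_onD)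
        qed
        show "\<exists>j\<in>J - {i}. c j * real (e j - k) \<noteq> 0" using True ik by force
        show "(\<Sum>j\<in>J - {i}. c j * real (e j - k) * t ^ (e j - k - 1)) = 0" if "t \<in> R \<union> B" for t
          using that R qB unfolding q'_def by blast
      qed (use R finB less.prems cardJ in auto)
      then show ?thesis using cRB R cardJ by simp
    next
      case no: False
      have "q t = c i" for t
        unfolding q_def Jsum using no i by simp
      then have "A = {}" using qA False by auto
      then show ?thesis using less.prems(7) cardJ by simp
    qed
  qed
qed

subsection \<open>Determinants\<close>

lemma detN_eq_det: "detN N M = Determinant.det (mat N N (\<lambda>(i, j). M i j))"
  unfolding detN_def Determinant.det_def
  by (auto simp: lessThan_atLeast0 permutes_in_image intro!: sum.cong prod.cong)

lemma detN_cong: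
  assumes "\<And>i j. i < N \<Longrightarrow> j < N \<Longrightarrow> M i j = M' i j"
  shows "detN N M = detN N M'"
  unfolding detN_def
proof (intro sum.cong refl arg_cong2[of _ _ _ _ "(*)"] prod.cong)
  fix p i assume "p \<in> {p. p permutes {..<N}}" "i \<in> {..<N}"
  then show "M i (p i) = M' i (p i)" using permutes_in_image[of p "{..<N}" i] by (auto intro!: assms)
qed

lemma detN_zero_kernel:
  assumes "detN N M = 0"
  obtains v where "\<exists>j<N. v j \<noteq> 0" "\<And>i. i < N \<Longrightarrow> (\<Sum>j<N. M i j * v j) = 0"
proof -
  let ?A = "mat N N (\<lambda>(i, j). M i j)"
  have "Determinant.det ?A = 0" using assms by (simp add: detN_eq_det)
  then obtain v where v: "v \<in> carrier_vec N" "v \<noteq> 0\<^sub>v N" "?A *\<^sub>v v = 0\<^sub>v N"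
    using det_0_iff_vec_prod_zero[of ?A N] by auto
  show thesis
  proof
    show "\<exists>j<N. vec_index v j \<noteq> 0"
      using v by (metis eq_vecI carrier_vecD index_zero_vec)
    fix i assume "i < N"
    then have "vec_index (?A *\<^sub>v v) i = 0" using v by simp
    then show "(\<Sum>j<N. M i j * vec_index v j) = 0"
      using \<open>i < N\<close> v(1) by (simp add: scalar_prod_def lessThan_atLeast0)
  qed
qed

lemma detN_transpose: "detN N (\<lambda>i j. M j i) = detN N M"
proof -
  have "mat N N (\<lambda>(i, j). M j i) = transpose_mat (mat N N (\<lambda>(i, j). M i j))" by auto
  then show ?thesis using Determinant.det_transpose[of "mat N N (\<lambda>(i, j). M i j)" N]
    by (simp add: detN_eq_det)
qed

lemma detN_permute_rows:
  assumes "p permutes {..<N}"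
  shows "detN N (\<lambda>i j. M (p i) j) = of_int (sign p) * detN N M"
proof -
  have "mat N N (\<lambda>(i, j). M (p i) j) = mat N N (\<lambda>(i, j). mat N N (\<lambda>(i, j). M i j) $$ (p i, j))"
    using permutes_in_image[OF assms] by (intro cong_mat) auto
  then show ?thesis
    using det_permute_rows[of "mat N N (\<lambda>(i, j). M i j)" N p] assms
    by (simp add: detN_eq_det lessThan_atLeast0[symmetric])
qed

lemma detN_permute_cols:
  assumes "p permutes {..<N}"
  shows "detN N (\<lambda>i j. M i (p j)) = of_int (sign p) * detN N M"
  using detN_permute_rows[OF assms, of "\<lambda>i j. M j i"] by (simp only: detN_transpose[of N "\<lambda>i j. M i (p j)"] detN_transpose[of N M])

lemma detN_mult:
  "detN N (\<lambda>i j. \<Sum>k<N. L i k * H k j) = detN N L * detN N H"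
proof -
  have "mat N N (\<lambda>(i, j). \<Sum>k<N. L i k * H k j) =
      mat N N (\<lambda>(i, j). L i j) * mat N N (\<lambda>(i, j). H i j)"
    by (auto simp: scalar_prod_def lessThan_atLeast0)
  then show ?thesis by (simp add: detN_eq_det det_mult[of _ N])
qed

lemma detN_lower_triangular:
  assumes "\<And>i j. i < j \<Longrightarrow> j < N \<Longrightarrow> M i j = 0"
  shows "detN N M = (\<Prod>i<N. M i i)"
  using det_lower_triangular[of N "mat N N (\<lambda>(i, j). M i j)"] assms
  by (simp add: detN_eq_det prod_list_diag_prod lessThan_atLeast0)

lemma detN_mult_rows:
  "detN N (\<lambda>i j. a i * M i j) = (\<Prod>i<N. a i) * detN N M"
  unfolding detN_def by (simp add: prod.distrib sum_distrib_left mult_ac)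

text \<open>The last entry of the solution of \<open>x J = (0, \<dots>, 0, y)\<close>, with the adjugate in place of the
  inverse so that \<open>J\<close> may be singular.\<close>

lemma detN_cramer_last:
  assumes "\<And>j. j \<le> k \<Longrightarrow> (\<Sum>i\<le>k. x i * J i j) = (if j = k then y else 0)"
  shows "x k * detN (Suc k) J = y * detN k J"
proof -
  let ?A = "mat (Suc k) (Suc k) (\<lambda>(i, j). J i j)"
  have A: "?A \<in> carrier_mat (Suc k) (Suc k)" by simp
  have adj: "?A * adj_mat ?A = Determinant.det ?A \<cdot>\<^sub>m 1\<^sub>m (Suc k)" "adj_mat ?A \<in> carrier_mat (Suc k) (Suc k)"
    using adj_mat[OF A] by auto
  have idx: "(\<Sum>j\<le>k. J i j * adj_mat ?A $$ (j, k)) = (if i = k then Determinant.det ?A else 0)"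
    if "i \<le> k" for i
  proof -
    have "(?A * adj_mat ?A) $$ (i, k) = (\<Sum>j\<le>k. J i j * adj_mat ?A $$ (j, k))"
      using that adj(2) by (simp add: scalar_prod_def lessThan_atLeast0[symmetric] lessThan_Suc_atMost)
    then show ?thesis using adj(1) that by auto
  qed
  have "x k * Determinant.det ?A = (\<Sum>i\<le>k. x i * (\<Sum>j\<le>k. J i j * adj_mat ?A $$ (j, k)))"
    by (simp add: idx sum.delta if_distrib cong: if_cong)
  also have "\<dots> = (\<Sum>j\<le>k. (\<Sum>i\<le>k. x i * J i j) * adj_mat ?A $$ (j, k))"
    unfolding sum_distrib_left sum_distrib_right by (subst sum.swap) (simp add: mult.assoc)
  also have "\<dots> = y * adj_mat ?A $$ (k, k)"
    by (simp add: assms if_distrib[of "\<lambda>x. x * _"] cong: if_cong)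
  also have "adj_mat ?A $$ (k, k) = Determinant.det (mat_delete ?A k k)"
    by (simp add: adj_mat_def cofactor_def)
  also have "mat_delete ?A k k = mat k k (\<lambda>(i, j). J i j)"
    by (auto simp: mat_delete_def)
  finally show ?thesis by (simp add: detN_eq_det)
qed

text \<open>With as many exponents selected as there are nodes, the matrix of powers is square; a
  kernel vector would give a sum of \<open>card A\<close> powers with \<open>card A\<close> positive
  roots. Hence its transpose, which acts on the weights \<open>\<mu>\<close>, is injective
  too.\<close>

lemma power_sums_independent:
  fixes e :: "'j \<Rightarrow> nat" and \<mu> :: "real \<Rightarrow> real"
  assumes J: "finite J" "inj_on e J" and A: "finite A" "A \<subseteq> {0<..}" "card A \<le> card J"
    and 0: "\<And>j. j \<in> J \<Longrightarrow> (\<Sum>a\<in>A. \<mu> a * a ^ e j) = 0" and "a \<in> A"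
  shows "\<mu> a = 0"
proof -
  obtain J' where J': "J' \<subseteq> J" "card J' = card A" 
    using A(3) J(1) by (meson obtain_subset_with_card_n)
  have fin': "finite J'" using J' J finite_subset by blast
  define N where "N = card A"
  obtain \<alpha> where \<alpha>: "bij_betw \<alpha> {..<N} A"
    using ex_bij_betw_nat_finite[OF A(1)] by (auto simp: N_def lessThan_atLeast0)
  obtain \<iota> where \<iota>: "bij_betw \<iota> {..<N} J'"
    using ex_bij_betw_nat_finite[OF fin'] J' by (auto simp: N_def lessThan_atLeast0)
  let ?M = "\<lambda>i j. \<alpha> i ^ e (\<iota> j)"
  have "detN N ?M \<noteq> 0"
  proof
    assume "detN N ?M = 0"
    then obtain v where v: "\<exists>j<N. v j \<noteq> 0" "\<And>i. i < N \<Longrightarrow> (\<Sum>j<N. ?M i j * v j) = 0"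
      by (rule detN_zero_kernel) blast
    have "card A + card ({} :: real set) < card {..<N}"
    proof (rule card_roots_less[of "{..<N}" "e \<circ> \<iota>" v A "{}"])
      show "inj_on (e \<circ> \<iota>) {..<N}"
        using \<iota> J' J by (metis bij_betw_def comp_inj_on inj_on_subset)
      show "(\<Sum>j<N. v j * t ^ (e \<circ> \<iota>) j) = 0" if "t \<in> A" for t
      proof -
        from that \<alpha> have "t \<in> \<alpha> ` {..<N}" by (simp add: bij_betw_def)
        then obtain i where "i < N" "t = \<alpha> i" by auto
        then show ?thesis using v(2)[of i] by (simp add: mult.commute)
      qed
    qed (use v A in auto)
    then show False by (simp add: N_def)
  qed
  then have ne: "detN N (\<lambda>i j. ?M j i) \<noteq> 0" by (subst detN_transpose)
  let ?A = "mat N N (\<lambda>(i, j). ?M j i)"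
  let ?v = "vec N (\<lambda>i. \<mu> (\<alpha> i))"
  have "?A *\<^sub>v ?v = 0\<^sub>v N"
  proof (rule eq_vecI)
    fix i assume i: "i < dim_vec (0\<^sub>v N :: real vec)"
    have "\<iota> i \<in> J" using i \<iota> J' by (auto simp: bij_betw_def)
    have "(\<Sum>j<N. ?M j i * \<mu> (\<alpha> j)) = (\<Sum>a\<in>A. a ^ e (\<iota> i) * \<mu> a)"
      by (rule sum.reindex_bij_betw[OF \<alpha>])
    also have "\<dots> = 0" using 0[OF \<open>\<iota> i \<in> J\<close>] by (simp add: mult.commute)
    finally show "vec_index (?A *\<^sub>v ?v) i = vec_index (0\<^sub>v N) i"
      using i by (simp add: scalar_prod_def lessThan_atLeast0)
  qed simp
  then have "?v = 0\<^sub>v N"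
    using ne det_0_iff_vec_prod_zero[of ?A N] vec_carrier[of N "\<lambda>i. \<mu> (\<alpha> i)"]
    unfolding detN_eq_det by fastforce
  moreover have "a \<in> \<alpha> ` {..<N}" using \<open>a \<in> A\<close> \<alpha> by (simp add: bij_betw_def)
  then obtain i where "i < N" "a = \<alpha> i" by auto
  ultimately show ?thesis by (metis index_vec index_zero_vec(1))
qed

subsection \<open>Divided differences of powers and Schur polynomials\<close>

text \<open>The complete homogeneous symmetric polynomial of degree \<open>d\<close>, expanded by
  the exponent of the first variable.\<close>

primrec hsym :: "real list \<Rightarrow> nat \<Rightarrow> real" where
  "hsym [] d = (if d = 0 then 1 else 0)"
| "hsym (x # xs) d = (\<Sum>k\<le>d. x ^ k * hsym xs (d - k))"

declare hsym.simps(2) [simp del]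

lemma hsym_0 [simp]: "hsym xs 0 = 1"
  by (induction xs) (auto simp: hsym.simps(2))

lemma hsym_Cons_Suc: "hsym (x # xs) (Suc d) = x * hsym (x # xs) d + hsym xs (Suc d)"
  by (simp only: hsym.simps(2) sum.atMost_Suc_shift sum_distrib_left power_Suc power_0 mult_1 diff_Suc_Suc
      minus_nat.diff_0 mult.assoc add.commute)

text \<open>This is the recursion of divided differences. Induction on the degree works because
  \<open>hsym_Cons_Suc\<close> splits off one factor of the first variable.\<close>

lemma hsym_diff: "hsym (a # xs) (Suc d) - hsym (b # xs) (Suc d) = (a - b) * hsym (a # b # xs) d"
proof (induction d)
  case 0
  show ?case by (simp add: hsym_Cons_Suc)
next
  case (Suc d)
  have "(a - b) * hsym (a # b # xs) (Suc d) =
      a * ((a - b) * hsym (a # b # xs) d) + (a - b) * hsym (b # xs) (Suc d)"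
    unfolding hsym_Cons_Suc[of a "b # xs"] by (simp add: algebra_simps)
  also have "\<dots> = a * hsym (a # xs) (Suc d) - b * hsym (b # xs) (Suc d)"
    by (simp only: Suc.IH[symmetric]) (simp add: algebra_simps)
  also have "\<dots> = hsym (a # xs) (Suc (Suc d)) - hsym (b # xs) (Suc (Suc d))"
    unfolding hsym_Cons_Suc[of _ xs "Suc d"] by simp
  finally show ?case by simp
qed

text \<open>The divided difference of the power function with exponent \<open>e\<close> at the nodes
  \<open>zs\<close>, in a form that remains meaningful when nodes coincide. It vanishes when
  \<open>Suc e < length zs\<close>; without the case split, truncated subtraction would give
  \<open>hsym zs 0 = 1\<close> there.\<close>

definition pdd :: "real list \<Rightarrow> nat \<Rightarrow> real" where
  "pdd zs e = (if Suc e < length zs then 0 else hsym zs (Suc e - length zs))"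

lemma pdd_single [simp]: "pdd [t] e = t ^ e"
proof -
  have "(\<Sum>k\<le>e. t ^ k * hsym [] (e - k)) = (\<Sum>k\<le>e. if k = e then t ^ k else 0)"
    by (intro sum.cong) auto
  then show ?thesis by (simp add: pdd_def hsym.simps(2))
qed

lemma pdd_diff: "pdd (a # zs) e - pdd (b # zs) e = (a - b) * pdd (a # b # zs) e"
proof (cases "e \<le> length zs")
  case True
  then show ?thesis by (auto simp: pdd_def)
next
  case False
  then obtain d where "e - length zs = Suc d" "Suc e - length (a # b # zs) = d"
    by (metis Suc_diff_Suc diff_Suc_Suc length_Cons not_le)
  then show ?thesis using False hsym_diff[of a zs d b]
    by (auto simp: pdd_def)
qed

lemma power_diff_pdd: "a ^ e - b ^ e = (a - b) * pdd [a, b] e" for a b :: real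
  using pdd_diff[of a "[]" e b] by simp

text \<open>At a double node the divided difference is the derivative, so a matrix of secants
  becomes a Jacobian on the diagonal.\<close>

lemma pdd_confluent: "pdd [a, a] e = real e * a ^ (e - 1)"
proof (cases e)
  case 0
  then show ?thesis by (simp add: pdd_def)
next
  case (Suc d)
  have "hsym [a] k = a ^ k" for k using pdd_single[of a k] by (simp add: pdd_def)
  then have "hsym [a, a] d = (\<Sum>k\<le>d. a ^ d)"
    by (subst hsym.simps(2)) (auto intro!: sum.cong simp: power_add[symmetric])
  then show ?thesis using Suc by (simp add: pdd_def)
qed

text \<open>Newton interpolation of a power, with exact remainder. The node list is reversed so that
  the newest node stands first, where \<open>pdd_diff\<close> acts.\<close>

lemma power_Newton:
  fixes z :: "nat \<Rightarrow> real"
  shows "t ^ e = (\<Sum>r<R. (\<Prod>a<r. t - z a) * pdd (map z (rev [0..<Suc r])) e) +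
    (\<Prod>a<R. t - z a) * pdd (t # map z (rev [0..<R])) e"
proof (induction R)
  case (Suc R)
  let ?L = "map z (rev [0..<R])"
  have "(\<Prod>a<R. t - z a) * pdd (t # ?L) e = (\<Prod>a<R. t - z a) * (pdd (z R # ?L) e + (t - z R) * pdd (t # z R # ?L) e)"
    using pdd_diff[of t ?L e "z R"] by simp
  then show ?case using Suc by (simp add: algebra_simps)
qed simp

text \<open>At a node the Newton remainder vanishes, so the matrix of powers is a triangular matrix
  of node differences times a matrix of divided differences. The determinant of the second factor is
  polynomial in \<open>z\<close>; up to the order of the exponents it is the Schur
  polynomial.\<close>

lemma detN_powers:
  "detN N (\<lambda>i j. z i ^ e j) = (\<Prod>i<N. \<Prod>a<i. z i - z a) *
    detN N (\<lambda>r j. pdd (map z (rev [0..<Suc r])) (e j))"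
proof -
  let ?L = "\<lambda>i r. \<Prod>a<r. z i - z a" and ?H = "\<lambda>r j. pdd (map z (rev [0..<Suc r])) (e j)"
  have "z i ^ e j = (\<Sum>r<N. ?L i r * ?H r j)" if "i < N" for i j
  proof -
    have "(\<Prod>a<N. z i - z a) = 0" using that by (auto intro!: prod_zero)
    then show ?thesis using power_Newton[of "z i" "e j" z N] by simp
  qed
  then have "detN N (\<lambda>i j. z i ^ e j) = detN N (\<lambda>i j. \<Sum>r<N. ?L i r * ?H r j)"
    by (intro detN_cong) auto
  also have "\<dots> = detN N ?L * detN N ?H" by (rule detN_mult)
  also have "detN N ?L = (\<Prod>i<N. \<Prod>a<i. z i - z a)"
    by (rule detN_lower_triangular) (auto intro!: prod_zero)
  finally show ?thesis .
qed

text \<open>For the exponents \<open>0, ..., N - 1\<close> the divided differences form a triangular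
  matrix with unit diagonal.\<close>

lemma detN_Vandermonde: "detN N (\<lambda>i j. z i ^ j) = (\<Prod>i<N. \<Prod>a<i. z i - z a)"
proof -
  have "detN N (\<lambda>r j. pdd (map z (rev [0..<Suc r])) j) =
      detN N (\<lambda>j r. pdd (map z (rev [0..<Suc r])) j)"
    by (rule detN_transpose[symmetric])
  also have "\<dots> = (\<Prod>j<N. pdd (map z (rev [0..<Suc j])) j)"
    by (rule detN_lower_triangular) (auto simp: pdd_def)
  also have "\<dots> = 1" by (intro prod.neutral) (auto simp: pdd_def simp del: upt_Suc)
  finally show ?thesis by (simp add: detN_powers)
qed

text \<open>The bialternant lists exponents in decreasing order, the Vandermonde product belongs to
  the increasing order. Reversal costs a sign that is the same in numerator and denominator.\<close>

definition rev_perm :: "nat \<Rightarrow> nat \<Rightarrow> nat" where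
  "rev_perm N j = (if j < N then N - 1 - j else j)"

lemma rev_perm_permutes: "rev_perm N permutes {..<N}"
proof (rule bij_imp_permutes)
  show "bij_betw (rev_perm N) {..<N} {..<N}"
    by (rule bij_betw_byWitness[of _ "rev_perm N"]) (auto simp: rev_perm_def)
qed (auto simp: rev_perm_def)

lemma detN_reverse_cols:
  "detN N (\<lambda>i j. M i (N - 1 - j)) = of_int (sign (rev_perm N)) * detN N M"
  unfolding detN_permute_cols[OF rev_perm_permutes, symmetric]
  by (rule detN_cong) (auto simp: rev_perm_def)

lemma Vandermonde_neq_0_iff:
  "detN N (\<lambda>i j. z i ^ (N - 1 - j)) \<noteq> 0 \<longleftrightarrow> inj_on z {..<N}"
proof -
  have "real_of_int (sign (rev_perm N)) \<noteq> 0" by (simp add: sign_def)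
  then have "detN N (\<lambda>i j. z i ^ (N - 1 - j)) \<noteq> 0 \<longleftrightarrow> (\<forall>i<N. \<forall>a<i. z i \<noteq> z a)"
    unfolding detN_reverse_cols[of N "\<lambda>i j. z i ^ j"] detN_Vandermonde by auto
  also have "\<dots> \<longleftrightarrow> inj_on z {..<N}"
  proof
    assume *: "\<forall>i<N. \<forall>a<i. z i \<noteq> z a"
    show "inj_on z {..<N}"
    proof (rule inj_onI, rule ccontr)
      fix x y assume "x \<in> {..<N}" "y \<in> {..<N}" "z x = z y" "x \<noteq> y"
      then show False using *[rule_format, of x y] *[rule_format, of y x] by (cases x y rule: linorder_cases) auto
    qed
  next
    assume inj: "inj_on z {..<N}"
    show "\<forall>i<N. \<forall>a<i. z i \<noteq> z a"
    proof (intro allI impI notI)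
      fix i a assume "i < N" "a < i" "z i = z a"
      then show False using inj_onD[OF inj, of i a] by auto
    qed
  qed
  finally show ?thesis .
qed

section \<open>Polynomial functions of finitely many coordinates\<close>

lemma poly_fun_monomial: "poly_fun N (\<lambda>z. c * (\<Prod>i<N. z i ^ a i))"
proof -
  let ?a = "restrict a {..<N}"
  show ?thesis unfolding poly_fun_def
    by (rule exI[of _ "{?a}"], rule exI[of _ "\<lambda>_. c"]) (auto intro!: prod.cong)
qed

lemma poly_fun_0: "poly_fun N (\<lambda>z. 0)"
  unfolding poly_fun_def by (rule exI[of _ "{}"]) auto

lemma poly_fun_add:
  assumes "poly_fun N f" "poly_fun N g"
  shows "poly_fun N (\<lambda>z. f z + g z)"
proof -
  let ?m = "\<lambda>z a. \<Prod>i<N. (z i :: real) ^ a i"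
  obtain S c where S: "finite S" "S \<subseteq> {..<N} \<rightarrow>\<^sub>E UNIV" "\<And>z. f z = (\<Sum>a\<in>S. c a * ?m z a)"
    using assms(1) unfolding poly_fun_def by auto
  obtain T d where T: "finite T" "T \<subseteq> {..<N} \<rightarrow>\<^sub>E UNIV" "\<And>z. g z = (\<Sum>a\<in>T. d a * ?m z a)"
    using assms(2) unfolding poly_fun_def by auto
  let ?k = "\<lambda>a. (if a \<in> S then c a else 0) + (if a \<in> T then d a else 0)"
  have "f z + g z = (\<Sum>a\<in>S \<union> T. ?k a * ?m z a)" for z
  proof -
    have "f z = (\<Sum>a\<in>S \<union> T. (if a \<in> S then c a else 0) * ?m z a)"
      unfolding S(3) by (rule sum.mono_neutral_cong_left) (use S T in auto)
    moreover have "g z = (\<Sum>a\<in>S \<union> T. (if a \<in> T then d a else 0) * ?m z a)"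
      unfolding T(3) by (rule sum.mono_neutral_cong_left) (use S T in auto)
    ultimately show ?thesis by (simp add: sum.distrib distrib_right)
  qed
  then show ?thesis unfolding poly_fun_def
    by (intro exI[of _ "S \<union> T"] exI[of _ ?k]) (use S T in auto)
qed

lemma poly_fun_sum:
  assumes "\<And>i. i \<in> I \<Longrightarrow> poly_fun N (f i)"
  shows "poly_fun N (\<lambda>z. \<Sum>i\<in>I. f i z)"
  using assms by (induction I rule: infinite_finite_induct) (auto intro: poly_fun_0 poly_fun_add)

lemma poly_fun_mult:
  assumes "poly_fun N f" "poly_fun N g"
  shows "poly_fun N (\<lambda>z. f z * g z)"
proof -
  let ?m = "\<lambda>z a. \<Prod>i<N. (z i :: real) ^ a i"
  obtain S c where S: "\<And>z. f z = (\<Sum>a\<in>S. c a * ?m z a)"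
    using assms(1) unfolding poly_fun_def by auto
  obtain T d where T: "\<And>z. g z = (\<Sum>a\<in>T. d a * ?m z a)"
    using assms(2) unfolding poly_fun_def by auto
  have "f z * g z = (\<Sum>a\<in>S. \<Sum>b\<in>T. (c a * d b) * ?m z (\<lambda>i. a i + b i))" for z
    unfolding S T sum_product by (simp add: power_add prod.distrib mult_ac)
  moreover have "poly_fun N (\<lambda>z. \<Sum>a\<in>S. \<Sum>b\<in>T. (c a * d b) * ?m z (\<lambda>i. a i + b i))"
    by (intro poly_fun_sum poly_fun_monomial)
  ultimately show ?thesis by simp
qed

lemma poly_fun_const: "poly_fun N (\<lambda>z. c)"
  using poly_fun_monomial[of N c "\<lambda>_. 0"] by simp

lemma poly_fun_prod:
  assumes "\<And>i. i \<in> I \<Longrightarrow> poly_fun N (f i)"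
  shows "poly_fun N (\<lambda>z. \<Prod>i\<in>I. f i z)"
  using assms by (induction I rule: infinite_finite_induct) (auto intro: poly_fun_const poly_fun_mult)

lemma poly_fun_power: "poly_fun N f \<Longrightarrow> poly_fun N (\<lambda>z. f z ^ k)"
  by (induction k) (auto intro: poly_fun_const poly_fun_mult)

lemma poly_fun_coordinate:
  assumes "i < N"
  shows "poly_fun N (\<lambda>z. z i)"
proof -
  have "(\<Prod>j<N. z j ^ (if j = i then 1 else 0)) = z i" for z :: "nat \<Rightarrow> real"
  proof -
    have "(\<Prod>j<N. z j ^ (if j = i then 1 else 0)) = (\<Prod>j<N. if j = i then z j else 1)"
      by (intro prod.cong) auto
    then show ?thesis using assms by simp
  qed
  then show ?thesis using poly_fun_monomial[of N 1 "\<lambda>j. if j = i then 1 else 0"] by simp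
qed

lemma poly_fun_hsym:
  assumes "set is \<subseteq> {..<N}"
  shows "poly_fun N (\<lambda>z. hsym (map z is) d)"
  using assms
  by (induction "is" arbitrary: d)
    (auto simp: hsym.simps(2) intro!: poly_fun_const poly_fun_0 poly_fun_sum poly_fun_mult poly_fun_power poly_fun_coordinate)

lemma poly_fun_pdd:
  assumes "set is \<subseteq> {..<N}"
  shows "poly_fun N (\<lambda>z. pdd (map z is) e)"
  using poly_fun_hsym[OF assms] unfolding pdd_def by (cases "Suc e < length is") (auto intro: poly_fun_0)

lemma poly_fun_detN:
  assumes "\<And>i j. i < N \<Longrightarrow> j < N \<Longrightarrow> poly_fun K (\<lambda>z. M z i j)"
  shows "poly_fun K (\<lambda>z. detN N (M z))"
  unfolding detN_def
proof (intro poly_fun_sum poly_fun_mult poly_fun_const poly_fun_prod)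
  fix p i assume "p \<in> {p. p permutes {..<N}}" "i \<in> {..<N}"
  then show "poly_fun K (\<lambda>z. M z i (p i))"
    using permutes_in_image[of p "{..<N}" i] by (auto intro!: assms)
qed

lemma poly_fun_continuous:
  assumes "poly_fun N f"
  shows "continuous_on UNIV f"
proof -
  obtain S c where S: "\<And>z. f z = (\<Sum>a\<in>S. c a * (\<Prod>i<N. z i ^ a i))"
    using assms unfolding poly_fun_def by auto
  have "f = (\<lambda>z. \<Sum>a\<in>S. c a * (\<Prod>i<N. z i ^ a i))" using S by auto
  then show ?thesis by (auto intro!: continuous_intros)
qed

text \<open>Two perturbed coordinates move at different speeds and so collide for at most one
  \<open>t\<close>. The speed \<open>Suc i\<close> instead of \<open>i\<close> also moves coordinate
  0, so that nonnegative arguments become positive in \<open>schur_nonneg\<close>.\<close>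

lemma eventually_inj_perturb:
  fixes z :: "nat \<Rightarrow> real"
  shows "\<forall>\<^sub>F t in at_right 0. inj_on (\<lambda>i. z i + t * real (Suc i)) {..<N}"
proof -
  let ?B = "(\<lambda>(i, j). (z j - z i) / (real i - real j)) ` ({..<N} \<times> {..<N})"
  have "\<forall>\<^sub>F t in at 0. t \<notin> ?B"
    using islimpt_finite[of ?B 0] islimpt_iff_eventually[of 0 ?B] by auto
  then have "\<forall>\<^sub>F t in at_right 0. t \<notin> ?B" using eventually_at_split by blast
  then show ?thesis
  proof eventually_elim
    case (elim t)
    show ?case
    proof (rule inj_onI, rule ccontr)
      fix i j assume *: "i \<in> {..<N}" "j \<in> {..<N}" "z i + t * real (Suc i) = z j + t * real (Suc j)" "i \<noteq> j"
      then have "t = (z j - z i) / (real i - real j)" by (simp add: field_simps)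
      then show False using elim * by (auto simp: image_iff)
    qed
  qed
qed

lemma tendsto_perturb:
  fixes z :: "nat \<Rightarrow> real"
  assumes "continuous_on UNIV f"
  shows "((\<lambda>t. f (\<lambda>i. z i + t * real (Suc i))) \<longlongrightarrow> f z) (at_right 0)"
proof -
  have "continuous_on UNIV (\<lambda>t. f (\<lambda>i. z i + t * real (Suc i)))"
    by (rule continuous_on_compose2[OF assms])
      (auto intro!: continuous_on_coordinatewise_then_product continuous_intros)
  then have "isCont (\<lambda>t. f (\<lambda>i. z i + t * real (Suc i))) 0"
    by (simp add: continuous_on_eq_continuous_at)
  then show ?thesis by (auto simp: isCont_def intro: tendsto_mono[OF at_le])
qed

lemma continuous_eq_if_eq_distinct:
  fixes f g :: "(nat \<Rightarrow> real) \<Rightarrow> real"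
  assumes "continuous_on UNIV f" "continuous_on UNIV g" "\<And>z. inj_on z {..<N} \<Longrightarrow> f z = g z"
  shows "f z = g z"
proof (rule tendsto_unique)
  show "((\<lambda>t. f (\<lambda>i. z i + t * real (Suc i))) \<longlongrightarrow> f z) (at_right 0)"
    by (rule tendsto_perturb) fact
  show "((\<lambda>t. f (\<lambda>i. z i + t * real (Suc i))) \<longlongrightarrow> g z) (at_right 0)"
    by (rule Lim_transform_eventually[OF tendsto_perturb[OF assms(2)]])
      (rule eventually_mono[OF eventually_inj_perturb[of z N]], simp add: assms(3))
qed simp

text \<open>Existence for the \<open>THE\<close> in \<open>schur\<close>: the determinant of divided
  differences from \<open>detN_powers\<close>, with \<open>?e\<close> listing the exponents in
  reversed order. Uniqueness: at distinct arguments the Vandermonde factor can be cancelled, and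
  continuity covers the rest.\<close>

lemma
  shows poly_fun_schur: "poly_fun N (schur N lam)"
    and schur_mult_Vandermonde: "schur N lam z * detN N (\<lambda>i j. z i ^ (N - 1 - j)) =
      detN N (\<lambda>i j. z i ^ (lam j + N - 1 - j))"
proof -
  let ?P = "\<lambda>f. poly_fun N f \<and>
      (\<forall>z. f z * detN N (\<lambda>i j. z i ^ (N - 1 - j)) = detN N (\<lambda>i j. z i ^ (lam j + N - 1 - j)))"
  let ?e = "\<lambda>j. lam (N - 1 - j) + N - 1 - (N - 1 - j)"
  let ?f = "\<lambda>z. detN N (\<lambda>r j. pdd (map z (rev [0..<Suc r])) (?e j))"
  have "?P ?f"
  proof (intro conjI allI)
    show "poly_fun N ?f" by (intro poly_fun_detN poly_fun_pdd) auto
    fix z :: "nat \<Rightarrow> real"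
    have "detN N (\<lambda>i j. z i ^ (lam j + N - 1 - j)) =
        detN N (\<lambda>i j. z i ^ ?e (N - 1 - j))"
      by (rule detN_cong) simp
    also have "\<dots> = of_int (sign (rev_perm N)) * detN N (\<lambda>i j. z i ^ ?e j)"
      by (rule detN_reverse_cols)
    finally show "?f z * detN N (\<lambda>i j. z i ^ (N - 1 - j)) = detN N (\<lambda>i j. z i ^ (lam j + N - 1 - j))"
      unfolding detN_reverse_cols[of N "\<lambda>i j. z i ^ j"] detN_Vandermonde detN_powers[of N z ?e]
      by (simp only: mult_ac)
  qed
  moreover have "f = g" if "?P f" "?P g" for f g
  proof (rule ext)
    fix z
    show "f z = g z"
    proof (rule continuous_eq_if_eq_distinct[where N = N and f = f and g = g])
      fix z :: "nat \<Rightarrow> real" assume "inj_on z {..<N}"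
      then have "detN N (\<lambda>i j. z i ^ (N - 1 - j)) \<noteq> 0" by (simp only: Vandermonde_neq_0_iff)
      moreover have "f z * detN N (\<lambda>i j. z i ^ (N - 1 - j)) = g z * detN N (\<lambda>i j. z i ^ (N - 1 - j))"
        using that by simp
      ultimately show "f z = g z" using mult_right_cancel by blast
    qed (use that poly_fun_continuous in blast)+
  qed
  ultimately have "?P (schur N lam)"
    unfolding schur_def by (intro theI'[of ?P, OF ex1I[of ?P]])
  then show "poly_fun N (schur N lam)"
    "schur N lam z * detN N (\<lambda>i j. z i ^ (N - 1 - j)) = detN N (\<lambda>i j. z i ^ (lam j + N - 1 - j))"
    by blast+
qed

subsection \<open>Positivity of Schur polynomials\<close>

text \<open>Laplace expansion along the last row. It turns a determinant of powers into a sum of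
  powers of its last node, and the coefficient \<open>c N\<close> is the leading minor.\<close>

lemma detN_last_row:
  obtains c where "c N = detN N M"
    "\<And>f. detN (Suc N) (\<lambda>i j. if i = N then f j else M i j) = (\<Sum>j\<le>N. c j * f j)"
proof -
  let ?A = "\<lambda>f. mat (Suc N) (Suc N) (\<lambda>(i, j). if i = N then f j else M i j)"
  let ?c = "\<lambda>j. cofactor (?A (\<lambda>_. 0)) N j"
  have del: "mat_delete (?A f) N j = mat_delete (?A (\<lambda>_. 0)) N j" for f j
    by (auto simp: mat_delete_def)
  have 1: "?c N = detN N M"
    unfolding cofactor_def detN_eq_det
    by (auto simp: mat_delete_def intro!: arg_cong[of _ _ Determinant.det])
  have "Determinant.det (?A f) = (\<Sum>j<Suc N. ?A f $$ (N, j) * cofactor (?A f) N j)"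
    for f by (rule laplace_expansion_row) auto
  then have "detN (Suc N) (\<lambda>i j. if i = N then f j else M i j) = (\<Sum>j\<le>N. ?c j * f j)" for f
    by (simp add: detN_eq_det cofactor_def del[of f] lessThan_Suc_atMost mult_ac)
  with 1 show thesis by (rule that[of ?c])
qed

text \<open>As a function \<open>g\<close> of the last node, the determinant is a sum of
  \<open>N + 1\<close> powers that vanishes at the \<open>N\<close> larger nodes, so it has no root
  in \<open>(0, z N]\<close>. Its sign there is the sign near 0, which belongs to the smallest
  exponent \<open>e N\<close>; the coefficient of that term is the determinant of size
  \<open>N\<close>, positive by induction.\<close>

lemma detN_powers_pos:
  assumes "\<And>i j. i < j \<Longrightarrow> j < N \<Longrightarrow> e j < e i" "\<And>i j. i < j \<Longrightarrow> j < N \<Longrightarrow> z j < z i"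
    "\<And>i. i < N \<Longrightarrow> 0 < z i"
  shows "0 < detN N (\<lambda>i j. z i ^ e j :: real)"
  using assms
proof (induction N)
  case 0
  show ?case by (simp add: detN_def)
next
  case (Suc N)
  have IH: "0 < detN N (\<lambda>i j. z i ^ e j)" using Suc by auto
  obtain c where c: "c N = detN N (\<lambda>i j. z i ^ e j)"
    "\<And>f. detN (Suc N) (\<lambda>i j. if i = N then f j else z i ^ e j) = (\<Sum>j\<le>N. c j * f j)"
    using detN_last_row[of N "\<lambda>i j. z i ^ e j"] by blast
  define g where "g t = (\<Sum>j\<le>N. c j * t ^ e j)" for t
  have inje: "inj_on e {..N}"
    using Suc.prems(1) by (auto simp: inj_on_def) (metis less_Suc_eq_le less_irrefl linorder_neqE_nat)
  have injz: "inj_on z {..<N}"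
    using Suc.prems(2) by (auto simp: inj_on_def) (metis less_Suc_eq less_irrefl linorder_neqE_nat)
  have gz: "g (z i) = 0" if "i < N" for i
  proof -
    let ?A = "mat (Suc N) (Suc N) (\<lambda>(l, j). if l = N then z i ^ e j else z l ^ e j)"
    have "Determinant.det ?A = 0"
      by (rule det_identical_rows[of _ "Suc N" i N]) (use that in \<open>auto intro!: eq_vecI\<close>)
    then show ?thesis using c(2)[of "\<lambda>j. z i ^ e j"] by (simp add: detN_eq_det g_def)
  qed
  have no_root: "g t \<noteq> 0" if "0 < t" "t \<le> z N" for t
  proof
    assume "g t = 0"
    have tz: "t < z i" if "i < N" for i using Suc.prems(2)[of i N] that \<open>t \<le> z N\<close> by auto
    have "card (insert t (z ` {..<N})) + card ({} :: real set) < card {..N}"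
    proof (rule card_roots_less[of _ e c])
      show "\<exists>j\<in>{..N}. c j \<noteq> 0" using c IH by force
      show "insert t (z ` {..<N}) \<subseteq> {0<..}" using Suc.prems(3) that by auto
      show "(\<Sum>j\<le>N. c j * s ^ e j) = 0" if "s \<in> insert t (z ` {..<N})" for s
        using that gz \<open>g t = 0\<close> by (auto simp: g_def)
    qed (use inje in auto)
    moreover have "t \<notin> z ` {..<N}" using tz by force
    ultimately show False using injz by (simp add: card_image)
  qed
  define q where "q t = (\<Sum>j\<le>N. c j * t ^ (e j - e N))" for t
  have gq: "g t = t ^ e N * q t" for t
    unfolding g_def q_def sum_distrib_left
  proof (intro sum.cong refl)
    fix j assume "j \<in> {..N}"
    then have "e N \<le> e j" using Suc.prems(1)[of j N] by (cases "j = N") auto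
    then show "c j * t ^ e j = t ^ e N * (c j * t ^ (e j - e N))"
      by (simp add: power_add[symmetric] mult_ac)
  qed
  have "q 0 = (\<Sum>j\<le>N. if j = N then c N else 0)"
    unfolding q_def
  proof (intro sum.cong refl)
    fix j assume "j \<in> {..N}"
    then show "c j * 0 ^ (e j - e N) = (if j = N then c N else 0)"
      using Suc.prems(1)[of j N] by (cases "j = N") auto
  qed
  then have q0: "q 0 > 0" using c IH by simp
  have zN: "z N > 0" using Suc.prems(3) by auto
  have "q (z N) > 0"
  proof (rule ccontr)
    assume "\<not> q (z N) > 0"
    moreover have "continuous_on {0..z N} q" unfolding q_def by (intro continuous_intros)
    ultimately obtain t where t: "0 \<le> t" "t \<le> z N" "q t = 0"
      using IVT2'[of q "z N" 0 0] q0 zN by auto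
    then have "t \<noteq> 0" using q0 by auto
    then show False using no_root[of t] gq[of t] t by auto
  qed
  then have "0 < g (z N)" using gq zN by simp
  also have "g (z N) = detN (Suc N) (\<lambda>i j. if i = N then z N ^ e j else z i ^ e j)"
    unfolding c(2) g_def ..
  also have "\<dots> = detN (Suc N) (\<lambda>i j. z i ^ e j)" by (rule detN_cong) auto
  finally show ?case .
qed

lemma ex_sorting_permutation:
  fixes x :: "nat \<Rightarrow> 'a::linorder"
  assumes "inj_on x {..<N}"
  obtains p where "p permutes {..<N}" "\<And>i j. i < j \<Longrightarrow> j < N \<Longrightarrow> x (p i) < x (p j)"
proof
  define s where "s = sorted_list_of_set (x ` {..<N})"
  have s: "length s = N" "set s = x ` {..<N}" "sorted_wrt (<) s"
    using assms by (auto simp: s_def card_image)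
  let ?p = "\<lambda>i. if i < N then the_inv_into {..<N} x (s ! i) else i"
  have xp: "x (?p i) = s ! i" "?p i < N" if "i < N" for i
  proof -
    have "s ! i \<in> x ` {..<N}" using that s nth_mem by metis
    then show "x (?p i) = s ! i" "?p i < N"
      using that f_the_inv_into_f[OF assms] the_inv_into_into[OF assms, of "s ! i" "{..<N}"] by auto
  qed
  show lt: "x (?p i) < x (?p j)" if "i < j" "j < N" for i j
    using that s sorted_wrt_nth_less[of "(<)" s i j] xp[of i] xp[of j] by simp
  have "inj_on ?p {..<N}"
  proof (rule inj_onI, rule ccontr)
    fix i j assume "i \<in> {..<N}" "j \<in> {..<N}" "?p i = ?p j" "i \<noteq> j"
    then show False using lt[of i j] lt[of j i] by (cases i j rule: linorder_cases) auto
  qed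
  moreover have "?p ` {..<N} \<subseteq> {..<N}" using xp by auto
  ultimately have "bij_betw ?p {..<N} {..<N}"
    unfolding bij_betw_def using endo_inj_surj[of "{..<N}" ?p] by blast
  then show "?p permutes {..<N}" by (rule bij_imp_permutes) simp
qed

text \<open>At distinct positive arguments, sorting them in decreasing order makes numerator and
  denominator positive, at the price of the same sign in both. The limit to repeated or vanishing
  arguments keeps the weak inequality.\<close>

lemma schur_nonneg:
  assumes e: "\<And>i j. i < j \<Longrightarrow> j < N \<Longrightarrow> lam j + N - 1 - j < lam i + N - 1 - i"
    and z: "\<And>i. i < N \<Longrightarrow> 0 \<le> z i"
  shows "0 \<le> schur N lam z"
proof (rule tendsto_lowerbound)
  let ?z = "\<lambda>t i. z i + t * real (Suc i)"
  show "((\<lambda>t. schur N lam (?z t)) \<longlongrightarrow> schur N lam z) (at_right 0)"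
    by (rule tendsto_perturb[OF poly_fun_continuous[OF poly_fun_schur]])
  have pos: "0 < schur N lam y" if inj: "inj_on y {..<N}" and y: "\<And>i. i < N \<Longrightarrow> 0 < y i" for y
  proof -
    have "inj_on (\<lambda>i. - y i) {..<N}" using inj by (auto simp: inj_on_def)
    then obtain p where p: "p permutes {..<N}" "\<And>i j. i < j \<Longrightarrow> j < N \<Longrightarrow> - y (p i) < - y (p j)"
      using ex_sorting_permutation by blast
    have "0 < detN N (\<lambda>i j. y (p i) ^ (lam j + N - 1 - j))"
      by (rule detN_powers_pos) (use p e y permutes_in_image[OF p(1)] in auto)
    moreover have "0 < detN N (\<lambda>i j. y (p i) ^ (N - 1 - j))"
      by (rule detN_powers_pos) (use p y permutes_in_image[OF p(1)] in auto)
    ultimately have "0 < real_of_int (sign p) * detN N (\<lambda>i j. y i ^ (lam j + N - 1 - j))"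
      "0 < real_of_int (sign p) * detN N (\<lambda>i j. y i ^ (N - 1 - j))"
      using detN_permute_rows[OF p(1), of "\<lambda>i j. y i ^ (lam j + N - 1 - j)"]
        detN_permute_rows[OF p(1), of "\<lambda>i j. y i ^ (N - 1 - j)"] by auto
    then show ?thesis
      unfolding schur_mult_Vandermonde[symmetric]
      by (auto simp: sign_def zero_less_mult_iff mult_less_0_iff split: if_splits)
  qed
  show "\<forall>\<^sub>F t in at_right 0. 0 \<le> schur N lam (?z t)"
    using eventually_inj_perturb[of z N] eventually_at_right_less[of 0]
  proof eventually_elim
    case (elim t)
    have "0 < z i + t * real (Suc i)" if "i < N" for i
      using z[OF that] elim(2) by (intro add_nonneg_pos) auto
    then show ?case using elim(1) by (intro less_imp_le pos) auto
  qed
qed simp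

subsection \<open>Substitution in one coordinate\<close>

lemma nn_integral_image_compact:
  fixes g g' :: "real \<Rightarrow> real" and f :: "real \<Rightarrow> ennreal"
  assumes S: "compact S"
    and der: "\<And>x. x \<in> S \<Longrightarrow> (g has_field_derivative g' x) (at x within S)"
    and g': "continuous_on S g'" and inj: "inj_on g S"
    and f: "f \<in> borel_measurable borel"
  shows "(\<integral>\<^sup>+y. f y * indicator (g ` S) y \<partial>lborel) =
    (\<integral>\<^sup>+x. f (g x) * ennreal \<bar>g' x\<bar> * indicator S x \<partial>lborel)"
proof -
  have S_borel [measurable]: "S \<in> sets borel" using S by (simp add: borel_compact)
  have cont: "continuous_on S g"
    using der by (meson DERIV_continuous continuous_on_eq_continuous_within)
  have gS_compact: "compact (g ` S)" by (rule compact_continuous_image[OF cont S])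
  have gS_borel [measurable]: "g ` S \<in> sets borel" using gS_compact by (simp add: borel_compact)
  \<comment> \<open>Extension by 0 gives Borel functions on the whole line, to which
    \<open>distr\<close> and \<open>density\<close> apply.\<close>
  define G where "G x = (if x \<in> S then g x else 0)" for x
  define G' where "G' x = (if x \<in> S then \<bar>g' x\<bar> else 0)" for x
  have G [measurable]: "G \<in> borel_measurable borel"
    unfolding G_def[abs_def] by (intro borel_measurable_continuous_on_if cont) auto
  have G' [measurable]: "G' \<in> borel_measurable borel"
    unfolding G'_def[abs_def]
    by (intro borel_measurable_continuous_on_if) (auto intro!: continuous_intros g')
  have main: "(\<integral>\<^sup>+x. ennreal (G' x * indicator (G -` E) x) \<partial>lborel) = emeasure lborel (E \<inter> g ` S)"
    if E: "E \<in> sets borel" for E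
  proof -
    define SE where "SE = S \<inter> G -` E"
    have SE: "SE \<in> sets borel" using E measurable_sets[OF G E] by (simp add: SE_def)
    have im: "g ` SE = E \<inter> g ` S" by (auto simp: SE_def G_def)
    have "E \<inter> g ` S \<in> lmeasurable"
      using bounded_set_imp_lmeasurable[of "E \<inter> g ` S"] E gS_compact
      by (auto intro: bounded_subset compact_imp_bounded)
    then have "((\<lambda>x. 1::real) has_integral measure lebesgue (g ` SE)) (g ` SE)"
      unfolding im has_integral_restrict_UNIV[of "E \<inter> g ` S", symmetric] lmeasurable_iff_has_integral indicator_def of_bool_def .
    then have "(\<lambda>x. 1::real) absolutely_integrable_on (g ` SE)" "integral (g ` SE) (\<lambda>x. 1::real) = measure lebesgue (g ` SE)"
      by (auto intro: nonnegative_absolutely_integrable_1)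
    moreover have "SE \<in> sets lebesgue" using SE by simp
    moreover have "(g has_field_derivative g' x) (at x within SE)" if "x \<in> SE" for x
      using that der by (auto simp: SE_def intro: DERIV_subset)
    moreover have "inj_on g SE" using inj by (auto simp: SE_def intro: inj_on_subset)
    ultimately have *: "(\<lambda>x. \<bar>g' x\<bar> * 1) absolutely_integrable_on SE"
      "integral SE (\<lambda>x. \<bar>g' x\<bar> * 1) = measure lebesgue (g ` SE)"
      using has_absolute_integral_change_of_variables_1'[of SE g g' "\<lambda>_. 1" "measure lebesgue (g ` SE)"] by auto
    then have "((\<lambda>x. \<bar>g' x\<bar>) has_integral measure lebesgue (g ` SE)) SE"
      using set_lebesgue_integral_eq_integral(1) by (auto simp: has_integral_iff)
    then have "((\<lambda>x. if x \<in> SE then \<bar>g' x\<bar> else 0) has_integral measure lebesgue (g ` SE)) UNIV"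
      by (simp only: has_integral_restrict_UNIV)
    also have "(\<lambda>x. if x \<in> SE then \<bar>g' x\<bar> else 0) = (\<lambda>x. G' x * indicator (G -` E) x)"
      by (auto simp: G'_def SE_def fun_eq_iff indicator_def)
    finally have "(\<integral>\<^sup>+x. ennreal (G' x * indicator (G -` E) x) \<partial>lborel) = measure lebesgue (g ` SE)"
    proof (intro nn_integral_has_integral_lborel)
      have "G -` E \<in> sets borel" using measurable_sets[OF G E] by simp
      then show "(\<lambda>x. G' x * indicator (G -` E) x) \<in> borel_measurable borel" by simp
    qed (auto simp: G'_def)
    also have "\<dots> = emeasure lebesgue (E \<inter> g ` S)"
      unfolding im using fmeasurableD2[OF \<open>E \<inter> g ` S \<in> lmeasurable\<close>] by (rule emeasure_eq_ennreal_measure[symmetric])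
    also have "\<dots> = emeasure lborel (E \<inter> g ` S)"
      using E by (simp add: emeasure_completion)
    finally show ?thesis .
  qed
  have "distr (density lborel (\<lambda>x. ennreal (G' x))) borel G = density lborel (indicator (g ` S))"
  proof (rule measure_eqI)
    fix E assume "E \<in> sets (distr (density lborel (\<lambda>x. ennreal (G' x))) borel G)"
    then have E [measurable]: "E \<in> sets borel" by simp
    have "G -` E \<in> sets borel" using measurable_sets[OF G E] by simp
    show "emeasure (distr (density lborel (\<lambda>x. ennreal (G' x))) borel G) E =
        emeasure (density lborel (indicator (g ` S))) E"
    proof -
      have "emeasure (distr (density lborel (\<lambda>x. ennreal (G' x))) borel G) E =
          (\<integral>\<^sup>+x. ennreal (G' x) * indicator (G -` E) x \<partial>lborel)"
        using \<open>G -` E \<in> sets borel\<close> by (simp add: emeasure_distr emeasure_density)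
      also have "\<dots> = (\<integral>\<^sup>+x. ennreal (G' x * indicator (G -` E) x) \<partial>lborel)"
        by (intro nn_integral_cong) (auto simp: indicator_def)
      also have "\<dots> = (\<integral>\<^sup>+x. indicator (E \<inter> g ` S) x \<partial>lborel)"
        unfolding main[OF E] by (rule nn_integral_indicator[symmetric]) simp
      also have "\<dots> = (\<integral>\<^sup>+x. indicator (g ` S) x * indicator E x \<partial>lborel)"
        by (intro nn_integral_cong) (auto simp: indicator_def)
      also have "\<dots> = emeasure (density lborel (indicator (g ` S))) E"
        by (simp add: emeasure_density)
      finally show ?thesis .
    qed
  qed simp
  then have "(\<integral>\<^sup>+y. f y \<partial>density lborel (indicator (g ` S))) =
      (\<integral>\<^sup>+y. f y \<partial>distr (density lborel (\<lambda>x. ennreal (G' x))) borel G)"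
    by simp
  also have "\<dots> = (\<integral>\<^sup>+x. ennreal (G' x) * f (G x) \<partial>lborel)"
    using f by (simp add: nn_integral_distr nn_integral_density)
  also have "\<dots> = (\<integral>\<^sup>+x. f (g x) * ennreal \<bar>g' x\<bar> * indicator S x \<partial>lborel)"
    by (intro nn_integral_cong) (auto simp: G_def G'_def mult.commute)
  finally show ?thesis using f by (simp add: nn_integral_density mult.commute)
qed

section \<open>Product Lebesgue measure and substitution in a single coordinate\<close>

abbreviation lebP :: "'i set \<Rightarrow> ('i \<Rightarrow> real) measure" where
  "lebP I \<equiv> PiM I (\<lambda>_. lborel)"

lemma space_lebN: "space (lebN n) = {..<n} \<rightarrow>\<^sub>E UNIV"
  by (simp add: space_PiM)

text \<open>Continuity and compactness refer to the topology on all functions, whereas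
  \<open>lebN n\<close> lives on functions that are \<open>undefined\<close> outside
  \<open>{..<n}\<close>. The identity carries Borel sets and functions over to
  \<open>lebN n\<close>.\<close>

lemma measurable_lebN_borel: "(\<lambda>x. x) \<in> measurable (lebN n) (borel :: (nat \<Rightarrow> real) measure)"
proof -
  have "(\<lambda>x. x) \<in> measurable (lebN n) (PiM UNIV (\<lambda>_. borel :: real measure))"
  proof (rule measurable_PiM_single')
    fix i :: nat
    show "(\<lambda>x. x i) \<in> borel_measurable (lebN n)"
    proof (cases "i < n")
      case False
      then have "(\<lambda>x. x i) \<in> borel_measurable (lebN n) \<longleftrightarrow> (\<lambda>x. undefined :: real) \<in> borel_measurable (lebN n)"
        by (intro measurable_cong) (auto simp: space_PiM PiE_def extensional_def)
      then show ?thesis by simp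
    qed (simp add: measurable_component_singleton)
  qed auto
  then show ?thesis by (simp cong: measurable_cong_sets add: sets_PiM_equal_borel)
qed

lemma borel_measurable_lebN:
  "f \<in> measurable (borel :: (nat \<Rightarrow> real) measure) N \<Longrightarrow> f \<in> measurable (lebN n) N"
  using measurable_comp[OF measurable_lebN_borel] by (simp add: o_def)

lemma compact_sets_lebN:
  assumes "compact A" "A \<subseteq> {..<n} \<rightarrow>\<^sub>E UNIV"
  shows "A \<in> sets (lebN n)"
  using measurable_sets[OF measurable_lebN_borel[of n], of A] assms
  by (simp add: borel_compact space_lebN Int_absorb2)

text \<open>Tonelli isolates coordinate \<open>k\<close>; on each line in that direction the claim
  is the one-dimensional change of variables. The second conclusion makes the new integrand a valid
  input for the next substitution.\<close>

lemma nn_integral_coordinate_subst: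
  fixes A :: "(nat \<Rightarrow> real) set" and h :: "(nat \<Rightarrow> real) \<Rightarrow> ennreal"
  assumes A: "compact A" "A \<subseteq> {..<n} \<rightarrow>\<^sub>E UNIV" and k: "k < n"
    and \<sigma>: "continuous_on A \<sigma>" and d: "continuous_on A d"
    and inj: "inj_on (\<lambda>v. v(k := \<sigma> v)) A"
    and der: "\<And>v. v \<in> A \<Longrightarrow>
      ((\<lambda>s. \<sigma> (v(k := s))) has_field_derivative d v) (at (v k) within {s. v(k := s) \<in> A})"
    and h: "h \<in> borel_measurable borel"
  shows "(\<integral>\<^sup>+v. h v * indicator ((\<lambda>v. v(k := \<sigma> v)) ` A) v \<partial>lebN n) =
      (\<integral>\<^sup>+v. h (v(k := \<sigma> v)) * ennreal \<bar>d v\<bar> * indicator A v \<partial>lebN n)" (is ?int)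
    and "(\<lambda>v. h (v(k := \<sigma> v)) * ennreal \<bar>d v\<bar> * indicator A v) \<in> borel_measurable borel" (is ?meas)
proof -
  interpret product_sigma_finite "\<lambda>_::nat. lborel :: real measure"
    by standard
  define S where "S v = v(k := \<sigma> v)" for v
  define I where "I = {..<n} - {k}"
  have I: "finite I" "k \<notin> I" "{..<n} = insert k I" using k by (auto simp: I_def)
  have contS: "continuous_on A S"
    unfolding S_def[abs_def]
  proof (rule continuous_on_coordinatewise_then_product)
    fix i
    have "continuous_on A (\<lambda>v. v i)" by (rule continuous_on_subset[OF continuous_on_product_coordinates]) simp
    then show "continuous_on A (\<lambda>v. (v(k := \<sigma> v)) i)" using \<sigma> by (cases "i = k") auto
  qed
  have A_borel [measurable]: "A \<in> sets borel" using A by (simp add: borel_compact)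
  have SA_borel [measurable]: "S ` A \<in> sets borel"
    using compact_continuous_image[OF contS A(1)] by (simp add: borel_compact)
  define S' where "S' v = (if v \<in> A then S v else (\<lambda>_. 0))" for v
  define d' where "d' v = (if v \<in> A then \<bar>d v\<bar> else 0)" for v
  have S' [measurable]: "S' \<in> borel_measurable borel"
    unfolding S'_def[abs_def] by (intro borel_measurable_continuous_on_if contS) auto
  have d' [measurable]: "d' \<in> borel_measurable borel"
    unfolding d'_def[abs_def]
    by (intro borel_measurable_continuous_on_if) (auto intro!: continuous_intros d)
  note h [measurable]
  have m1: "(\<lambda>v. h v * indicator (S ` A) v) \<in> borel_measurable (lebP (insert k I))"
    unfolding I(3)[symmetric] by (rule borel_measurable_lebN) measurable
  have m2: "(\<lambda>v. h (S' v) * ennreal (d' v)) \<in> borel_measurable (lebP (insert k I))"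
    unfolding I(3)[symmetric] by (rule borel_measurable_lebN) measurable
  have "(\<integral>\<^sup>+v. h v * indicator (S ` A) v \<partial>lebN n) =
      (\<integral>\<^sup>+x. \<integral>\<^sup>+s. h (x(k := s)) * indicator (S ` A) (x(k := s)) \<partial>lborel \<partial>lebP I)"
    unfolding I(3) by (rule product_nn_integral_insert[OF I(1,2) m1])
  also have "\<dots> = (\<integral>\<^sup>+x. \<integral>\<^sup>+s. h (S' (x(k := s))) * ennreal (d' (x(k := s))) \<partial>lborel \<partial>lebP I)"
  proof (rule nn_integral_cong)
    fix x assume "x \<in> space (lebP I)"
    define T where "T = {s. x(k := s) \<in> A}"
    define g where "g s = \<sigma> (x(k := s))" for s
    have cont_upd: "continuous_on U (\<lambda>s. x(k := s))" for U
    proof (rule continuous_on_coordinatewise_then_product)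
      show "continuous_on U (\<lambda>s. (x(k := s)) i)" for i by (cases "i = k") auto
    qed
    \<comment> \<open>The slice is the projection of the points of \<open>A\<close> that agree with
      \<open>x\<close> off \<open>k\<close>; this exhibits it as the continuous image of a compact
      set.\<close>
    have T_im: "T = (\<lambda>v. v k) ` (A \<inter> (\<Inter>i\<in>-{k}. {v. v i = x i}))"
    proof (intro equalityI subsetI)
      fix s assume "s \<in> T"
      then show "s \<in> (\<lambda>v. v k) ` (A \<inter> (\<Inter>i\<in>-{k}. {v. v i = x i}))"
        by (intro image_eqI[of _ _ "x(k := s)"]) (auto simp: T_def)
    next
      fix s assume "s \<in> (\<lambda>v. v k) ` (A \<inter> (\<Inter>i\<in>-{k}. {v. v i = x i}))"
      then obtain v where v: "s = v k" "v \<in> A" "\<And>i. i \<noteq> k \<Longrightarrow> v i = x i" by auto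
      then have "x(k := s) = v" by (auto simp: fun_eq_iff)
      then show "s \<in> T" using v by (simp add: T_def)
    qed
    have "compact (A \<inter> (\<Inter>i\<in>-{k}. {v. v i = x i}))"
      by (intro compact_Int_closed A(1) closed_INT ballI closed_Collect_eq) (auto intro!: continuous_intros)
    then have T: "compact T" unfolding T_im
      by (rule compact_continuous_image[rotated])
        (rule continuous_on_subset[OF continuous_on_product_coordinates], simp)
    have mem: "x(k := s) \<in> S ` A \<longleftrightarrow> s \<in> g ` T" for s
    proof
      assume "x(k := s) \<in> S ` A"
      then obtain v where v: "v \<in> A" "x(k := s) = v(k := \<sigma> v)" by (auto simp: S_def)
      then have "x(k := v k) = v" by (metis fun_upd_idem_iff fun_upd_upd)
      moreover have "s = \<sigma> v" using v(2) by (metis fun_upd_same)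
      ultimately show "s \<in> g ` T" using v by (intro image_eqI[of _ _ "v k"]) (auto simp: g_def T_def)
    next
      assume "s \<in> g ` T"
      then show "x(k := s) \<in> S ` A"
        by (auto simp: g_def T_def S_def intro!: image_eqI[of _ _ "x(k := _)"])
    qed
    have "(\<integral>\<^sup>+s. h (x(k := s)) * indicator (S ` A) (x(k := s)) \<partial>lborel) =
        (\<integral>\<^sup>+s. h (x(k := s)) * indicator (g ` T) s \<partial>lborel)"
      by (intro nn_integral_cong) (auto simp: indicator_def mem)
    also have "\<dots> = (\<integral>\<^sup>+s. h (x(k := g s)) * ennreal \<bar>d (x(k := s))\<bar> * indicator T s \<partial>lborel)"
    proof (rule nn_integral_image_compact[OF T])
      show "(g has_field_derivative d (x(k := s))) (at s within T)" if "s \<in> T" for s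
        using der[of "x(k := s)"] that by (simp add: T_def g_def[abs_def])
      show "continuous_on T (\<lambda>s. d (x(k := s)))"
        by (rule continuous_on_compose2[OF d cont_upd]) (auto simp: T_def)
      show "inj_on g T"
      proof (rule inj_onI)
        fix s t assume st: "s \<in> T" "t \<in> T" "g s = g t"
        then have "x(k := s) = x(k := t)"
          using inj_onD[OF inj, of "x(k := s)" "x(k := t)"] by (simp add: T_def g_def)
        then show "s = t" by (metis fun_upd_same)
      qed
      show "(\<lambda>s. h (x(k := s))) \<in> borel_measurable borel"
        by (rule measurable_compose[OF borel_measurable_continuous_onI[OF cont_upd] h])
    qed
    also have "\<dots> = (\<integral>\<^sup>+s. h (S' (x(k := s))) * ennreal (d' (x(k := s))) \<partial>lborel)"
      by (intro nn_integral_cong) (auto simp: S'_def d'_def T_def S_def g_def indicator_def)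
    finally show "(\<integral>\<^sup>+s. h (x(k := s)) * indicator (S ` A) (x(k := s)) \<partial>lborel) =
        (\<integral>\<^sup>+s. h (S' (x(k := s))) * ennreal (d' (x(k := s))) \<partial>lborel)" .
  qed
  also have "\<dots> = (\<integral>\<^sup>+v. h (S' v) * ennreal (d' v) \<partial>lebN n)"
    unfolding I(3) by (rule product_nn_integral_insert[OF I(1,2) m2, symmetric])
  also have "\<dots> = (\<integral>\<^sup>+v. h (S v) * ennreal \<bar>d v\<bar> * indicator A v \<partial>lebN n)"
    by (intro nn_integral_cong) (auto simp: S'_def d'_def indicator_def)
  finally show ?int unfolding S_def[abs_def] by simp
  have "(\<lambda>v. h (S' v) * ennreal (d' v)) = (\<lambda>v. h (v(k := \<sigma> v)) * ennreal \<bar>d v\<bar> * indicator A v)"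
    by (auto simp: fun_eq_iff S'_def d'_def S_def indicator_def)
  moreover have "(\<lambda>v. h (S' v) * ennreal (d' v)) \<in> borel_measurable borel" by measurable
  ultimately show ?meas by simp
qed

subsection \<open>The parametrisation by nodes and weights\<close>

lemmas continuous_on_fun = continuous_on_coordinatewise_then_product

lemma sum_pairs:
  fixes f :: "nat \<Rightarrow> 'a::comm_monoid_add"
  shows "(\<Sum>a<n. f a) = (\<Sum>i<(n + 1) div 2. f (2 * i) + (if 2 * i + 1 < n then f (2 * i + 1) else 0))"
proof -
  have even: "(\<Sum>a<2 * q. f a) = (\<Sum>i<q. f (2 * i) + f (2 * i + 1))" for q
    by (induction q) (auto simp: add_ac)
  show ?thesis
  proof (cases "even n")
    case True
    then obtain q where "n = 2 * q" by blast
    then show ?thesis using even[of q] by (auto intro!: sum.cong)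
  next
    case False
    then obtain q where q: "n = 2 * q + 1" using oddE by blast
    have "(\<Sum>i<q. f (2 * i) + (if 2 * i + 1 < n then f (2 * i + 1) else 0)) =
        (\<Sum>i<q. f (2 * i) + f (2 * i + 1))"
      using q by (intro sum.cong) auto
    then show ?thesis using even[of q] q by simp
  qed
qed

lemma continuous_on_coordinate: "continuous_on S (\<lambda>x. x i :: real)"
  by (rule continuous_on_subset[OF continuous_on_product_coordinates]) simp

text \<open>Tychonoff, with the singleton \<open>{undefined}\<close> as factor at every index
  outside \<open>{..<n}\<close>.\<close>

lemma compact_box:
  assumes "compact (B :: real set)"
  shows "compact ({..<n::nat} \<rightarrow>\<^sub>E B)"
proof -
  let ?S = "\<lambda>i. if i < n then B else {undefined}"
  have "compactin (product_topology (\<lambda>_. euclidean) UNIV) (PiE UNIV ?S)"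
    unfolding compactin_PiE using assms by auto
  moreover have "PiE UNIV ?S = ({..<n} \<rightarrow>\<^sub>E B)"
  proof (intro equalityI subsetI)
    fix f assume "f \<in> PiE UNIV ?S"
    then have f: "f i \<in> ?S i" for i by (rule PiE_mem) simp
    show "f \<in> {..<n} \<rightarrow>\<^sub>E B"
    proof (rule PiE_I)
      show "f i \<in> B" if "i \<in> {..<n}" for i using f[of i] that by simp
      show "f i = undefined" if "i \<notin> {..<n}" for i using f[of i] that by simp
    qed
  next
    fix f assume f: "f \<in> {..<n} \<rightarrow>\<^sub>E B"
    have "f i \<in> ?S i" for i
      using PiE_mem[OF f, of i] PiE_arb[OF f, of i] by (cases "i < n") simp_all
    then show "f \<in> PiE UNIV ?S" by (intro PiE_I) simp_all
  qed
  ultimately show ?thesis by (simp add: euclidean_product_topology)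
qed

lemma continuous_on_pdd2:
  assumes "continuous_on S f" "continuous_on S g"
  shows "continuous_on S (\<lambda>s. pdd [f s, g s] d)"
  using assms unfolding pdd_def
  by (cases "Suc d < 2") (auto simp: hsym.simps(2) intro!: continuous_intros)

lemma continuous_on_detN:
  assumes "\<And>i j. continuous_on S (\<lambda>s. M s i j)"
  shows "continuous_on S (\<lambda>s. detN k (M s))"
  using assms unfolding detN_def by (intro continuous_intros)

locale monomial_curve =
  fixes n :: nat and e :: "nat \<Rightarrow> nat"
  assumes n_pos: "0 < n"
    and e_pos: "j < n \<Longrightarrow> 0 < e j"
    and e_dec: "i < j \<Longrightarrow> j < n \<Longrightarrow> e j < e i"
begin

text \<open>For odd \<open>n\<close> this count includes the fixed node 1; the free nodes number
  \<open>n div 2\<close>.\<close>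

definition num_nodes :: nat where
  "num_nodes = (n + 1) div 2"

text \<open>A parameter \<open>u\<close> lists weight and node alternately; for odd \<open>n\<close> the last node is the end
  point \<open>1\<close>, which is not a free parameter. The unused mass sits at the node \<open>0\<close>.\<close>

definition node :: "(nat \<Rightarrow> real) \<Rightarrow> nat \<Rightarrow> real" where
  "node u i = (if 2 * i + 1 < n then u (2 * i + 1) else 1)"

definition Phi :: "(nat \<Rightarrow> real) \<Rightarrow> nat \<Rightarrow> real" where
  "Phi u j = (\<Sum>i<num_nodes. u (2 * i) * node u i ^ e j)"

definition nodes_ok :: "(nat \<Rightarrow> real) \<Rightarrow> bool" where
  "nodes_ok \<nu> \<longleftrightarrow> 0 < \<nu> 0 \<and> (\<forall>i. Suc i < num_nodes \<longrightarrow> \<nu> i < \<nu> (Suc i)) \<and> \<nu> (num_nodes - 1) \<le> 1"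

definition params :: "(nat \<Rightarrow> real) set" where
  "params = {u \<in> {..<n} \<rightarrow>\<^sub>E UNIV. (\<forall>i<num_nodes. 0 < u (2 * i)) \<and> (\<Sum>i<num_nodes. u (2 * i)) \<le> 1 \<and>
    nodes_ok (node u)}"

definition partial_map :: "nat \<Rightarrow> (nat \<Rightarrow> real) \<Rightarrow> nat \<Rightarrow> real" where
  "partial_map k u j = (if j < k then Phi u j else u j)"

text \<open>Matrix of secants of \<open>Phi\<close> between \<open>u\<close> and \<open>v\<close>;
  on the diagonal it is the Jacobian, with rows indexed by parameters. The mixture of
  \<open>u\<close> and \<open>v\<close> comes from
  \<open>w x^e - w' y^e = (w - w') x^e + w' (x^e - y^e)\<close>: a weight row takes its node from
  \<open>u\<close>, a node row takes its weight from \<open>v\<close>.\<close>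

definition jac :: "(nat \<Rightarrow> real) \<Rightarrow> (nat \<Rightarrow> real) \<Rightarrow> nat \<Rightarrow> nat \<Rightarrow> real" where
  "jac u v a j = (if even a then node u (a div 2) ^ e j
     else v (a - 1) * pdd [node u (a div 2), node v (a div 2)] (e j))"

lemma num_nodes_pos: "0 < num_nodes"
  using n_pos by (simp add: num_nodes_def)

lemma inj_on_e: "inj_on e {..<n}"
  unfolding inj_on_def using e_dec by (metis lessThan_iff less_irrefl linorder_neqE_nat)

lemma nodes_ok_mono:
  assumes "nodes_ok \<nu>" "i < i'" "i' < num_nodes"
  shows "\<nu> i < \<nu> i'"
  using assms(2,3)
proof (induction i')
  case (Suc i')
  have "\<nu> i' < \<nu> (Suc i')" using assms(1) Suc.prems by (auto simp: nodes_ok_def)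
  then show ?case using Suc by (cases "i = i'") auto
qed simp

lemma nodes_ok_bounds:
  assumes "nodes_ok \<nu>" "i < num_nodes"
  shows "0 < \<nu> i" "\<nu> i \<le> 1"
proof -
  have "0 < \<nu> 0" "\<nu> (num_nodes - 1) \<le> 1" using assms by (auto simp: nodes_ok_def)
  moreover have "0 < i \<Longrightarrow> \<nu> 0 < \<nu> i" "i < num_nodes - 1 \<Longrightarrow> \<nu> i < \<nu> (num_nodes - 1)"
    using nodes_ok_mono[OF assms(1), of 0 i] nodes_ok_mono[OF assms(1), of i "num_nodes - 1"] assms(2) by auto
  ultimately show "0 < \<nu> i" "\<nu> i \<le> 1"
    using assms(2) by (cases "i = 0"; cases "i = num_nodes - 1"; force)+
qed

lemma params_nodes_ok: "u \<in> params \<Longrightarrow> nodes_ok (node u)"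
  by (simp add: params_def)

lemmas node_mono = nodes_ok_mono[OF params_nodes_ok]
lemmas node_bounds = nodes_ok_bounds[OF params_nodes_ok]

text \<open>Equal nodes are merged and the node 0 drops out because all exponents are positive. At
  most \<open>k\<close> distinct positive nodes then satisfy \<open>k\<close> equations, so
  independence of power sums makes every merged coefficient vanish. The lemma is applied to the
  difference of two representations.\<close>

lemma grouped_coeffs_zero:
  fixes a c :: "'i \<Rightarrow> real"
  assumes I: "finite I" and a: "\<And>i. i \<in> I \<Longrightarrow> 0 \<le> a i"
    and card: "card (a ` I - {0}) \<le> k" "k \<le> n"
    and 0: "\<And>j. j < k \<Longrightarrow> (\<Sum>i\<in>I. c i * a i ^ e j) = 0" and "0 < b"
  shows "(\<Sum>i | i \<in> I \<and> a i = b. c i) = 0"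
proof (cases "b \<in> a ` I")
  case True
  define \<mu> where "\<mu> b = (\<Sum>i | i \<in> I \<and> a i = b. c i)" for b
  have "\<mu> b = 0"
  proof (rule power_sums_independent[of "{..<k}" e "a ` I - {0}" \<mu> b])
    fix j assume j: "j \<in> {..<k}"
    have "0 = (\<Sum>i\<in>I. c i * a i ^ e j)" using 0 j by simp
    also have "\<dots> = (\<Sum>b\<in>a ` I. \<Sum>i | i \<in> I \<and> a i = b. c i * a i ^ e j)"
      using I by (rule sum.image_gen)
    also have "\<dots> = (\<Sum>b\<in>a ` I. \<mu> b * b ^ e j)"
      unfolding \<mu>_def sum_distrib_right by (intro sum.cong refl) auto
    also have "\<dots> = (\<Sum>b\<in>a ` I - {0}. \<mu> b * b ^ e j)"
      using I e_pos[of j] j card by (intro sum.mono_neutral_right) auto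
    finally show "(\<Sum>b\<in>a ` I - {0}. \<mu> b * b ^ e j) = 0" by simp
  next
    show "inj_on e {..<k}" using inj_on_subset[OF inj_on_e] card by auto
    show "a ` I - {0} \<subseteq> {0<..}" using a by (force simp: less_le)
  qed (use I card True \<open>0 < b\<close> in auto)
  then show ?thesis by (simp add: \<mu>_def)
next
  case False
  then have *: "{i. i \<in> I \<and> a i = b} = {}" by auto
  show ?thesis unfolding * by simp
qed

text \<open>Parameters with index at least \<open>k\<close> are shared, so only the first
  \<open>K\<close> nodes of each side enter the difference. They have at most \<open>k\<close>
  distinct values, hence at each value the total weights on the two sides agree; positivity and
  ordering recover nodes and weights.\<close>

lemma partial_map_inj:
  assumes "k \<le> n"
  shows "inj_on (partial_map k) params"
proof (rule inj_onI)
  fix u v assume u: "u \<in> params" and v: "v \<in> params" and eq: "partial_map k u = partial_map k v"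
  have hi: "u j = v j" if "k \<le> j" for j
    using fun_cong[OF eq, of j] that by (simp add: partial_map_def)
  have lo: "Phi u j = Phi v j" if "j < k" for j
    using fun_cong[OF eq, of j] that by (simp add: partial_map_def)
  define K where "K = (k + 1) div 2"
  have K: "K \<le> num_nodes" "k \<le> 2 * K" using assms by (auto simp: K_def num_nodes_def)
  have tail: "node u i = node v i" if "K \<le> i \<or> k = 2 * i + 1" for i
    using that K(2) hi[of "2 * i + 1"] by (auto simp: node_def)
  define I where "I = {..<K} <+> {..<K}"
  define a where "a = case_sum (node u) (node v)"
  define c where "c = case_sum (\<lambda>i. u (2 * i)) (\<lambda>i. - v (2 * i))"
  have I_sum: "(\<Sum>i\<in>I. f i) = (\<Sum>i<K. f (Inl i)) + (\<Sum>i<K. f (Inr i))" for f :: "nat + nat \<Rightarrow> real"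
    unfolding I_def by (subst sum.Plus) auto
  have aI: "a ` I = node u ` {..<K} \<union> node v ` {..<K}"
    by (force simp: I_def a_def)
  have zero: "(\<Sum>i | i \<in> I \<and> a i = b. c i) = 0" if "0 < b" for b
  proof (rule grouped_coeffs_zero[of I a k])
    show "0 \<le> a i" if "i \<in> I" for i
      using that node_bounds(1)[OF u] node_bounds(1)[OF v] K by (force simp: I_def a_def less_imp_le)
    have "card (node u ` {..<K} \<union> node v ` {..<K}) \<le> k"
    proof (cases "even k")
      case True
      have "card (node u ` {..<K} \<union> node v ` {..<K}) \<le> card (node u ` {..<K}) + card (node v ` {..<K})"
        by (rule card_Un_le)
      also have "\<dots> \<le> K + K" by (intro add_mono card_image_le[THEN order_trans]) auto
      finally show ?thesis using True by (auto simp: K_def)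
    next
      case False
      \<comment> \<open>For odd \<open>k\<close> the node with number \<open>K - 1\<close> is stored
        at index \<open>k\<close>, which is not yet replaced. It is common to both sides, and this
        saves the one node needed for the bound \<open>k\<close>.\<close>
      then have k: "k = 2 * (K - 1) + 1" "K > 0" by (auto simp: K_def elim!: oddE)
      then have "{..<K} = insert (K - 1) {..<K - 1}" by auto
      then have "node u ` {..<K} \<union> node v ` {..<K} = node u ` {..<K} \<union> node v ` {..<K - 1}"
        using tail[of "K - 1"] k by auto
      also have "card \<dots> \<le> card (node u ` {..<K}) + card (node v ` {..<K - 1})"
        by (rule card_Un_le)
      also have "\<dots> \<le> K + (K - 1)" by (intro add_mono card_image_le[THEN order_trans]) auto
      finally show ?thesis using k by simp
    qed
    then show "card (a ` I - {0}) \<le> k"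
      unfolding aI by (meson card_Diff1_le finite_UnI finite_imageI finite_lessThan order_trans)
    fix j assume j: "j < k"
    have split: "{..<num_nodes} = {..<K} \<union> {K..<num_nodes}" "{..<K} \<inter> {K..<num_nodes} = {}" using K by auto
    have "Phi u j - Phi v j = (\<Sum>i<K. u (2 * i) * node u i ^ e j) - (\<Sum>i<K. v (2 * i) * node v i ^ e j)
        + ((\<Sum>i=K..<num_nodes. u (2 * i) * node u i ^ e j) - (\<Sum>i=K..<num_nodes. v (2 * i) * node v i ^ e j))"
      unfolding Phi_def split by (subst (1 2) sum.union_disjoint) auto
    also have "(\<Sum>i=K..<num_nodes. u (2 * i) * node u i ^ e j) = (\<Sum>i=K..<num_nodes. v (2 * i) * node v i ^ e j)"
      using tail hi K(2) by (intro sum.cong) auto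
    finally show "(\<Sum>i\<in>I. c i * a i ^ e j) = 0"
      using lo[OF j] unfolding I_sum by (simp add: c_def a_def sum_negf)
  qed (use that assms in \<open>auto simp: I_def\<close>)
  define f where "f w b = (\<Sum>i | i < K \<and> node w i = b. w (2 * i))" for w b
  have inj: "node w i = node w i' \<longleftrightarrow> i = i'" if "w \<in> params" "i < K" "i' < K" for w i i'
    using node_mono[OF that(1), of i i'] node_mono[OF that(1), of i' i] that K
    by (cases i i' rule: linorder_cases) auto
  have f_node: "f w (node w l) = w (2 * l)" if "w \<in> params" "l < K" for w l
  proof -
    have "{i. i < K \<and> node w i = node w l} = {l}" using inj that by auto
    then show ?thesis by (simp add: f_def)
  qed
  have f_eq: "f u b = f v b" if "0 < b" for b
  proof -
    have "{i. i \<in> I \<and> a i = b} = {i. i < K \<and> node u i = b} <+> {i. i < K \<and> node v i = b}"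
      by (force simp: I_def a_def)
    then show ?thesis using zero[OF that] by (simp add: sum.Plus c_def sum_negf f_def)
  qed
  \<comment> \<open>A node absent from the other side would have total weight 0 there, contrary to
    its positive weight here.\<close>
  have sub: "node w l \<in> node w' ` {..<K}"
    if w: "w \<in> params" and l: "l < K" and eq: "\<And>b. 0 < b \<Longrightarrow> f w b = f w' b" for w w' l
  proof (rule ccontr)
    assume no: "node w l \<notin> node w' ` {..<K}"
    have "node w' i \<noteq> node w l" if "i < K" for i
      using no imageI[of i "{..<K}" "node w'"] that by (simp only: lessThan_iff) metis
    then have *: "{i. i < K \<and> node w' i = node w l} = {}" by blast
    have "f w' (node w l) = 0" unfolding f_def * by simp
    then have "w (2 * l) = 0"
      using eq[of "node w l"] f_node[OF w l] node_bounds(1)[OF w, of l] l K by simp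
    moreover have "0 < w (2 * l)" using w l K by (simp add: params_def)
    ultimately show False by simp
  qed
  have "map (node u) [0..<K] = map (node v) [0..<K]"
  proof (rule sorted_distinct_set_unique)
    show "sorted (map (node u) [0..<K])" "sorted (map (node v) [0..<K])"
      using node_mono[OF u] node_mono[OF v] K by (auto simp: sorted_iff_nth_mono_less less_imp_le)
    show "distinct (map (node u) [0..<K])" "distinct (map (node v) [0..<K])"
      using inj u v by (auto simp: distinct_map inj_on_def)
    show "set (map (node u) [0..<K]) = set (map (node v) [0..<K])"
      using sub[OF u _ f_eq] sub[OF v _ f_eq[symmetric]] by (auto simp: lessThan_atLeast0)
  qed
  then have nodes: "node u i = node v i" if "i < K" for i using that by simp
  have weights: "u (2 * i) = v (2 * i)" if "i < K" for i
    using f_eq[of "node u i"] f_node[OF u that] f_node[OF v that] nodes[OF that]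
      node_bounds(1)[OF u, of i] that K by simp
  show "u = v"
  proof
    fix j
    show "u j = v j"
    proof (cases "j < k")
      case True
      then have "j div 2 < K" by (auto simp: K_def)
      show ?thesis
      proof (cases "even j")
        case True
        then show ?thesis using weights[OF \<open>j div 2 < K\<close>] by simp
      next
        case False
        then have "2 * (j div 2) + 1 = j" by presburger
        then show ?thesis using nodes[OF \<open>j div 2 < K\<close>] \<open>j < k\<close> assms by (simp add: node_def)
      qed
    qed (use hi in simp)
  qed
qed

text \<open>An exact identity for finite increments: divided differences absorb the nonlinearity in
  the nodes.\<close>

lemma Phi_diff: "Phi u j - Phi v j = (\<Sum>a<n. (u a - v a) * jac u v a j)"
  unfolding sum_pairs[where n = n] Phi_def num_nodes_def[symmetric] sum_subtractf[symmetric]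
proof (intro sum.cong refl)
  fix i assume "i \<in> {..<num_nodes}"
  have "(node u i - node v i) * pdd [node u i, node v i] (e j) = node u i ^ e j - node v i ^ e j"
    by (rule power_diff_pdd[symmetric])
  moreover have "node u i - node v i = (if 2 * i + 1 < n then u (2 * i + 1) - v (2 * i + 1) else 0)"
    by (simp add: node_def)
  ultimately have "v (2 * i) * (node u i ^ e j - node v i ^ e j) =
      (if 2 * i + 1 < n then (u (2 * i + 1) - v (2 * i + 1)) * jac u v (2 * i + 1) j else 0)"
    by (auto simp: jac_def mult_ac)
  then show "u (2 * i) * node u i ^ e j - v (2 * i) * node v i ^ e j = (u (2 * i) - v (2 * i)) * jac u v (2 * i) j +
      (if 2 * i + 1 < n then (u (2 * i + 1) - v (2 * i + 1)) * jac u v (2 * i + 1) j else 0)"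
    by (simp add: jac_def algebra_simps)
qed

text \<open>A kernel vector is a combination of \<open>k\<close> powers. Even rows make the first
  \<open>K\<close> nodes roots; odd rows, after cancelling a positive weight, make the first
  \<open>k div 2\<close> of them double roots. As \<open>K + k div 2 = k\<close>, this is one root
  too many.\<close>

lemma detN_jac_nonzero:
  assumes "u \<in> params" "k \<le> n"
  shows "detN k (jac u u) \<noteq> 0"
proof
  assume "detN k (jac u u) = 0"
  then obtain w where w: "\<exists>j<k. w j \<noteq> 0" "\<And>i. i < k \<Longrightarrow> (\<Sum>j<k. jac u u i j * w j) = 0"
    by (rule detN_zero_kernel) blast
  define K where "K = (k + 1) div 2"
  have K: "K \<le> num_nodes" using assms by (auto simp: K_def num_nodes_def)
  have inj: "inj_on (node u) {..<K}"
  proof (rule inj_onI, rule ccontr)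
    fix i i' assume "i \<in> {..<K}" "i' \<in> {..<K}" "node u i = node u i'" "i \<noteq> i'"
    then show False using node_mono[OF assms(1), of i i'] node_mono[OF assms(1), of i' i] K
      by (cases i i' rule: linorder_cases) auto
  qed
  have "card (node u ` {..<K}) + card (node u ` {..<k div 2}) < card {..<k}"
  proof (rule card_roots_less[of "{..<k}" e w])
    show "inj_on e {..<k}" using inj_on_subset[OF inj_on_e] assms by auto
    show "node u ` {..<K} \<subseteq> {0<..}" using node_bounds(1)[OF assms(1)] K by auto
    show "node u ` {..<k div 2} \<subseteq> node u ` {..<K}" by (auto simp: K_def)
    show "(\<Sum>j<k. w j * t ^ e j) = 0" if "t \<in> node u ` {..<K}" for t
    proof -
      from that obtain i where "t = node u i" "i < K" by auto
      moreover from this have "2 * i < k" by (auto simp: K_def)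
      ultimately show ?thesis using w(2)[of "2 * i"] by (simp add: jac_def mult.commute)
    qed
    show "(\<Sum>j<k. w j * (real (e j) * t ^ (e j - 1))) = 0" if "t \<in> node u ` {..<k div 2}" for t
    proof -
      from that obtain i where i: "t = node u i" "i < k div 2" by auto
      then have i: "t = node u i" "2 * i + 1 < k" by auto
      have "0 = (\<Sum>j<k. jac u u (2 * i + 1) j * w j)" using w(2)[OF i(2)] by simp
      also have "\<dots> = u (2 * i) * (\<Sum>j<k. w j * (real (e j) * t ^ (e j - 1)))"
        unfolding sum_distrib_left by (intro sum.cong) (auto simp: jac_def pdd_confluent i mult_ac)
      moreover have "0 < u (2 * i)" using assms i by (auto simp: params_def num_nodes_def)
      ultimately show ?thesis by simp
    qed
  qed (use w in auto)
  moreover have "inj_on (node u) {..<k div 2}" by (rule inj_on_subset[OF inj]) (auto simp: K_def)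
  ultimately have "K + k div 2 < k" using inj by (simp add: card_image)
  then show False by (simp add: K_def)
qed

section \<open>Continuity, and the change of variables one coordinate at a time\<close>

lemma continuous_on_node: "continuous_on S f \<Longrightarrow> continuous_on S (\<lambda>s. node (f s) i)"
  unfolding node_def by (cases "2 * i + 1 < n") (auto intro: continuous_on_product_then_coordinatewise)

lemma continuous_on_detN_jac:
  assumes "continuous_on S f" "continuous_on S g"
  shows "continuous_on S (\<lambda>s. detN k (jac (f s) (g s)))"
proof (rule continuous_on_detN)
  show "continuous_on S (\<lambda>s. jac (f s) (g s) i j)" for i j
  proof (cases "even i")
    case True
    then show ?thesis
      unfolding jac_def by (simp only: if_True) (intro continuous_on_power continuous_on_node assms)
  next
    case False
    then show ?thesis
      unfolding jac_def
      by (simp only: if_False) (intro continuous_on_mult continuous_on_pdd2 continuous_on_node assms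
          continuous_on_product_then_coordinatewise[OF assms(2)])
  qed
qed

lemma continuous_on_Phi: "continuous_on S f \<Longrightarrow> continuous_on S (\<lambda>s. Phi (f s) j)"
  unfolding Phi_def
  by (intro continuous_on_sum continuous_on_mult continuous_on_power continuous_on_node
      continuous_on_product_then_coordinatewise[of S f])

lemma continuous_on_partial_map: "continuous_on S (partial_map k)"
proof (rule continuous_on_fun)
  show "continuous_on S (\<lambda>u. partial_map k u j)" for j
    unfolding partial_map_def
    by (cases "j < k") (simp_all add: continuous_on_Phi[OF continuous_on_id, unfolded id_def] continuous_on_coordinate)
qed

lemma partial_map_Suc: "partial_map (Suc k) u = (partial_map k u)(k := Phi u k)"
  by (auto simp: partial_map_def fun_eq_iff less_Suc_eq)

lemma partial_map_PiE: "k \<le> n \<Longrightarrow> u \<in> {..<n} \<rightarrow>\<^sub>E UNIV \<Longrightarrow> partial_map k u \<in> {..<n} \<rightarrow>\<^sub>E UNIV"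
  by (auto simp: partial_map_def PiE_def extensional_def)

text \<open>The derivative of \<open>Phi u k\<close> along the curve on which all other coordinates of
  \<open>partial_map k u\<close> stay fixed is a quotient of consecutive Jacobian minors.\<close>

lemma partial_map_derivative:
  assumes C: "compact C" "C \<subseteq> params" and k: "k < n" and \<tau>: "\<And>u. u \<in> C \<Longrightarrow> \<tau> (partial_map k u) = u"
    and u0: "u0 \<in> C" and v: "v = partial_map k u0"
  shows "((\<lambda>s. Phi (\<tau> (v(k := s))) k) has_field_derivative
      detN (Suc k) (jac u0 u0) / detN k (jac u0 u0)) (at (v k) within {s. v(k := s) \<in> partial_map k ` C})"
proof -
  define S where "S = {s. v(k := s) \<in> partial_map k ` C}"
  define w where "w s = \<tau> (v(k := s))" for s
  have w: "w s \<in> C" "partial_map k (w s) = v(k := s)" if "s \<in> S" for s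
    using that \<tau> by (auto simp: S_def w_def)
  have vk: "v k \<in> S" "w (v k) = u0" using u0 \<tau> v by (auto simp: S_def w_def)
  \<comment> \<open>A continuous injection on a compact set has a continuous inverse; this makes the
    parameter path \<open>w\<close> continuous in \<open>s\<close>.\<close>
  have "continuous_on (partial_map k ` C) \<tau>"
    by (rule continuous_on_inv[OF continuous_on_partial_map C(1)]) (simp add: \<tau>)
  moreover have "continuous_on S (\<lambda>s. v(k := s))"
  proof (rule continuous_on_fun)
    show "continuous_on S (\<lambda>s. (v(k := s)) i)" for i by (cases "i = k") auto
  qed
  ultimately have cw: "continuous_on S w"
    unfolding w_def[abs_def] by (rule continuous_on_compose2) (auto simp: S_def)
  have lim: "((\<lambda>s. detN l (jac (w s) u0)) \<longlongrightarrow> detN l (jac u0 u0)) (at (v k) within S)" for l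
    using continuous_on_detN_jac[OF cw continuous_on_const[of S u0], of l] vk
    by (auto simp: continuous_on_def)
  have ne: "detN k (jac u0 u0) \<noteq> 0" using detN_jac_nonzero[of u0 k] C u0 k by auto
  have quot: "detN (Suc k) (jac (w s) u0) / detN k (jac (w s) u0) = (Phi (w s) k - Phi (w (v k)) k) / (s - v k)"
    if s: "s \<in> S" "s \<noteq> v k" and ne: "detN k (jac (w s) u0) \<noteq> 0" for s
  proof -
    have pm: "partial_map k (w s) j = (if j = k then s else partial_map k u0 j)" for j
      using w(2)[OF s(1)] v by (simp add: fun_eq_iff)
    have hi: "w s j = u0 j" if "k < j" for j using pm[of j] that by (simp add: partial_map_def)
    have lo: "Phi (w s) j = Phi u0 j" if "j < k" for j using pm[of j] that by (simp add: partial_map_def)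
    have wk: "w s k = s" "u0 k = v k" using pm[of k] v by (auto simp: partial_map_def)
    \<comment> \<open>Only parameters with index at most \<open>k\<close> move, and the curve
      coordinates below \<open>k\<close> stay fixed. The increments therefore solve a square system
      whose right-hand side is zero except in the last entry.\<close>
    have "(w s k - u0 k) * detN (Suc k) (jac (w s) u0) = (Phi (w s) k - Phi u0 k) * detN k (jac (w s) u0)"
    proof (rule detN_cramer_last[where x = "\<lambda>a. w s a - u0 a"])
      fix j assume "j \<le> k"
      have "(\<Sum>i\<le>k. (w s i - u0 i) * jac (w s) u0 i j) = (\<Sum>i<n. (w s i - u0 i) * jac (w s) u0 i j)"
        using k hi by (intro sum.mono_neutral_left) auto
      also have "\<dots> = Phi (w s) j - Phi u0 j" by (rule Phi_diff[symmetric])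
      finally show "(\<Sum>i\<le>k. (w s i - u0 i) * jac (w s) u0 i j) = (if j = k then Phi (w s) k - Phi u0 k else 0)"
        using lo \<open>j \<le> k\<close> by auto
    qed
    then show ?thesis using s ne wk vk by (simp add: field_simps)
  qed
  have lim2: "((\<lambda>s. detN (Suc k) (jac (w s) u0) / detN k (jac (w s) u0)) \<longlongrightarrow>
      detN (Suc k) (jac u0 u0) / detN k (jac u0 u0)) (at (v k) within S)"
    by (intro tendsto_divide lim ne)
  have "\<forall>\<^sub>F s in at (v k) within S. detN k (jac (w s) u0) \<noteq> 0"
    using tendsto_imp_eventually_ne[OF lim ne] .
  moreover have "\<forall>\<^sub>F s in at (v k) within S. s \<in> S \<and> s \<noteq> v k"
    by (simp add: eventually_at_filter)
  ultimately have "\<forall>\<^sub>F s in at (v k) within S. detN (Suc k) (jac (w s) u0) / detN k (jac (w s) u0) =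
      (Phi (w s) k - Phi (w (v k)) k) / (s - v k)"
    by eventually_elim (simp add: quot)
  with lim2 have "((\<lambda>s. (Phi (w s) k - Phi (w (v k)) k) / (s - v k)) \<longlongrightarrow>
      detN (Suc k) (jac u0 u0) / detN k (jac u0 u0)) (at (v k) within S)"
    by (rule Lim_transform_eventually)
  then show ?thesis by (simp add: has_field_derivative_iff S_def w_def)
qed

text \<open>The derivative of step \<open>k\<close> is a quotient of consecutive minors, so the
  product over all steps telescopes. The claim is for arbitrary \<open>h\<close> because the
  induction hypothesis is applied to \<open>h'\<close>, which has absorbed the derivative and the
  indicator.\<close>

lemma nn_integral_partial_map:
  assumes C: "compact C" "C \<subseteq> params" and "k \<le> n" and h: "h \<in> borel_measurable borel"
  shows "(\<integral>\<^sup>+v. h v * indicator (partial_map k ` C) v \<partial>lebN n) =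
    (\<integral>\<^sup>+u. h (partial_map k u) * ennreal \<bar>detN k (jac u u)\<bar> * indicator C u \<partial>lebN n)"
  using \<open>k \<le> n\<close> h
proof (induction k arbitrary: h)
  case 0
  have "partial_map 0 = (\<lambda>u. u)" by (auto simp: partial_map_def fun_eq_iff)
  then show ?case by (simp add: detN_def)
next
  case (Suc k)
  have k: "k < n" "k \<le> n" using Suc.prems by auto
  define A where "A = partial_map k ` C"
  define \<tau> where "\<tau> = the_inv_into C (partial_map k)"
  have inj: "inj_on (partial_map k) C" using partial_map_inj[OF k(2)] C inj_on_subset by blast
  have \<tau>: "\<tau> (partial_map k u) = u" if "u \<in> C" for u
    unfolding \<tau>_def by (rule the_inv_into_f_f[OF inj that])
  have A: "compact A" unfolding A_def by (rule compact_continuous_image[OF continuous_on_partial_map C(1)])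
  have CP: "C \<subseteq> {..<n} \<rightarrow>\<^sub>E UNIV" using C by (auto simp: params_def)
  have AP: "A \<subseteq> {..<n} \<rightarrow>\<^sub>E UNIV" using partial_map_PiE[OF k(2)] CP by (auto simp: A_def)
  have c\<tau>: "continuous_on A \<tau>"
    unfolding A_def by (rule continuous_on_inv[OF continuous_on_partial_map C(1)]) (simp add: \<tau>)
  define \<sigma> where "\<sigma> v = Phi (\<tau> v) k" for v
  define d where "d v = detN (Suc k) (jac (\<tau> v) (\<tau> v)) / detN k (jac (\<tau> v) (\<tau> v))" for v
  have c\<sigma>: "continuous_on A \<sigma>" unfolding \<sigma>_def[abs_def] by (rule continuous_on_Phi[OF c\<tau>])
  have ne: "detN k (jac u u) \<noteq> 0" if "u \<in> C" for u using detN_jac_nonzero[of u k] C k that by auto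
  have cd: "continuous_on A d"
    unfolding d_def[abs_def] using ne \<tau>
    by (intro continuous_on_divide continuous_on_detN_jac c\<tau>) (auto simp: A_def)
  have upd: "(partial_map k u)(k := \<sigma> (partial_map k u)) = partial_map (Suc k) u" if "u \<in> C" for u
    using \<tau>[OF that] by (simp add: \<sigma>_def partial_map_Suc)
  have im: "(\<lambda>v. v(k := \<sigma> v)) ` A = partial_map (Suc k) ` C"
    unfolding A_def image_image using upd by (intro image_cong refl)
  have inj2: "inj_on (\<lambda>v. v(k := \<sigma> v)) A"
  proof (rule inj_onI)
    fix x y assume "x \<in> A" "y \<in> A" and eq: "x(k := \<sigma> x) = y(k := \<sigma> y)"
    then obtain u w where uw: "u \<in> C" "w \<in> C" "x = partial_map k u" "y = partial_map k w" by (auto simp: A_def)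
    then have "partial_map (Suc k) u = partial_map (Suc k) w" using eq upd by metis
    then have "u = w" using uw C partial_map_inj[OF Suc.prems(1)] by (auto dest: inj_onD)
    then show "x = y" using uw by simp
  qed
  note h = Suc.prems(2)
  define h' where "h' v = h (v(k := \<sigma> v)) * ennreal \<bar>d v\<bar> * indicator A v" for v
  have der: "((\<lambda>s. \<sigma> (v(k := s))) has_field_derivative d v) (at (v k) within {s. v(k := s) \<in> A})" if "v \<in> A" for v
  proof -
    from that obtain u0 where u0: "u0 \<in> C" "v = partial_map k u0" by (auto simp: A_def)
    then have "\<tau> v = u0" using \<tau> by simp
    then show ?thesis
      unfolding \<sigma>_def d_def A_def by (simp only: partial_map_derivative[OF C k(1) \<tau> u0])
  qed
  note subst = nn_integral_coordinate_subst[OF A AP k(1) c\<sigma> cd inj2 der h]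
  have h': "h' \<in> borel_measurable borel" unfolding h'_def[abs_def] by (rule subst(2))
  have "(\<integral>\<^sup>+v. h v * indicator (partial_map (Suc k) ` C) v \<partial>lebN n) =
      (\<integral>\<^sup>+v. h (v(k := \<sigma> v)) * ennreal \<bar>d v\<bar> * indicator A v \<partial>lebN n)"
    unfolding im[symmetric] by (rule subst(1))
  also have "\<dots> = (\<integral>\<^sup>+v. h' v * indicator (partial_map k ` C) v \<partial>lebN n)"
    by (intro nn_integral_cong) (auto simp: h'_def A_def indicator_def)
  also have "\<dots> = (\<integral>\<^sup>+u. h' (partial_map k u) * ennreal \<bar>detN k (jac u u)\<bar> * indicator C u \<partial>lebN n)"
    by (rule Suc.IH[OF k(2) h'])
  also have "\<dots> = (\<integral>\<^sup>+u. h (partial_map (Suc k) u) * ennreal \<bar>detN (Suc k) (jac u u)\<bar> * indicator C u \<partial>lebN n)"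
  proof (intro nn_integral_cong)
    fix u
    show "h' (partial_map k u) * ennreal \<bar>detN k (jac u u)\<bar> * indicator C u =
        h (partial_map (Suc k) u) * ennreal \<bar>detN (Suc k) (jac u u)\<bar> * indicator C u"
    proof (cases "u \<in> C")
      case True
      then have "partial_map k u \<in> A" by (simp add: A_def)
      moreover have "\<bar>d (partial_map k u)\<bar> * \<bar>detN k (jac u u)\<bar> = \<bar>detN (Suc k) (jac u u)\<bar>"
        using \<tau>[OF True] ne[OF True] by (simp add: d_def abs_divide)
      then have "ennreal \<bar>d (partial_map k u)\<bar> * ennreal \<bar>detN k (jac u u)\<bar> = ennreal \<bar>detN (Suc k) (jac u u)\<bar>"
        by (simp add: ennreal_mult[symmetric])
      ultimately show ?thesis using upd[OF True] by (simp add: h'_def mult.assoc)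
    qed simp
  qed
  finally show ?case .
qed

text \<open>Compact pieces that exhaust \<open>params\<close>: each strict inequality receives the
  margin \<open>\<delta>\<close>. The substitution is available only on compact sets.\<close>

definition params_margin :: "real \<Rightarrow> (nat \<Rightarrow> real) set" where
  "params_margin \<delta> = {u \<in> {..<n} \<rightarrow>\<^sub>E {0..1}. (\<forall>i<num_nodes. \<delta> \<le> u (2 * i)) \<and> (\<Sum>i<num_nodes. u (2 * i)) \<le> 1 \<and>
    \<delta> \<le> node u 0 \<and> (\<forall>i. Suc i < num_nodes \<longrightarrow> \<delta> \<le> node u (Suc i) - node u i) \<and> node u (num_nodes - 1) \<le> 1}"

lemma compact_params_margin: "compact (params_margin \<delta>)"
proof -
  let ?X = "(\<Inter>i<num_nodes. {u. \<delta> \<le> u (2 * i)}) \<inter> {u. (\<Sum>i<num_nodes. u (2 * i)) \<le> 1} \<inter> {u. \<delta> \<le> node u 0} \<inter>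
    (\<Inter>i\<in>{i. Suc i < num_nodes}. {u. \<delta> \<le> node u (Suc i) - node u i}) \<inter> {u. node u (num_nodes - 1) \<le> 1}"
  have "closed ?X"
    by (intro closed_Int closed_INT ballI closed_Collect_le continuous_on_const continuous_on_sum
        continuous_on_diff continuous_on_node continuous_on_coordinate continuous_on_id)
  moreover have "params_margin \<delta> = ({..<n} \<rightarrow>\<^sub>E {0..1}) \<inter> ?X" by (auto simp: params_margin_def)
  ultimately show ?thesis by (simp add: compact_Int_closed compact_box)
qed

lemma params_margin_subset: "0 < \<delta> \<Longrightarrow> params_margin \<delta> \<subseteq> params"
proof
  fix u assume \<delta>: "0 < \<delta>" and u: "u \<in> params_margin \<delta>"
  have "node u i < node u (Suc i)" if "Suc i < num_nodes" for i
  proof -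
    have "\<delta> \<le> node u (Suc i) - node u i" using u that by (auto simp: params_margin_def)
    then show ?thesis using \<delta> by simp
  qed
  moreover have "0 < u (2 * i)" if "i < num_nodes" for i
    using u that \<delta> by (auto simp: params_margin_def intro: less_le_trans)
  ultimately show "u \<in> params"
    using u \<delta> by (auto simp: params_margin_def params_def nodes_ok_def PiE_iff)
qed

lemma params_margin_antimono: "\<delta> \<le> \<delta>' \<Longrightarrow> params_margin \<delta>' \<subseteq> params_margin \<delta>"
  unfolding params_margin_def by (auto intro: order_trans)

lemma params_UN: "params = (\<Union>l. params_margin (1 / real (Suc l)))"
proof (intro equalityI subsetI)
  fix u assume u: "u \<in> params"
  \<comment> \<open>All quantities that must be positive for \<open>u\<close> to lie in
    \<open>params\<close>; they are finitely many, so their minimum leaves room for a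
    margin.\<close>
  define V where "V = (\<lambda>i. u (2 * i)) ` {..<num_nodes} \<union> insert (node u 0) ((\<lambda>i. node u (Suc i) - node u i) ` {i. Suc i < num_nodes})"
  have fin: "finite {i. Suc i < num_nodes}" by (rule finite_subset[of _ "{..<num_nodes}"]) auto
  have V: "finite V" "V \<noteq> {}" "\<And>x. x \<in> V \<Longrightarrow> 0 < x"
    using u fin by (auto simp: V_def params_def nodes_ok_def)
  then have "0 < Min V" by simp
  then obtain l where l: "1 / real (Suc l) < Min V" by (rule nat_approx_posE)
  have le: "1 / real (Suc l) \<le> x" if "x \<in> V" for x using l that V(1) Min_le[of V x] by linarith
  have box: "u \<in> {..<n} \<rightarrow>\<^sub>E {0..1}"
  proof (rule PiE_I)
    fix j assume j: "j \<in> {..<n}"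
    then have j2: "j div 2 < num_nodes" by (auto simp: num_nodes_def)
    show "u j \<in> {0..1}"
    proof (cases "even j")
      case True
      have "u (2 * (j div 2)) \<le> (\<Sum>i<num_nodes. u (2 * i))"
        by (rule member_le_sum) (use u j2 in \<open>auto simp: params_def less_imp_le\<close>)
      moreover have "0 < u (2 * (j div 2))" using u j2 by (auto simp: params_def)
      moreover have "(\<Sum>i<num_nodes. u (2 * i)) \<le> 1" using u by (auto simp: params_def)
      ultimately show ?thesis using True by simp
    next
      case False
      then have "2 * (j div 2) + 1 = j" by presburger
      then have "node u (j div 2) = u j" using j by (simp add: node_def)
      then show ?thesis using node_bounds[OF u j2] by simp
    qed
  next
    fix j assume "j \<notin> {..<n}"
    then show "u j = undefined" using u by (auto simp: params_def PiE_def extensional_def)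
  qed
  have "u \<in> params_margin (1 / real (Suc l))"
    using u box le unfolding params_margin_def params_def nodes_ok_def by (auto simp: V_def)
  then show "u \<in> (\<Union>l. params_margin (1 / real (Suc l)))" by blast
next
  fix u assume "u \<in> (\<Union>l. params_margin (1 / real (Suc l)))"
  then obtain l where "u \<in> params_margin (1 / real (Suc l))" by blast
  moreover have "params_margin (1 / real (Suc l)) \<subseteq> params" by (rule params_margin_subset) simp
  ultimately show "u \<in> params" by blast
qed

text \<open>Both sides are measures evaluated along the increasing compact pieces, so the identity
  passes to the union.\<close>

lemma emeasure_image_params:
  "emeasure (lebN n) (partial_map n ` params) =
    (\<integral>\<^sup>+u. ennreal \<bar>detN n (jac u u)\<bar> * indicator params u \<partial>lebN n)"
  "partial_map n ` params \<in> sets (lebN n)"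
proof -
  define C where "C l = params_margin (1 / real (Suc l))" for l
  define f where "f u = ennreal \<bar>detN n (jac u u)\<bar>" for u
  have C: "compact (C l)" "C l \<subseteq> params" "C l \<subseteq> {..<n} \<rightarrow>\<^sub>E UNIV" for l
    using params_margin_subset[of "1 / real (Suc l)"]
    by (auto simp: C_def compact_params_margin params_def)
  have "params_margin (1 / real (Suc l)) \<subseteq> params_margin (1 / real (Suc l'))" if "l \<le> l'" for l l'
    by (rule params_margin_antimono) (use that in \<open>simp add: frac_le\<close>)
  then have inc: "incseq C" "incseq (\<lambda>l. partial_map n ` C l)"
    by (auto simp: incseq_def C_def intro!: image_mono)
  have D: "params = (\<Union>l. C l)" by (simp add: C_def params_UN)
  have "(\<lambda>u. \<bar>detN n (jac u u)\<bar>) \<in> borel_measurable borel"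
    by (intro borel_measurable_continuous_onI continuous_intros continuous_on_detN_jac continuous_on_id)
  then have "f \<in> borel_measurable borel"
    unfolding f_def[abs_def] by (rule measurable_compose[OF _ measurable_ennreal])
  then have f: "f \<in> borel_measurable (lebN n)" by (rule borel_measurable_lebN)
  have Cs: "C l \<in> sets (lebN n)" for l by (rule compact_sets_lebN) (use C in auto)
  have ICs: "partial_map n ` C l \<in> sets (lebN n)" for l
  proof (rule compact_sets_lebN)
    show "compact (partial_map n ` C l)"
      by (rule compact_continuous_image[OF continuous_on_partial_map C(1)])
    show "partial_map n ` C l \<subseteq> {..<n} \<rightarrow>\<^sub>E UNIV"
      by (rule image_subsetI, rule partial_map_PiE[OF order_refl], rule subsetD[OF C(3)])
  qed
  show "partial_map n ` params \<in> sets (lebN n)" using ICs by (auto simp: D image_UN)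
  have eq: "emeasure (lebN n) (partial_map n ` C l) = emeasure (density (lebN n) f) (C l)" for l
    using nn_integral_partial_map[of "C l" n "\<lambda>_. 1"] C ICs Cs f
    by (simp add: emeasure_density f_def)
  have "emeasure (lebN n) (partial_map n ` params) = (SUP l. emeasure (lebN n) (partial_map n ` C l))"
    unfolding D image_UN by (rule SUP_emeasure_incseq[symmetric]) (use ICs inc in auto)
  also have "\<dots> = emeasure (density (lebN n) f) params"
    unfolding eq D by (rule SUP_emeasure_incseq) (use Cs inc in auto)
  also have "\<dots> = (\<integral>\<^sup>+u. f u * indicator params u \<partial>lebN n)"
    by (rule emeasure_density[OF f]) (use Cs in \<open>auto simp: D\<close>)
  finally show "emeasure (lebN n) (partial_map n ` params) =
    (\<integral>\<^sup>+u. ennreal \<bar>detN n (jac u u)\<bar> * indicator params u \<partial>lebN n)" by (simp add: f_def)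
qed

end

subsection \<open>Boundary representations of points of the hull\<close>

context monomial_curve
begin

definition atoms_point :: "nat \<Rightarrow> (nat \<Rightarrow> real) \<Rightarrow> (nat \<Rightarrow> real) \<Rightarrow> nat \<Rightarrow> real" where
  "atoms_point N W X = restrict (\<lambda>j. \<Sum>i<N. W i * X i ^ e j) {..<n}"

definition admissible :: "nat \<Rightarrow> (nat \<Rightarrow> real) \<Rightarrow> (nat \<Rightarrow> real) \<Rightarrow> bool" where
  "admissible N W X \<longleftrightarrow> (\<forall>i<N. 0 \<le> W i \<and> 0 \<le> X i \<and> X i \<le> 1) \<and> (\<Sum>i<N. W i) \<le> 1"

text \<open>Bounding the number of atoms makes the set compact. Nodes may coincide and weights may
  vanish, and total mass below 1 is allowed because an atom at 0 contributes nothing.\<close>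

definition atoms_hull :: "nat \<Rightarrow> (nat \<Rightarrow> real) set" where
  "atoms_hull N = {atoms_point N W X | W X. admissible N W X}"

text \<open>Representations of index at most \<open>n / 2\<close>: interior nodes count twice, the node \<open>1\<close> once and
  the node \<open>0\<close>, which carries the missing mass, not at all.\<close>

definition low_index :: "(nat \<Rightarrow> real) set" where
  "low_index = {y. \<exists>A w. finite A \<and> A \<subseteq> {0<..1} \<and> (\<forall>a\<in>A. 0 < w a) \<and> sum w A \<le> 1 \<and>
    card A + card (A \<inter> {..<1}) \<le> n \<and> y = restrict (\<lambda>j. \<Sum>a\<in>A. w a * a ^ e j) {..<n}}"

lemma atoms_point_cong:
  "(\<And>i. i < N \<Longrightarrow> W i = W' i \<and> X i = X' i) \<Longrightarrow> atoms_point N W X = atoms_point N W' X'"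
  unfolding atoms_point_def by (intro restrict_ext sum.cong) auto

lemma atoms_point_PiE: "atoms_point N W X \<in> {..<n} \<rightarrow>\<^sub>E UNIV"
  by (simp add: atoms_point_def)

lemma admissible_le_1:
  assumes "admissible N W X" "i < N"
  shows "W i \<le> 1"
proof -
  have "W i \<le> (\<Sum>i<N. W i)" by (rule member_le_sum) (use assms in \<open>auto simp: admissible_def\<close>)
  then show ?thesis using assms by (simp add: admissible_def)
qed

lemma compact_atoms_hull: "compact (atoms_hull N)"
proof -
  let ?B = "({..<N} \<rightarrow>\<^sub>E {0..1}) :: (nat \<Rightarrow> real) set"
  let ?W = "?B \<inter> {W. (\<Sum>i<N. W i) \<le> 1}"
  let ?f = "\<lambda>p. atoms_point N (fst p) (snd p)"
  have "closed {W :: nat \<Rightarrow> real. (\<Sum>i<N. W i) \<le> 1}"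
    by (intro closed_Collect_le continuous_on_sum continuous_on_coordinate continuous_on_const)
  then have "compact ?W" by (intro compact_Int_closed compact_box compact_Icc)
  then have "compact (?W \<times> ?B)" by (intro compact_Times compact_box compact_Icc)
  moreover have "continuous_on (?W \<times> ?B) ?f"
  proof (rule continuous_on_fun)
    fix j
    show "continuous_on (?W \<times> ?B) (\<lambda>p. ?f p j)"
    proof (cases "j < n")
      case True
      then show ?thesis unfolding atoms_point_def
        by simp (intro continuous_on_sum continuous_on_mult continuous_on_power
            continuous_on_product_then_coordinatewise[of _ fst] continuous_on_product_then_coordinatewise[of _ snd]
            continuous_on_fst continuous_on_snd continuous_on_id)
    qed (simp add: atoms_point_def)
  qed
  ultimately have "compact (?f ` (?W \<times> ?B))" by (intro compact_continuous_image)
  also have "?f ` (?W \<times> ?B) = atoms_hull N"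
  proof (intro equalityI subsetI)
    fix y assume "y \<in> ?f ` (?W \<times> ?B)"
    then obtain W X where WX: "W \<in> ?W" "X \<in> ?B" "y = atoms_point N W X" by auto
    have "W i \<in> {0..1}" "X i \<in> {0..1}" if "i < N" for i
      using PiE_mem[OF IntD1[OF WX(1)], of i] PiE_mem[OF WX(2), of i] that by simp_all
    then have "admissible N W X" using WX(1) by (auto simp: admissible_def)
    then show "y \<in> atoms_hull N" using WX by (auto simp: atoms_hull_def)
  next
    fix y assume "y \<in> atoms_hull N"
    then obtain W X where WX: "admissible N W X" "y = atoms_point N W X" by (auto simp: atoms_hull_def)
    have "W i \<le> 1" if "i < N" for i using admissible_le_1[OF WX(1) that] .
    then have "restrict W {..<N} \<in> ?W" "restrict X {..<N} \<in> ?B"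
      using WX(1) by (auto simp: admissible_def)
    moreover have "y = ?f (restrict W {..<N}, restrict X {..<N})"
      unfolding WX(2) fst_conv snd_conv by (rule atoms_point_cong) simp
    ultimately show "y \<in> ?f ` (?W \<times> ?B)" by blast
  qed
  finally show ?thesis .
qed

lemma atoms_hull_Un: "curve_hull (curve_pts n e) = (\<Union>N. atoms_hull N)"
proof (intro equalityI subsetI)
  fix y assume "y \<in> curve_hull (curve_pts n e)"
  define Q where "Q k c v \<longleftrightarrow> (\<forall>j<k. 0 \<le> c j \<and> v j \<in> curve_pts n e) \<and> (\<Sum>j<k. c j) = 1 \<and>
    y = (\<lambda>i. \<Sum>j<k. c j * v j i)" for k :: nat and c v
  have "\<exists>k c v. Q k c v"
    using \<open>y \<in> curve_hull (curve_pts n e)\<close> by (simp only: curve_hull_def mem_Collect_eq Q_def)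
  then obtain k c v where "Q k c v" by blast
  note Q = this[unfolded Q_def]
  note kcv = Q[THEN conjunct2, THEN conjunct1] Q[THEN conjunct2, THEN conjunct2]
  have c0: "0 \<le> c j" and vj: "v j \<in> curve_pts n e" if "j < k" for j
    using Q[THEN conjunct1] that by simp_all
  have "\<forall>j\<in>{..<k}. \<exists>p. 0 \<le> p \<and> p \<le> 1 \<and> v j = restrict (\<lambda>i. p ^ e i) {..<n}"
  proof
    fix j assume "j \<in> {..<k}"
    then have "v j \<in> curve_pts n e" using vj by simp
    then show "\<exists>p. 0 \<le> p \<and> p \<le> 1 \<and> v j = restrict (\<lambda>i. p ^ e i) {..<n}"
      unfolding curve_pts_def by auto
  qed
  from bchoice[OF this] obtain p where
    p: "\<And>j. j < k \<Longrightarrow> 0 \<le> p j \<and> p j \<le> 1 \<and> v j = restrict (\<lambda>i. p j ^ e i) {..<n}" by auto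
  have "y = atoms_point k c p"
  proof
    fix i
    show "y i = atoms_point k c p i"
    proof (cases "i < n")
      case True
      then show ?thesis unfolding kcv(2) atoms_point_def using p by simp
    next
      case False
      \<comment> \<open>Outside \<open>{..<n}\<close> every curve point is \<open>undefined\<close>,
        and a combination whose weights sum to 1 reproduces this value.\<close>
      then have "y i = (\<Sum>j<k. c j * undefined)" unfolding kcv(2) using p by simp
      then show ?thesis using kcv(1) False by (simp add: atoms_point_def sum_distrib_right[symmetric])
    qed
  qed
  moreover have "admissible k c p" using kcv(1) c0 p by (simp add: admissible_def)
  ultimately show "y \<in> (\<Union>N. atoms_hull N)" unfolding atoms_hull_def by blast
next
  fix y assume "y \<in> (\<Union>N. atoms_hull N)"
  then obtain N W X where WX: "admissible N W X" "y = atoms_point N W X" by (auto simp: atoms_hull_def)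
  \<comment> \<open>One additional atom, placed at 0, takes the missing mass.\<close>
  define c where "c j = (if j < N then W j else 1 - (\<Sum>i<N. W i))" for j
  define v where "v j = restrict (\<lambda>i. (if j < N then X j else 0) ^ e i) {..<n}" for j
  have 1: "0 \<le> c j \<and> v j \<in> curve_pts n e" if "j < Suc N" for j
  proof
    show "0 \<le> c j" using WX(1) by (simp add: c_def admissible_def)
    show "v j \<in> curve_pts n e"
      unfolding curve_pts_def mem_Collect_eq v_def
      by (rule exI[of _ "if j < N then X j else 0"]) (use WX(1) in \<open>simp add: admissible_def\<close>)
  qed
  have 2: "(\<Sum>j<Suc N. c j) = 1" by (simp add: c_def)
  have 3: "y = (\<lambda>i. \<Sum>j<Suc N. c j * v j i)"
  proof
    fix i
    show "y i = (\<Sum>j<Suc N. c j * v j i)"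
    proof (cases "i < n")
      case True
      then show ?thesis using e_pos[of i] by (simp add: WX(2) atoms_point_def c_def v_def)
    next
      case False
      then have "(\<Sum>j<Suc N. c j * v j i) = (\<Sum>j<Suc N. c j) * undefined"
        unfolding sum_distrib_right by (intro sum.cong) (auto simp: v_def)
      then show ?thesis using False 2 by (simp add: WX(2) atoms_point_def)
    qed
  qed
  show "y \<in> curve_hull (curve_pts n e)"
    unfolding curve_hull_def mem_Collect_eq
    by (intro exI[of _ "Suc N"] exI[of _ c] exI[of _ v] conjI allI impI) (use 1 2 3 in auto)
qed

text \<open>Coincident nodes are merged, and atoms with weight or node 0 are dropped; the index is
  counted after this reduction.\<close>

lemma group_atoms:
  fixes c a :: "nat \<Rightarrow> real"
  assumes I: "finite I" and c: "\<And>i. i \<in> I \<Longrightarrow> 0 \<le> c i" "sum c I \<le> 1"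
    and a: "\<And>i. i \<in> I \<Longrightarrow> 0 \<le> a i \<and> a i \<le> 1"
    and A: "A = a ` {i \<in> I. 0 < c i \<and> 0 < a i}"
    and card: "card A + card (A \<inter> {..<1}) \<le> n"
  shows "restrict (\<lambda>j. \<Sum>i\<in>I. c i * a i ^ e j) {..<n} \<in> low_index"
proof -
  define I' where "I' = {i \<in> I. 0 < c i \<and> 0 < a i}"
  define w where "w b = (\<Sum>i | i \<in> I' \<and> a i = b. c i)" for b
  have I': "finite I'" "I' \<subseteq> I" using I by (auto simp: I'_def)
  have group: "(\<Sum>b\<in>A. w b * f b) = (\<Sum>i\<in>I'. c i * f (a i))" for f
  proof -
    have "(\<Sum>i\<in>I'. c i * f (a i)) = (\<Sum>b\<in>A. \<Sum>i | i \<in> I' \<and> a i = b. c i * f (a i))"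
      unfolding A I'_def[symmetric] using I'(1) by (rule sum.image_gen)
    also have "\<dots> = (\<Sum>b\<in>A. w b * f b)"
      unfolding w_def sum_distrib_right by (intro sum.cong refl) auto
    finally show ?thesis ..
  qed
  have "0 < w b" if "b \<in> A" for b
    unfolding w_def
  proof (rule sum_pos)
    show "finite {i. i \<in> I' \<and> a i = b}" using I'(1) by simp
    show "{i. i \<in> I' \<and> a i = b} \<noteq> {}" using that by (auto simp: A I'_def)
  qed (auto simp: I'_def)
  moreover have "sum w A \<le> 1"
  proof -
    have "sum w A = sum c I'" using group[of "\<lambda>_. 1"] by simp
    also have "\<dots> \<le> sum c I" by (rule sum_mono2) (use I I' c in auto)
    finally show ?thesis using c by simp
  qed
  moreover have "restrict (\<lambda>j. \<Sum>i\<in>I. c i * a i ^ e j) {..<n} = restrict (\<lambda>j. \<Sum>b\<in>A. w b * b ^ e j) {..<n}"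
  proof (rule restrict_ext)
    fix j assume "j \<in> {..<n}"
    then have "0 < e j" by (simp add: e_pos)
    have "(\<Sum>i\<in>I. c i * a i ^ e j) = (\<Sum>i\<in>I'. c i * a i ^ e j)"
    proof (rule sum.mono_neutral_right)
      show "\<forall>i\<in>I - I'. c i * a i ^ e j = 0"
      proof
        fix i assume "i \<in> I - I'"
        then have "c i = 0 \<or> a i = 0" using c(1)[of i] a[of i] by (auto simp: I'_def)
        then show "c i * a i ^ e j = 0" using \<open>0 < e j\<close> by auto
      qed
    qed (use I I' in auto)
    then show "(\<Sum>i\<in>I. c i * a i ^ e j) = (\<Sum>b\<in>A. w b * b ^ e j)"
      by (simp add: group)
  qed
  moreover have "finite A" "A \<subseteq> {0<..1}" using I'(1) a by (auto simp: A I'_def)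
  ultimately show ?thesis using card unfolding low_index_def by blast
qed

text \<open>The index bound leaves room for at most \<open>num_nodes\<close> nodes. If all are
  present, sorting them gives a parameter in \<open>params\<close>; otherwise the point lies in the
  hull with fewer atoms, later shown to be null.\<close>

lemma low_index_cases:
  assumes "y \<in> low_index"
  shows "y \<in> partial_map n ` params \<union> atoms_hull (num_nodes - 1)"
proof -
  obtain A w where A: "finite A" "A \<subseteq> {0<..1}" "\<And>a. a \<in> A \<Longrightarrow> 0 < w a" "sum w A \<le> 1"
    and card: "card A + card (A \<inter> {..<1}) \<le> n"
    and y: "y = restrict (\<lambda>j. \<Sum>a\<in>A. w a * a ^ e j) {..<n}"
    using assms unfolding low_index_def by blast
  define s where "s = sorted_list_of_set A"
  have s: "set s = A" "sorted s" "distinct s" "length s = card A" "sorted_wrt (<) s"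
    using A(1) by (auto simp: s_def)
  have bij: "bij_betw ((!) s) {..<card A} A"
    by (rule bij_betw_nth) (simp_all only: s)
  have sA: "s ! i \<in> A" if "i < card A" for i using nth_mem[of i s] that by (simp only: s)
  have sums: "(\<Sum>i<card A. g (s ! i)) = (\<Sum>a\<in>A. g a)" for g :: "real \<Rightarrow> real"
    by (rule sum.reindex_bij_betw[OF bij])
  have split: "card A = card (A \<inter> {..<1}) + card (A \<inter> {1})"
  proof -
    have "A = (A \<inter> {..<1}) \<union> (A \<inter> {1})" using A(2) by auto
    then have "card A = card ((A \<inter> {..<1}) \<union> (A \<inter> {1}))" by simp
    also have "\<dots> = card (A \<inter> {..<1}) + card (A \<inter> {1})" using A(1) by (intro card_Un_disjoint) auto
    finally show ?thesis .
  qed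
  have one: "card (A \<inter> {1}) = (if 1 \<in> A then 1 else 0)" by auto
  have le: "card A \<le> num_nodes" using card split one by (auto simp: num_nodes_def split: if_splits)
  show ?thesis
  proof (cases "card A = num_nodes")
    case False
    define N where "N = num_nodes - 1"
    have N: "card A \<le> N" using False le by (simp add: N_def)
    define W where "W i = (if i < card A then w (s ! i) else 0)" for i
    define X where "X i = (if i < card A then s ! i else 0)" for i
    have pad: "(\<Sum>i<N. W i * f i) = (\<Sum>i<card A. w (s ! i) * f i)" for f
    proof -
      have "(\<Sum>i<N. W i * f i) = (\<Sum>i<card A. W i * f i)"
        using N by (intro sum.mono_neutral_right) (auto simp: W_def)
      then show ?thesis by (simp add: W_def)
    qed
    have "y = atoms_point N W X"
      unfolding y atoms_point_def
      by (rule restrict_ext) (simp add: pad X_def sums[of "\<lambda>a. w a * a ^ e _", symmetric])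
    moreover have "admissible N W X"
      unfolding admissible_def
    proof (intro conjI allI impI)
      show "(\<Sum>i<N. W i) \<le> 1" using pad[of "\<lambda>_. 1"] A(4) sums[of w] by simp
      fix i
      have "s ! i \<in> {0<..1} \<and> 0 < w (s ! i)" if "i < card A"
        using sA[OF that] A(2) A(3)[of "s ! i"] by blast
      then show "0 \<le> W i" "0 \<le> X i" "X i \<le> 1" by (auto simp: W_def X_def less_imp_le)
    qed
    ultimately show ?thesis by (auto simp: atoms_hull_def N_def)
  next
    case True
    define u where "u = restrict (\<lambda>l. if even l then w (s ! (l div 2)) else s ! (l div 2)) {..<n}"
    \<comment> \<open>For odd \<open>n\<close>, having \<open>num_nodes\<close> nodes all below 1
      would give index \<open>n + 1\<close>. So 1 is among the nodes, and being the largest possible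
      value it comes last.\<close>
    have last: "s ! i = 1" if "2 * i + 1 = n" for i
    proof -
      have i: "num_nodes = Suc i" "n = 2 * i + 1" using that by (auto simp: num_nodes_def)
      have "1 \<in> A" using True card split one i by (auto split: if_splits)
      then have "1 \<in> set s" by (simp only: s)
      then obtain l where l: "l < length s" "s ! l = 1" by (auto simp: in_set_conv_nth)
      then have l: "l < Suc i" "s ! l = 1" using s(4) True i by simp_all
      have "l = i"
      proof (rule ccontr)
        assume "l \<noteq> i"
        then have "s ! l < s ! i" using l sorted_wrt_nth_less[OF s(5), of l i] s True i by simp
        moreover have "s ! i \<le> 1" using sA[of i] A(2) True i by auto
        ultimately show False using l by simp
      qed
      then show ?thesis using l by simp
    qed
    have w: "u (2 * i) = w (s ! i)" if "i < num_nodes" for i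
      using that by (auto simp: u_def num_nodes_def)
    have x: "node u i = s ! i" if "i < num_nodes" for i
    proof (cases "2 * i + 1 < n")
      case False
      then have "2 * i + 1 = n" using that by (auto simp: num_nodes_def)
      then show ?thesis using last False by (simp add: node_def)
    qed (simp add: node_def u_def)
    have mem: "s ! i \<in> A" if "i < num_nodes" for i using sA that True by simp
    have "u \<in> params"
      unfolding params_def nodes_ok_def mem_Collect_eq
    proof (intro conjI allI impI)
      show "u \<in> {..<n} \<rightarrow>\<^sub>E UNIV" by (simp add: u_def)
      show "0 < u (2 * i)" if "i < num_nodes" for i using w mem A(3) that by simp
      show "(\<Sum>i<num_nodes. u (2 * i)) \<le> 1" using sums[of w] A(4) w True by simp
      have "node u 0 \<in> A" "node u (num_nodes - 1) \<in> A" using x mem num_nodes_pos by auto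
      then show "0 < node u 0" "node u (num_nodes - 1) \<le> 1" using A(2) by auto
      show "node u i < node u (Suc i)" if "Suc i < num_nodes" for i
        using that x sorted_wrt_nth_less[OF s(5), of i "Suc i"] s True by simp
    qed
    moreover have "partial_map n u = y"
    proof
      fix j
      show "partial_map n u j = y j"
      proof (cases "j < n")
        case True
        have "(\<Sum>i<num_nodes. u (2 * i) * node u i ^ e j) = (\<Sum>i<num_nodes. w (s ! i) * (s ! i) ^ e j)"
          using w x by (intro sum.cong) auto
        then show ?thesis
          using True sums[of "\<lambda>a. w a * a ^ e j"] \<open>card A = num_nodes\<close> by (simp add: partial_map_def Phi_def y)
      qed (simp add: partial_map_def u_def y)
    qed
    ultimately show ?thesis by blast
  qed
qed

text \<open>Limits of low-index representations may merge nodes or lose weight. Dropping order and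
  positivity gives a compact parameter set with image exactly \<open>low_index\<close>, whence
  \<open>compact_low_index\<close>.\<close>

definition closed_params :: "(nat \<Rightarrow> real) set" where
  "closed_params = ({..<n} \<rightarrow>\<^sub>E {0..1}) \<inter> {u. (\<Sum>i<num_nodes. u (2 * i)) \<le> 1}"

lemma compact_closed_params: "compact closed_params"
  unfolding closed_params_def
  by (intro compact_Int_closed compact_box compact_Icc closed_Collect_le continuous_on_sum
      continuous_on_coordinate continuous_on_const)

lemma closed_params_low_index: "partial_map n ` closed_params \<subseteq> low_index"
proof (rule image_subsetI)
  fix u assume u: "u \<in> closed_params"
  have box: "0 \<le> u l \<and> u l \<le> 1" if "l < n" for l
    using PiE_mem[OF IntD1[OF u[unfolded closed_params_def]], of l] that by simp
  have pm: "partial_map n u = restrict (\<lambda>j. \<Sum>i<num_nodes. u (2 * i) * node u i ^ e j) {..<n}"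
    using u by (auto simp: partial_map_def Phi_def fun_eq_iff closed_params_def PiE_def extensional_def)
  show "partial_map n u \<in> low_index"
    unfolding pm
  proof (rule group_atoms[OF _ _ _ _ refl])
    let ?A = "node u ` {i \<in> {..<num_nodes}. 0 < u (2 * i) \<and> 0 < node u i}"
    have "card ?A \<le> card (node u ` {..<num_nodes})" by (intro card_mono) auto
    also have "\<dots> \<le> num_nodes" using card_image_le[of "{..<num_nodes}" "node u"] by simp
    finally have cA: "card ?A \<le> num_nodes" .
    have "?A \<inter> {..<1} \<subseteq> node u ` {..<n div 2}"
    proof
      fix x assume "x \<in> ?A \<inter> {..<1}"
      then obtain i where "x = node u i" "node u i < 1" "i < num_nodes" by auto
      moreover from this have "i < n div 2" by (auto simp: node_def num_nodes_def split: if_splits)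
      ultimately show "x \<in> node u ` {..<n div 2}" by blast
    qed
    then have "card (?A \<inter> {..<1}) \<le> card (node u ` {..<n div 2})" by (intro card_mono) auto
    also have "\<dots> \<le> n div 2" using card_image_le[of "{..<n div 2}" "node u"] by simp
    finally show "card ?A + card (?A \<inter> {..<1}) \<le> n" using cA by (simp add: num_nodes_def)
    show "0 \<le> u (2 * i)" if "i \<in> {..<num_nodes}" for i using box[of "2 * i"] that by (auto simp: num_nodes_def)
    show "0 \<le> node u i \<and> node u i \<le> 1" for i using box by (simp add: node_def)
    show "(\<Sum>i<num_nodes. u (2 * i)) \<le> 1" using u by (simp add: closed_params_def)
  qed simp
qed

lemma low_index_closed_params: "low_index \<subseteq> partial_map n ` closed_params"
proof
  fix y assume "y \<in> low_index"
  then consider "y \<in> partial_map n ` params" | "y \<in> atoms_hull (num_nodes - 1)" using low_index_cases by blast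
  then show "y \<in> partial_map n ` closed_params"
  proof cases
    case 1
    have "params \<subseteq> closed_params" unfolding params_UN
      by (auto simp: params_margin_def closed_params_def)
    then show ?thesis using 1 by blast
  next
    case 2
    define N where "N = num_nodes - 1"
    obtain W X where WX: "admissible N W X" "y = atoms_point N W X"
      using 2 by (auto simp: atoms_hull_def N_def)
    have N: "2 * N < n" "num_nodes = Suc N" using num_nodes_pos by (auto simp: N_def num_nodes_def)
    define u where "u = restrict (\<lambda>l. if l div 2 < N then (if even l then W (l div 2) else X (l div 2)) else 0) {..<n}"
    have uW: "u (2 * i) = W i" "node u i = X i" if "i < N" for i using that N by (auto simp: u_def node_def)
    have uN: "u (2 * N) = 0" using N by (simp add: u_def)
    have W1: "W i \<le> 1" if "i < N" for i using admissible_le_1[OF WX(1) that] .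
    have "u \<in> closed_params"
      unfolding closed_params_def
    proof (intro IntI CollectI)
      show "u \<in> {..<n} \<rightarrow>\<^sub>E {0..1}" using WX(1) W1 by (auto simp: u_def admissible_def)
      show "(\<Sum>i<num_nodes. u (2 * i)) \<le> 1" using uW uN N WX(1) by (simp add: admissible_def)
    qed
    moreover have "partial_map n u = y"
    proof
      fix j
      show "partial_map n u j = y j"
      proof (cases "j < n")
        case True
        then show ?thesis using uW uN N by (simp add: partial_map_def Phi_def WX(2) atoms_point_def)
      qed (simp add: partial_map_def u_def WX(2) atoms_point_def)
    qed
    ultimately show ?thesis by blast
  qed
qed

lemma compact_low_index: "compact low_index"
proof -
  have "low_index = partial_map n ` closed_params"
    using closed_params_low_index low_index_closed_params by blast
  then show ?thesis
    by (simp add: compact_continuous_image[OF continuous_on_partial_map compact_closed_params])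
qed

text \<open>Moving a node, or moving mass between two nodes, cannot decrease the distance. Hence the
  residual polynomial takes one value at all nodes and has a critical point at each interior node.\<close>

lemma nearest_atoms_low_index:
  assumes q: "q \<in> {..<n} \<rightarrow>\<^sub>E UNIV" "q \<notin> atoms_hull N" and y: "y \<in> atoms_hull N"
    and min: "\<And>x. x \<in> atoms_hull N \<Longrightarrow> (\<Sum>j<n. (y j - q j)\<^sup>2) \<le> (\<Sum>j<n. (x j - q j)\<^sup>2)"
  shows "y \<in> low_index"
proof -
  obtain W X where WX: "admissible N W X" "y = atoms_point N W X" using y by (auto simp: atoms_hull_def)
  define b where "b j = q j - y j" for j
  have yj: "y j = (\<Sum>i<N. W i * X i ^ e j)" if "j < n" for j using that by (simp add: WX(2) atoms_point_def)
  have "\<exists>j<n. b j \<noteq> 0"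
  proof (rule ccontr)
    assume "\<not> (\<exists>j<n. b j \<noteq> 0)"
    moreover have "q j = undefined \<and> y j = undefined" if "\<not> j < n" for j
      using q(1) that PiE_arb[of q "{..<n}"] by (simp add: WX(2) atoms_point_def)
    ultimately have "q = y" by (intro ext) (metis b_def eq_iff_diff_eq_0)
    then show False using q y by simp
  qed
  \<comment> \<open>Along a two-sided path through \<open>y\<close> in the hull the squared distance
    to \<open>q\<close> has a minimum at 0, so the velocity \<open>g\<close> of the path is
    orthogonal to the residual \<open>b\<close>.\<close>
  have crit: "(\<Sum>j<n. b j * g j) = 0"
    if "0 < r" and adm: "\<And>s. \<bar>s\<bar> < r \<Longrightarrow> \<exists>x\<in>atoms_hull N. \<forall>j<n. x j = f s j"
      and f0: "\<And>j. j < n \<Longrightarrow> f 0 j = y j"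
      and der: "\<And>j. j < n \<Longrightarrow> ((\<lambda>s. f s j) has_field_derivative g j) (at 0)"
    for r :: real and f :: "real \<Rightarrow> nat \<Rightarrow> real" and g
  proof -
    let ?Q = "\<lambda>s. \<Sum>j<n. (f s j - q j)\<^sup>2"
    have "DERIV ?Q 0 :> (\<Sum>j<n. 2 * (f 0 j - q j) * g j)"
      by (auto intro!: derivative_eq_intros der sum.cong)
    then have "(\<Sum>j<n. 2 * (f 0 j - q j) * g j) = 0"
    proof (rule DERIV_local_min[OF _ \<open>0 < r\<close>])
      show "\<forall>s. \<bar>0 - s\<bar> < r \<longrightarrow> ?Q 0 \<le> ?Q s"
      proof (intro allI impI)
        fix s :: real assume "\<bar>0 - s\<bar> < r"
        then obtain x where x: "x \<in> atoms_hull N" "\<And>j. j < n \<Longrightarrow> x j = f s j" using adm[of s] by auto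
        show "?Q 0 \<le> ?Q s" using min[OF x(1)] x(2) f0 by simp
      qed
    qed
    also have "(\<Sum>j<n. 2 * (f 0 j - q j) * g j) = - 2 * (\<Sum>j<n. b j * g j)"
      unfolding sum_distrib_left by (intro sum.cong) (auto simp: f0 b_def algebra_simps)
    finally show ?thesis by simp
  qed
  define I' where "I' = {i \<in> {..<N}. 0 < W i \<and> 0 < X i}"
  define A where "A = X ` I'"
  have bounds: "0 \<le> W i" "0 \<le> X i" "X i \<le> 1" if "i < N" for i using WX(1) that by (auto simp: admissible_def)
  have upd_sum: "(\<Sum>i<N. (g(k := v)) i) = (\<Sum>i<N. g i) - g k + v" if "k < N" for g :: "nat \<Rightarrow> real" and k v
  proof -
    have "(\<Sum>i<N. (g(k := v)) i) = v + (\<Sum>i\<in>{..<N} - {k}. (g(k := v)) i)"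
      using that by (subst sum.remove[of _ k]) auto
    also have "(\<Sum>i\<in>{..<N} - {k}. (g(k := v)) i) = (\<Sum>i\<in>{..<N} - {k}. g i)" by (intro sum.cong) auto
    also have "\<dots> = (\<Sum>i<N. g i) - g k" using that by (subst (2) sum.remove[of _ k]) auto
    finally show ?thesis by simp
  qed
  have crit_node: "(\<Sum>j<n. b j * (real (e j) * X k ^ (e j - 1))) = 0" if k: "k \<in> I'" "X k < 1" for k
  proof -
    have kN: "k < N" "0 < W k" "0 < X k" using k by (auto simp: I'_def)
    have "(\<Sum>j<n. b j * (W k * (real (e j) * X k ^ (e j - 1)))) = 0"
    proof (rule crit[of "min (X k) (1 - X k)" "\<lambda>s j. y j + W k * ((X k + s) ^ e j - X k ^ e j)"])
      fix s :: real assume s: "\<bar>s\<bar> < min (X k) (1 - X k)"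
      have adm: "admissible N W (X(k := X k + s))" using WX(1) s by (auto simp: admissible_def)
      have "atoms_point N W (X(k := X k + s)) j = y j + W k * ((X k + s) ^ e j - X k ^ e j)" if "j < n" for j
      proof -
        have "atoms_point N W (X(k := X k + s)) j = (\<Sum>i<N. ((\<lambda>i. W i * X i ^ e j)(k := W k * (X k + s) ^ e j)) i)"
          using that by (auto simp: atoms_point_def intro!: sum.cong)
        then show ?thesis using upd_sum[OF kN(1)] yj[OF that] by (simp add: algebra_simps)
      qed
      then show "\<exists>x\<in>atoms_hull N. \<forall>j<n. x j = y j + W k * ((X k + s) ^ e j - X k ^ e j)"
        using adm by (auto simp: atoms_hull_def)
    qed (use k kN in \<open>auto intro!: derivative_eq_intros\<close>)
    then have "W k * (\<Sum>j<n. b j * (real (e j) * X k ^ (e j - 1))) = 0"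
      by (simp add: sum_distrib_left mult_ac)
    then show ?thesis using kN by simp
  qed
  have crit_weight: "(\<Sum>j<n. b j * X k ^ e j) = (\<Sum>j<n. b j * X l ^ e j)" if kl: "k \<in> I'" "l \<in> I'" for k l
  proof (cases "k = l")
    case False
    have kN: "k < N" "0 < W k" "l < N" "0 < W l" using kl by (auto simp: I'_def)
    have "(\<Sum>j<n. b j * (X k ^ e j - X l ^ e j)) = 0"
    proof (rule crit[of "min (W k) (W l)" "\<lambda>s j. y j + s * (X k ^ e j - X l ^ e j)"])
      fix s :: real assume s: "\<bar>s\<bar> < min (W k) (W l)"
      let ?W = "W(k := W k + s, l := W l - s)"
      have "(\<Sum>i<N. ?W i) = (\<Sum>i<N. W i)"
        unfolding upd_sum[OF kN(3)] upd_sum[OF kN(1)] using False by simp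
      then have adm: "admissible N ?W X" using WX(1) s by (auto simp: admissible_def)
      have "atoms_point N ?W X j = y j + s * (X k ^ e j - X l ^ e j)" if "j < n" for j
      proof -
        have "atoms_point N ?W X j = (\<Sum>i<N. ((\<lambda>i. W i * X i ^ e j)
            (k := (W k + s) * X k ^ e j, l := (W l - s) * X l ^ e j)) i)"
          using that False by (auto simp: atoms_point_def intro!: sum.cong)
        also have "\<dots> = y j + s * (X k ^ e j - X l ^ e j)"
          unfolding upd_sum[OF kN(3)] upd_sum[OF kN(1)] using yj[OF that] False by (simp add: algebra_simps)
        finally show ?thesis .
      qed
      then show "\<exists>x\<in>atoms_hull N. \<forall>j<n. x j = y j + s * (X k ^ e j - X l ^ e j)"
        using adm by (auto simp: atoms_hull_def)
    qed (use kN in \<open>auto intro!: derivative_eq_intros\<close>)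
    then show ?thesis by (simp add: right_diff_distrib sum_subtractf)
  qed simp
  obtain \<kappa> where \<kappa>: "\<And>k. k \<in> I' \<Longrightarrow> (\<Sum>j<n. b j * X k ^ e j) = \<kappa>"
    using crit_weight by (cases "I' = {}") blast+
  \<comment> \<open>Subtracting the common value \<open>\<kappa>\<close> adds a term with exponent
    0, distinct from the others because \<open>e\<close> is positive. The resulting sum of
    \<open>n + 1\<close> powers vanishes at all nodes, doubly at those below 1, so the root count
    gives index at most \<open>n\<close>.\<close>
  let ?E = "\<lambda>j. if j < n then e j else 0" and ?c = "\<lambda>j. if j < n then b j else - \<kappa>"
  have finI: "finite I'" by (simp add: I'_def)
  have "card A + card (A \<inter> {..<1}) < card {..n}"
  proof (rule card_roots_less[of "{..n}" ?E ?c])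
    show "inj_on ?E {..n}"
    proof (rule inj_onI)
      fix x y assume "x \<in> {..n}" "y \<in> {..n}" "?E x = ?E y"
      then show "x = y" using inj_onD[OF inj_on_e, of x y] e_pos[of x] e_pos[of y] by (auto split: if_splits)
    qed
    show "\<exists>j\<in>{..n}. ?c j \<noteq> 0" using \<open>\<exists>j<n. b j \<noteq> 0\<close> by (auto intro: less_imp_le)
    have split_n: "(\<Sum>j\<le>n. h j) = (\<Sum>j<n. h j) + h n" for h :: "nat \<Rightarrow> real"
      by (simp add: lessThan_Suc_atMost[symmetric])
    show "(\<Sum>j\<le>n. ?c j * t ^ ?E j) = 0" if "t \<in> A" for t
      using that \<kappa> unfolding split_n by (auto simp: A_def)
    show "(\<Sum>j\<le>n. ?c j * (real (?E j) * t ^ (?E j - 1))) = 0" if "t \<in> A \<inter> {..<1}" for t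
      using that crit_node unfolding split_n by (auto simp: A_def)
  qed (use finI in \<open>auto simp: A_def I'_def\<close>)
  then have "card A + card (A \<inter> {..<1}) \<le> n" by simp
  then show ?thesis unfolding WX(2) atoms_point_def
    using bounds WX(1) by (intro group_atoms[of "{..<N}" W X A]) (auto simp: A_def I'_def admissible_def)
qed

text \<open>The nearest-point argument applies only to points nearest to something outside. The ray
  from 0 through \<open>y\<close> is followed to its last point \<open>z = t y\<close> in the hull;
  nearest points to points just beyond \<open>z\<close> have low index and converge to
  \<open>z\<close>, so compactness puts \<open>z\<close> in \<open>low_index\<close>. Scaling back
  to \<open>y\<close> changes the weights only.\<close>

lemma atoms_hull_low_index:
  assumes "y \<in> atoms_hull N"
  shows "y \<in> low_index"
proof (cases "\<forall>j<n. y j = 0")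
  case True
  have "y = restrict (\<lambda>j. \<Sum>a\<in>{}. 0 * a ^ e j) {..<n}"
    using True assms by (auto simp: atoms_hull_def atoms_point_def fun_eq_iff)
  then show ?thesis unfolding low_index_def
    by (intro CollectI exI[of _ "{}"] exI[of _ "\<lambda>_. 0"]) simp
next
  case False
  then obtain j0 where j0: "j0 < n" "y j0 \<noteq> 0" by blast
  define ray where "ray s = restrict (\<lambda>j. s * y j) {..<n}" for s
  have yPiE: "y \<in> {..<n} \<rightarrow>\<^sub>E UNIV" using assms atoms_point_PiE by (auto simp: atoms_hull_def)
  have bound: "\<bar>x j\<bar> \<le> 1" if x: "x \<in> atoms_hull N" and "j < n" for x j
  proof -
    obtain W X where WX: "admissible N W X" "x = atoms_point N W X" using x by (auto simp: atoms_hull_def)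
    have "0 \<le> (\<Sum>i<N. W i * X i ^ e j)" using WX(1) by (auto simp: admissible_def intro!: sum_nonneg)
    moreover have "(\<Sum>i<N. W i * X i ^ e j) \<le> (\<Sum>i<N. W i * 1)"
      using WX(1) by (intro sum_mono mult_left_mono power_le_one) (auto simp: admissible_def)
    ultimately show ?thesis using WX \<open>j < n\<close> by (simp add: atoms_point_def admissible_def)
  qed
  \<comment> \<open>Coordinates of hull points are at most 1 in absolute value, so the ray has left
    the hull after \<open>1 / \<bar>y j0\<bar>\<close>.\<close>
  define T where "T = {0..1 / \<bar>y j0\<bar>} \<inter> ray -` atoms_hull N"
  have "continuous_on UNIV ray"
  proof (rule continuous_on_fun)
    show "continuous_on UNIV (\<lambda>s. ray s j)" for j
      by (cases "j < n") (auto simp: ray_def intro!: continuous_intros)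
  qed
  then have "closed (ray -` atoms_hull N)"
    using compact_imp_closed[OF compact_atoms_hull] by (metis closed_vimage)
  then have "compact T" unfolding T_def by (intro compact_Int_closed compact_Icc)
  have in_T: "s \<in> T" if "ray s \<in> atoms_hull N" "0 \<le> s" for s
    using bound[OF that(1) j0(1)] j0 that by (simp add: T_def ray_def abs_mult field_simps)
  have ray1: "ray 1 = y" using yPiE by (auto simp: ray_def fun_eq_iff PiE_def extensional_def)
  have "1 \<in> T" using in_T[of 1] assms ray1 by simp
  then obtain t where t: "t \<in> T" "\<And>s. s \<in> T \<Longrightarrow> s \<le> t"
    using compact_attains_sup[OF \<open>compact T\<close>] by blast
  have t1: "1 \<le> t" using t(2)[OF \<open>1 \<in> T\<close>] .
  define z where "z = ray t"
  have zK: "z \<in> atoms_hull N" using t by (simp add: T_def z_def)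
  have contd: "continuous_on U (\<lambda>x. \<Sum>j<n. (x j - p j)\<^sup>2)" for U and p :: "nat \<Rightarrow> real"
    by (intro continuous_on_sum continuous_on_power continuous_on_diff continuous_on_coordinate continuous_on_const)
  have near: "\<exists>c\<in>low_index. (\<Sum>j<n. (c j - z j)\<^sup>2) \<le> 4 * \<epsilon>\<^sup>2 * (\<Sum>j<n. (y j)\<^sup>2)" if "0 < \<epsilon>" for \<epsilon>
  proof -
    define q where "q = ray (t + \<epsilon>)"
    have "q \<notin> atoms_hull N" using in_T[of "t + \<epsilon>"] t(2)[of "t + \<epsilon>"] t1 that by (auto simp: q_def)
    have "atoms_hull N \<noteq> {}" using assms by auto
    then obtain c where c: "c \<in> atoms_hull N"
      "\<And>x. x \<in> atoms_hull N \<Longrightarrow> (\<Sum>j<n. (c j - q j)\<^sup>2) \<le> (\<Sum>j<n. (x j - q j)\<^sup>2)"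
      using continuous_attains_inf[OF compact_atoms_hull _ contd[of "atoms_hull N" q]] by blast
    have "c \<in> low_index"
      by (rule nearest_atoms_low_index[of q N]) (use c \<open>q \<notin> atoms_hull N\<close> in \<open>auto simp: q_def ray_def\<close>)
    have zq: "(\<Sum>j<n. (z j - q j)\<^sup>2) = \<epsilon>\<^sup>2 * (\<Sum>j<n. (y j)\<^sup>2)"
      unfolding sum_distrib_left by (intro sum.cong) (auto simp: z_def q_def ray_def power2_eq_square algebra_simps)
    \<comment> \<open>The squared distance of \<open>c\<close> and \<open>z\<close> is at most twice
      the sum of their squared distances to \<open>q\<close>. Since \<open>z\<close> competes with
      the nearest point \<open>c\<close>, the factor 4 results.\<close>
    have "(\<Sum>j<n. (c j - z j)\<^sup>2) \<le> (\<Sum>j<n. 2 * (c j - q j)\<^sup>2 + 2 * (z j - q j)\<^sup>2)"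
    proof (rule sum_mono)
      fix j
      have "0 \<le> ((c j - q j) + (z j - q j))\<^sup>2" by simp
      then show "(c j - z j)\<^sup>2 \<le> 2 * (c j - q j)\<^sup>2 + 2 * (z j - q j)\<^sup>2"
        by (simp add: power2_eq_square algebra_simps)
    qed
    also have "\<dots> = 2 * (\<Sum>j<n. (c j - q j)\<^sup>2) + 2 * (\<Sum>j<n. (z j - q j)\<^sup>2)"
      by (simp add: sum.distrib sum_distrib_left)
    also have "\<dots> \<le> 4 * (\<Sum>j<n. (z j - q j)\<^sup>2)" using c(2)[OF zK] by simp
    also have "\<dots> = 4 * \<epsilon>\<^sup>2 * (\<Sum>j<n. (y j)\<^sup>2)" by (simp add: zq)
    finally show ?thesis using \<open>c \<in> low_index\<close> by blast
  qed
  obtain c0 where c0: "c0 \<in> low_index" "\<And>x. x \<in> low_index \<Longrightarrow> (\<Sum>j<n. (c0 j - z j)\<^sup>2) \<le> (\<Sum>j<n. (x j - z j)\<^sup>2)"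
    using continuous_attains_inf[OF compact_low_index _ contd[of low_index z]] near[of 1] by auto
  have le: "(\<Sum>j<n. (c0 j - z j)\<^sup>2) \<le> 4 * \<epsilon>\<^sup>2 * (\<Sum>j<n. (y j)\<^sup>2)" if "0 < \<epsilon>" for \<epsilon>
    using near[OF that] c0(2) by (meson order_trans)
  have "((\<lambda>\<epsilon>. 4 * \<epsilon>\<^sup>2 * (\<Sum>j<n. (y j)\<^sup>2)) \<longlongrightarrow> 4 * 0\<^sup>2 * (\<Sum>j<n. (y j)\<^sup>2)) (at_right 0)"
    by (intro tendsto_intros)
  then have "(\<Sum>j<n. (c0 j - z j)\<^sup>2) \<le> 4 * 0\<^sup>2 * (\<Sum>j<n. (y j)\<^sup>2)"
    by (rule tendsto_lowerbound) (auto simp: eventually_at_right_less intro!: eventually_mono[OF eventually_at_right_less[of 0]] le)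
  then have "(\<Sum>j<n. (c0 j - z j)\<^sup>2) = 0" by (intro antisym sum_nonneg) auto
  then have eq: "c0 j = z j" if "j < n" for j using that by (simp add: sum_nonneg_eq_0_iff)
  obtain A w where A: "finite A" "A \<subseteq> {0<..1}" "\<And>a. a \<in> A \<Longrightarrow> 0 < w a" "sum w A \<le> 1"
    "card A + card (A \<inter> {..<1}) \<le> n" "c0 = restrict (\<lambda>j. \<Sum>a\<in>A. w a * a ^ e j) {..<n}"
    using c0(1) unfolding low_index_def by blast
  \<comment> \<open>Division by \<open>t \<ge> 1\<close> keeps the weights positive with sum at most
    1, and the nodes, hence the index, are unchanged.\<close>
  have "y = restrict (\<lambda>j. \<Sum>a\<in>A. (w a / t) * a ^ e j) {..<n}"
  proof
    fix j
    show "y j = restrict (\<lambda>j. \<Sum>a\<in>A. (w a / t) * a ^ e j) {..<n} j"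
    proof (cases "j < n")
      case True
      have "t * y j = (\<Sum>a\<in>A. w a * a ^ e j)" using eq[OF True] True A(6) by (simp add: z_def ray_def)
      then have "y j = (\<Sum>a\<in>A. w a * a ^ e j) / t" using t1 by (simp add: field_simps)
      then show ?thesis using True by (simp add: sum_divide_distrib)
    next
      case False
      then show ?thesis using PiE_arb[OF yPiE, of j] by simp
    qed
  qed
  moreover have "(\<Sum>a\<in>A. w a / t) \<le> 1"
    unfolding sum_divide_distrib[symmetric] using A(4) t1 by (simp add: field_simps)
  moreover have "\<forall>a\<in>A. 0 < w a / t" using A(3) t1 by simp
  ultimately show ?thesis unfolding low_index_def
    by (intro CollectI exI[of _ A] exI[of _ "\<lambda>a. w a / t"] conjI A(1,2,5)) simp_all
qed

lemma curve_hull_eq: "curve_hull (curve_pts n e) = partial_map n ` params \<union> atoms_hull (num_nodes - 1)"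
proof (intro equalityI subsetI)
  fix y assume "y \<in> curve_hull (curve_pts n e)"
  then obtain N where "y \<in> atoms_hull N" unfolding atoms_hull_Un by blast
  then show "y \<in> partial_map n ` params \<union> atoms_hull (num_nodes - 1)"
    by (intro low_index_cases atoms_hull_low_index)
next
  fix y assume y: "y \<in> partial_map n ` params \<union> atoms_hull (num_nodes - 1)"
  have "y \<in> atoms_hull num_nodes" if "y \<in> partial_map n ` params"
  proof -
    from that obtain u where u: "u \<in> params" "y = partial_map n u" by blast
    have "y = atoms_point num_nodes (\<lambda>i. u (2 * i)) (node u)"
      using u by (auto simp: fun_eq_iff partial_map_def Phi_def atoms_point_def params_def PiE_def extensional_def)
    moreover have "admissible num_nodes (\<lambda>i. u (2 * i)) (node u)"
      using u(1) node_bounds[OF u(1)] by (auto simp: admissible_def params_def less_imp_le)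
    ultimately show ?thesis by (auto simp: atoms_hull_def)
  qed
  with y show "y \<in> curve_hull (curve_pts n e)" unfolding atoms_hull_Un by blast
qed

text \<open>Two representations with \<open>N\<close> atoms each involve at most
  \<open>2 * N\<close> nodes. Agreement in the first \<open>n - 1\<close> coordinates cancels all
  merged coefficients at positive nodes, so the last coordinates agree as well. The set is thus a
  graph over the other coordinates and has measure zero by Tonelli.\<close>

lemma atoms_hull_section:
  assumes N: "2 * N \<le> n - 1" and x: "x(n - 1 := s) \<in> atoms_hull N" "x(n - 1 := t) \<in> atoms_hull N"
  shows "s = t"
proof -
  obtain W X where WX: "admissible N W X" "x(n - 1 := s) = atoms_point N W X"
    using x by (auto simp: atoms_hull_def)
  obtain V Y where VY: "admissible N V Y" "x(n - 1 := t) = atoms_point N V Y"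
    using x by (auto simp: atoms_hull_def)
  define I where "I = {..<N} <+> {..<N}"
  define a where "a = case_sum X Y"
  define c where "c = case_sum W (\<lambda>i. - V i)"
  have I_sum: "(\<Sum>i\<in>I. f i) = (\<Sum>i<N. f (Inl i)) + (\<Sum>i<N. f (Inr i))" for f :: "nat + nat \<Rightarrow> real"
    unfolding I_def by (subst sum.Plus) auto
  have finI: "finite I" by (simp add: I_def)
  have diff: "(\<Sum>i\<in>I. c i * a i ^ e j) = (x(n - 1 := s)) j - (x(n - 1 := t)) j" if "j < n" for j
    unfolding WX(2) VY(2) I_sum using that by (simp add: atoms_point_def c_def a_def sum_negf)
  have zero: "(\<Sum>i | i \<in> I \<and> a i = b. c i) = 0" if "0 < b" for b
  proof (rule grouped_coeffs_zero[of I a "n - 1"])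
    have "card (a ` I - {0}) \<le> card (a ` I)" using finI by (intro card_mono) auto
    also have "\<dots> \<le> card I" using finI by (rule card_image_le)
    also have "\<dots> = 2 * N" by (simp add: I_def card_Plus)
    finally show "card (a ` I - {0}) \<le> n - 1" using N by simp
    show "(\<Sum>i\<in>I. c i * a i ^ e j) = 0" if "j < n - 1" for j using diff[of j] that by simp
    show "0 \<le> a i" if "i \<in> I" for i using that WX(1) VY(1) by (auto simp: I_def a_def admissible_def)
  qed (use finI that in auto)
  have "s - t = (\<Sum>i\<in>I. c i * a i ^ e (n - 1))" using diff[of "n - 1"] n_pos by simp
  also have "\<dots> = (\<Sum>b\<in>a ` I. \<Sum>i | i \<in> I \<and> a i = b. c i * a i ^ e (n - 1))"
    using finI by (rule sum.image_gen)
  also have "\<dots> = (\<Sum>b\<in>a ` I. (\<Sum>i | i \<in> I \<and> a i = b. c i) * b ^ e (n - 1))"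
    unfolding sum_distrib_right by (intro sum.cong refl) auto
  also have "\<dots> = 0"
  proof (intro sum.neutral ballI)
    fix b assume "b \<in> a ` I"
    then have "0 \<le> b" using WX(1) VY(1) by (auto simp: I_def a_def admissible_def)
    then show "(\<Sum>i | i \<in> I \<and> a i = b. c i) * b ^ e (n - 1) = 0"
      using zero[of b] e_pos[of "n - 1"] n_pos by (cases "b = 0") auto
  qed
  finally show ?thesis by simp
qed

lemma atoms_hull_null: "atoms_hull (num_nodes - 1) \<in> null_sets (lebN n)"
proof -
  interpret product_sigma_finite "\<lambda>_::nat. lborel :: real measure"
    by standard
  let ?K = "atoms_hull (num_nodes - 1)"
  have N: "2 * (num_nodes - 1) \<le> n - 1" by (auto simp: num_nodes_def)
  have "?K \<subseteq> {..<n} \<rightarrow>\<^sub>E UNIV" using atoms_point_PiE by (auto simp: atoms_hull_def)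
  then have K: "?K \<in> sets (lebN n)" by (rule compact_sets_lebN[OF compact_atoms_hull])
  define I where "I = {..<n - 1}"
  have I: "finite I" "n - 1 \<notin> I" "{..<n} = insert (n - 1) I" using n_pos by (auto simp: I_def)
  have m: "(indicator ?K :: _ \<Rightarrow> ennreal) \<in> borel_measurable (lebP (insert (n - 1) I))"
    unfolding I(3)[symmetric] using K by (rule borel_measurable_indicator)
  have "emeasure (lebN n) ?K = (\<integral>\<^sup>+x. indicator ?K x \<partial>lebN n)" using K by simp
  also have "\<dots> = (\<integral>\<^sup>+x. \<integral>\<^sup>+s. indicator ?K (x(n - 1 := s)) \<partial>lborel \<partial>lebP I)"
    unfolding I(3) by (rule product_nn_integral_insert[OF I(1,2) m])
  also have "\<dots> = (\<integral>\<^sup>+x. 0 \<partial>lebP I)"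
  proof (rule nn_integral_cong)
    fix x
    show "(\<integral>\<^sup>+s. indicator ?K (x(n - 1 := s)) \<partial>lborel) = (0 :: ennreal)"
    proof (cases "\<exists>s. x(n - 1 := s) \<in> ?K")
      case True
      then obtain s where s: "x(n - 1 := s) \<in> ?K" by blast
      have "(\<integral>\<^sup>+s. indicator ?K (x(n - 1 := s)) \<partial>lborel) \<le> (\<integral>\<^sup>+t. indicator {s} t \<partial>lborel)"
        by (intro nn_integral_mono) (use atoms_hull_section[OF N s] in \<open>auto simp: indicator_def\<close>)
      then show ?thesis by simp
    qed (simp add: indicator_def)
  qed
  finally show ?thesis using K by (intro null_setsI) simp_all
qed

theorem emeasure_curve_hull:
  "emeasure (lebN n) (curve_hull (curve_pts n e)) =
    (\<integral>\<^sup>+u. ennreal \<bar>detN n (jac u u)\<bar> * indicator params u \<partial>lebN n)"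
  unfolding curve_hull_eq
  using emeasure_Un_null_set[OF emeasure_image_params(2) atoms_hull_null] emeasure_image_params(1) by simp

end

subsection \<open>Evaluation of the volume integral\<close>

lemma schur_cong:
  assumes "\<And>i. i < N \<Longrightarrow> z i = z' i"
  shows "schur N lam z = schur N lam z'"
proof -
  obtain S c where "\<And>z. schur N lam z = (\<Sum>a\<in>S. c a * (\<Prod>i<N. z i ^ a i))"
    using poly_fun_schur[of N lam] unfolding poly_fun_def by auto
  then show ?thesis using assms by simp
qed

text \<open>Numerator and denominator of the bialternant acquire the same sign; repeated arguments
  follow by continuity.\<close>

lemma schur_permute:
  assumes p: "p permutes {..<N}"
  shows "schur N lam (\<lambda>i. z (p i)) = schur N lam z"
proof (rule continuous_eq_if_eq_distinct[where N = N and f = "\<lambda>z. schur N lam (\<lambda>i. z (p i))" and g = "schur N lam"])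
  show "continuous_on UNIV (\<lambda>z. schur N lam (\<lambda>i. z (p i)))"
    by (rule continuous_on_compose2[OF poly_fun_continuous[OF poly_fun_schur]])
      (auto intro: continuous_on_fun continuous_on_coordinate)
  show "continuous_on UNIV (schur N lam)" by (rule poly_fun_continuous[OF poly_fun_schur])
  fix z :: "nat \<Rightarrow> real" assume z: "inj_on z {..<N}"
  let ?V = "detN N (\<lambda>i j. z i ^ (N - 1 - j))" and ?s = "real_of_int (sign p)"
  have "schur N lam (\<lambda>i. z (p i)) * (?s * ?V) = ?s * (schur N lam z * ?V)"
    using schur_mult_Vandermonde[of N lam "\<lambda>i. z (p i)"]
    unfolding detN_permute_rows[OF p, of "\<lambda>i j. z i ^ (N - 1 - j)"]
      detN_permute_rows[OF p, of "\<lambda>i j. z i ^ (lam j + N - 1 - j)"] schur_mult_Vandermonde .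
  moreover have "?s \<noteq> 0" by (simp add: sign_def)
  moreover have "?V \<noteq> 0" using z by (simp only: Vandermonde_neq_0_iff)
  ultimately show "schur N lam (\<lambda>i. z (p i)) = schur N lam z" by simp
qed

lemma borel_measurable_simplex_integrand:
  assumes "finite I" "J \<subseteq> I"
  shows "(\<lambda>w. ennreal (of_bool ((\<forall>i\<in>I. 0 < w i) \<and> sum w I \<le> r) * (\<Prod>i\<in>J. w i))) \<in>
    borel_measurable (lebP I)"
proof -
  have [measurable]: "(\<lambda>w. w i :: real) \<in> borel_measurable (lebP I)" if "i \<in> I" for i
    using measurable_component_singleton[OF that, of "\<lambda>_. lborel"] by simp
  have [measurable]: "(\<lambda>w. \<Prod>i\<in>J. w i :: real) \<in> borel_measurable (lebP I)"
    by (rule borel_measurable_prod) (use assms in auto)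
  have [measurable]: "(\<lambda>w. sum w I :: real) \<in> borel_measurable (lebP I)"
    by (rule borel_measurable_sum) auto
  have "Measurable.pred (lebP I) (\<lambda>w. \<forall>i\<in>I. 0 < (w i :: real))"
    by (rule pred_intros_finite) (use assms in auto)
  then show ?thesis by measurable
qed

text \<open>A Dirichlet integral with exponents 0 and 1: \<open>I\<close> indexes all weights,
  \<open>J\<close> those that occur as factors. The size \<open>r\<close> is general because fixing
  one coordinate at \<open>y\<close> leaves a simplex of size \<open>r - y\<close>.\<close>

lemma simplex_integral:
  assumes "finite I" "J \<subseteq> I" "0 \<le> r"
  shows "(\<integral>\<^sup>+w. ennreal (of_bool ((\<forall>i\<in>I. 0 < w i) \<and> sum w I \<le> r) * (\<Prod>i\<in>J. w i)) \<partial>lebP I) =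
    ennreal (r ^ (card I + card J) / fact (card I + card J))"
  using assms
proof (induction I arbitrary: J r rule: finite_induct)
  case empty
  then show ?case by (simp add: PiM_empty)
next
  case (insert k I)
  interpret product_sigma_finite "\<lambda>_::'a. lborel :: real measure"
    by standard
  define J' where "J' = J - {k}"
  define \<delta> :: nat where "\<delta> = (if k \<in> J then 1 else 0)"
  define N where "N = card I + card J'"
  have finJ: "finite J" using insert finite_subset by blast
  have J': "J' \<subseteq> I" "k \<notin> J'" using insert by (auto simp: J'_def)
  have cards: "card (insert k I) + card J = N + 1 + \<delta>"
    using insert.hyps card.remove[OF finJ, of k] by (cases "k \<in> J") (simp_all add: N_def J'_def \<delta>_def)
  let ?f = "\<lambda>I J r w. ennreal (of_bool ((\<forall>i\<in>I. 0 < w i) \<and> sum w I \<le> r) * (\<Prod>i\<in>J. w i))"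
  have prod: "(\<Prod>i\<in>J. (x(k := y)) i) = y ^ \<delta> * (\<Prod>i\<in>J'. x i)" for x :: "'a \<Rightarrow> real" and y
  proof -
    have "(\<Prod>i\<in>J'. (x(k := y)) i) = (\<Prod>i\<in>J'. x i)" using J' by (intro prod.cong) auto
    then show ?thesis using finJ by (cases "k \<in> J") (auto simp: \<delta>_def J'_def prod.remove)
  qed
  have sum_upd: "sum (x(k := y)) (insert k I) = y + sum x I" for x :: "'a \<Rightarrow> real" and y
  proof -
    have "sum (x(k := y)) I = sum x I" using insert by (intro sum.cong) auto
    then show ?thesis using insert by simp
  qed
  have all_upd: "(\<forall>i\<in>insert k I. 0 < (x(k := y)) i) \<longleftrightarrow> 0 < y \<and> (\<forall>i\<in>I. 0 < x i)" for x :: "'a \<Rightarrow> real" and y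
    using insert by auto
  have meas: "?f (insert k I) J r \<in> borel_measurable (lebP (insert k I))"
    by (rule borel_measurable_simplex_integrand) (use insert in auto)
  \<comment> \<open>At \<open>y = 0\<close> the left side vanishes by the strict inequality, while
    the right side need not; this single point is discarded almost everywhere below.\<close>
  have inner: "(\<integral>\<^sup>+x. ?f (insert k I) J r (x(k := y)) \<partial>lebP I) =
      ennreal (y ^ \<delta> * (r - y) ^ N / fact N) * indicator {0..r} y" if "y \<noteq> 0" for y
  proof (cases "0 < y \<and> y \<le> r")
    case True
    have "(\<integral>\<^sup>+x. ?f (insert k I) J r (x(k := y)) \<partial>lebP I) =
        (\<integral>\<^sup>+x. ennreal (y ^ \<delta>) * ?f I J' (r - y) x \<partial>lebP I)"
    proof (intro nn_integral_cong)
      fix x :: "'a \<Rightarrow> real"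
      have "(y + sum x I \<le> r) = (sum x I \<le> r - y)" by auto
      then show "?f (insert k I) J r (x(k := y)) = ennreal (y ^ \<delta>) * ?f I J' (r - y) x"
        unfolding prod sum_upd all_upd using True by (simp add: ennreal_mult'[symmetric] mult_ac)
    qed
    also have "\<dots> = ennreal (y ^ \<delta>) * (\<integral>\<^sup>+x. ?f I J' (r - y) x \<partial>lebP I)"
      by (rule nn_integral_cmult, rule borel_measurable_simplex_integrand[OF insert.hyps(1) J'(1)])
    also have "\<dots> = ennreal (y ^ \<delta>) * ennreal ((r - y) ^ N / fact N)"
      using insert.IH[OF J'(1), of "r - y"] True by (simp add: N_def)
    also have "\<dots> = ennreal (y ^ \<delta> * (r - y) ^ N / fact N)"
      using True by (simp add: ennreal_mult'[symmetric])
    finally show ?thesis using True by simp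
  next
    case False
    have "?f (insert k I) J r (x(k := y)) = 0" for x
    proof -
      have "\<not> ((0 < y \<and> (\<forall>i\<in>I. 0 < x i)) \<and> y + sum x I \<le> r)"
      proof
        assume *: "(0 < y \<and> (\<forall>i\<in>I. 0 < x i)) \<and> y + sum x I \<le> r"
        then have "0 \<le> sum x I" by (intro sum_nonneg) (auto intro: less_imp_le)
        then show False using * False by linarith
      qed
      then show ?thesis unfolding prod sum_upd all_upd by (simp only: of_bool_eq(1) mult_zero_left ennreal_0)
    qed
    moreover have "y \<notin> {0..r}" using False that by auto
    ultimately show ?thesis by simp
  qed
  have "(\<integral>\<^sup>+w. ?f (insert k I) J r w \<partial>lebP (insert k I)) =
      (\<integral>\<^sup>+y. \<integral>\<^sup>+x. ?f (insert k I) J r (x(k := y)) \<partial>lebP I \<partial>lborel)"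
    by (rule product_nn_integral_insert_rev[OF insert.hyps meas])
  also have "\<dots> = (\<integral>\<^sup>+y. ennreal (y ^ \<delta> * (r - y) ^ N / fact N) * indicator {0..r} y \<partial>lborel)"
  proof (rule nn_integral_cong_AE)
    show "AE y in lborel. (\<integral>\<^sup>+x. ?f (insert k I) J r (x(k := y)) \<partial>lebP I) =
        ennreal (y ^ \<delta> * (r - y) ^ N / fact N) * indicator {0..r} y"
      using AE_lborel_singleton[of "0::real"] by eventually_elim (rule inner)
  qed
  also have "\<dots> = ennreal (r ^ (N + 1 + \<delta>) / fact (N + 1 + \<delta>))"
  proof -
    define g where "g l y = (r - y) ^ l / fact l" for l :: nat and y
    have g0: "g (Suc l) r = 0" for l by (simp add: g_def)
    have gder: "(g (Suc l) has_real_derivative - g l y) (at y)" for l y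
    proof -
      have d: "((\<lambda>y. r - y) has_real_derivative - 1) (at y)"
        by (auto intro!: derivative_eq_intros)
      have "((\<lambda>y. (r - y) ^ Suc l / fact (Suc l)) has_real_derivative
          (1 + real l) * (- 1 * (r - y) ^ l) / fact (Suc l)) (at y)"
        by (rule DERIV_cdivide[OF DERIV_power_Suc[OF d]])
      also have "(1 + real l) * (- 1 * (r - y) ^ l) / fact (Suc l) = - g l y"
      proof -
        have "fact (Suc l) = (1 + real l) * (fact l :: real)" by simp
        moreover have "1 + real l \<noteq> 0" by linarith
        ultimately show ?thesis by (simp only: mult_divide_mult_cancel_left g_def) simp
      qed
      finally show ?thesis by (simp only: g_def[abs_def])
    qed
    have int: "(\<integral>\<^sup>+y. ennreal (y ^ \<delta> * (r - y) ^ N / fact N) * indicator {0..r} y \<partial>lborel) = ennreal (F r - F 0)"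
      if "\<And>y. (F has_real_derivative y ^ \<delta> * g N y) (at y)" for F
    proof (rule nn_integral_FTC_Icc)
      show "(F has_real_derivative y ^ \<delta> * (r - y) ^ N / fact N) (at y)" for y
        using that[of y] by (simp add: g_def)
    qed (use insert.prems in auto)
    show ?thesis
    proof (cases "k \<in> J")
      case False
      have "((\<lambda>y. - g (Suc N) y) has_real_derivative y ^ \<delta> * g N y) (at y)" for y
        using DERIV_minus[OF gder[of N y]] False by (simp add: \<delta>_def)
      from int[OF this] show ?thesis unfolding g0 using False by (simp add: \<delta>_def g_def)
    next
      case True
      \<comment> \<open>Integration by parts, since \<open>g (Suc l)\<close> has derivative
        \<open>- g l\<close>.\<close>
      have "((\<lambda>y. - (y * g (Suc N) y) - g (Suc (Suc N)) y) has_real_derivative y ^ \<delta> * g N y) (at y)" for y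
        using DERIV_diff[OF DERIV_minus[OF DERIV_mult[OF DERIV_ident gder[of N y]]] gder[of "Suc N" y]] True
        by (simp add: \<delta>_def mult.commute)
      from int[OF this] show ?thesis unfolding g0 using True by (simp add: \<delta>_def g_def)
    qed
  qed
  finally show ?case unfolding cards .
qed

section \<open>Relabelling of coordinates, and products over pairs of indices\<close>

lemma PiM_lborel_reindex:
  fixes I :: "'a set" and J :: "'b set"
  assumes \<phi>: "bij_betw \<phi> J I" and J: "finite J"
  shows "distr (lebP I) (lebP J) (\<lambda>x. \<lambda>j\<in>J. x (\<phi> j)) = lebP J"
proof -
  interpret J: product_sigma_finite "\<lambda>_::'b. lborel :: real measure" by standard
  interpret I: product_sigma_finite "\<lambda>_::'a. lborel :: real measure" by standard
  have I: "finite I" using \<phi> J bij_betw_finite by blast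
  have \<phi>I: "\<phi> j \<in> I" if "j \<in> J" for j using \<phi> that by (rule bij_betw_apply)
  have meas: "(\<lambda>x. \<lambda>j\<in>J. x (\<phi> j)) \<in> measurable (lebP I) (lebP J)"
  proof (rule measurable_restrict)
    show "(\<lambda>x. x (\<phi> j)) \<in> measurable (lebP I) (lborel :: real measure)" if "j \<in> J" for j
      by (rule measurable_component_singleton[OF \<phi>I[OF that]])
  qed
  show ?thesis
  proof (rule J.PiM_eqI[OF J])
    fix A :: "'b \<Rightarrow> real set" assume A: "\<And>j. j \<in> J \<Longrightarrow> A j \<in> sets lborel"
    let ?\<psi> = "the_inv_into J \<phi>"
    have \<psi>: "?\<psi> (\<phi> j) = j" if "j \<in> J" for j
      using \<phi> that by (auto simp: bij_betw_def intro: the_inv_into_f_f)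
    have \<psi>I: "?\<psi> i \<in> J" "\<phi> (?\<psi> i) = i" if "i \<in> I" for i
      using bij_betw_apply[OF bij_betw_the_inv_into[OF \<phi>] that] f_the_inv_into_f_bij_betw[OF \<phi>] that by auto
    have "PiE J A \<in> sets (lebP J)" using A J by (intro sets_PiM_I_finite) auto
    then have "emeasure (distr (lebP I) (lebP J) (\<lambda>x. \<lambda>j\<in>J. x (\<phi> j))) (PiE J A) =
        emeasure (lebP I) ((\<lambda>x. \<lambda>j\<in>J. x (\<phi> j)) -` PiE J A \<inter> space (lebP I))"
      by (rule emeasure_distr[OF meas])
    also have "(\<lambda>x. \<lambda>j\<in>J. x (\<phi> j)) -` PiE J A \<inter> space (lebP I) = PiE I (\<lambda>i. A (?\<psi> i))"
    proof (intro equalityI subsetI)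
      fix x assume x: "x \<in> (\<lambda>x. \<lambda>j\<in>J. x (\<phi> j)) -` PiE J A \<inter> space (lebP I)"
      then have xJ: "(\<lambda>j\<in>J. x (\<phi> j)) \<in> PiE J A" and xI: "x \<in> extensional I" by (auto simp: space_PiM PiE_def)
      show "x \<in> PiE I (\<lambda>i. A (?\<psi> i))"
      proof (rule PiE_I)
        fix i assume "i \<in> I"
        then show "x i \<in> A (?\<psi> i)" using PiE_mem[OF xJ, of "?\<psi> i"] \<psi>I by simp
      qed (use xI in \<open>auto simp: extensional_def\<close>)
    next
      fix x assume x: "x \<in> PiE I (\<lambda>i. A (?\<psi> i))"
      have "x (\<phi> j) \<in> A j" if "j \<in> J" for j using PiE_mem[OF x \<phi>I[OF that]] \<psi>[OF that] by simp
      then show "x \<in> (\<lambda>x. \<lambda>j\<in>J. x (\<phi> j)) -` PiE J A \<inter> space (lebP I)"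
        using x by (auto simp: space_PiM PiE_def)
    qed
    also have "emeasure (lebP I) (PiE I (\<lambda>i. A (?\<psi> i))) = (\<Prod>i\<in>I. emeasure lborel (A (?\<psi> i)))"
      using I A \<psi>I by (intro I.emeasure_PiM) auto
    also have "\<dots> = (\<Prod>j\<in>J. emeasure lborel (A j))"
      using prod.reindex_bij_betw[OF \<phi>, of "\<lambda>i. emeasure lborel (A (?\<psi> i))"] \<psi> by simp
    finally show "emeasure (distr (lebP I) (lebP J) (\<lambda>x. \<lambda>j\<in>J. x (\<phi> j))) (PiE J A) =
        (\<Prod>j\<in>J. emeasure lborel (A j))" .
  qed simp
qed

lemma nn_integral_PiM_reindex:
  fixes I :: "'a set" and J :: "'b set"
  assumes \<phi>: "bij_betw \<phi> J I" and J: "finite J" and f: "f \<in> borel_measurable (lebP J)"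
  shows "(\<integral>\<^sup>+x. f x \<partial>lebP J) = (\<integral>\<^sup>+x. f (\<lambda>j\<in>J. x (\<phi> j)) \<partial>lebP I)"
proof -
  have "(\<lambda>x. \<lambda>j\<in>J. x (\<phi> j)) \<in> measurable (lebP I) (lebP J)"
    using bij_betw_apply[OF \<phi>] by (intro measurable_restrict measurable_component_singleton)
  then show ?thesis
    using nn_integral_distr[of "\<lambda>x. \<lambda>j\<in>J. x (\<phi> j)" "lebP I" "lebP J" f] f
    unfolding PiM_lborel_reindex[OF \<phi> J] by simp
qed

lemma AE_lebN_coordinate_neq:
  assumes "i < m"
  shows "AE x in lebN m. x i \<noteq> c"
proof -
  interpret product_sigma_finite "\<lambda>_::nat. lborel :: real measure" by standard
  let ?A = "\<lambda>j. if j = i then {c} else UNIV :: real set"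
  have "emeasure (lebN m) (PiE {..<m} ?A) = (\<Prod>j<m. emeasure lborel (?A j))"
    by (intro emeasure_PiM) auto
  also have "\<dots> = 0" using assms by (auto intro!: prod_zero bexI[of _ i])
  finally have "PiE {..<m} ?A \<in> null_sets (lebN m)"
    by (intro null_setsI) (auto intro!: sets_PiM_I_finite)
  then show ?thesis
    by (rule AE_I') (auto simp: space_PiM PiE_iff extensional_def)
qed

lemma prod_pairs_swap:
  fixes g :: "nat \<Rightarrow> nat \<Rightarrow> 'a::comm_monoid_mult"
  shows "(\<Prod>i<m. \<Prod>j\<in>{i<..<m}. g i j) = (\<Prod>j<m. \<Prod>i<j. g i j)"
proof (induction m)
  case (Suc m)
  have "(\<Prod>i<m. \<Prod>j\<in>{i<..<Suc m}. g i j) = (\<Prod>i<m. g i m * (\<Prod>j\<in>{i<..<m}. g i j))"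
  proof (intro prod.cong refl)
    fix i assume "i \<in> {..<m}"
    then have "{i<..<Suc m} = insert m {i<..<m}" by auto
    then show "(\<Prod>j\<in>{i<..<Suc m}. g i j) = g i m * (\<Prod>j\<in>{i<..<m}. g i j)" by simp
  qed
  moreover have "{m<..<Suc m} = {}" by auto
  ultimately show ?case using Suc by (simp add: prod.distrib mult.commute)
qed simp

lemma prod_pairs:
  fixes f :: "nat \<Rightarrow> 'a::comm_monoid_mult"
  shows "(\<Prod>a<n. f a) = (\<Prod>i<n div 2. f (2 * i) * f (2 * i + 1)) * (if odd n then f (2 * (n div 2)) else 1)"
proof -
  have even: "(\<Prod>a<2 * q. f a) = (\<Prod>i<q. f (2 * i) * f (2 * i + 1))" for q
    by (induction q) (auto simp: mult_ac)
  show ?thesis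
  proof (cases "even n")
    case True
    then show ?thesis using even[of "n div 2"] by simp
  next
    case False
    then have "n = Suc (2 * (n div 2))" by presburger
    then have "(\<Prod>a<n. f a) = (\<Prod>a<2 * (n div 2). f a) * f (2 * (n div 2))"
      by (metis lessThan_Suc finite_lessThan lessThan_iff less_irrefl prod.insert mult.commute)
    then show ?thesis using False even[of "n div 2"] by simp
  qed
qed

context monomial_curve
begin

definition extend_nodes :: "(nat \<Rightarrow> real) \<Rightarrow> nat \<Rightarrow> real" where
  "extend_nodes x i = (if i < n div 2 then x i else 1)"

definition double_nodes :: "(nat \<Rightarrow> real) \<Rightarrow> nat \<Rightarrow> real" where
  "double_nodes x i = (if i < 2 * (n div 2) then x (i div 2) else 1)"

text \<open>Up to sign, the factor of the Jacobian that depends on the nodes alone.\<close>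

definition jac_density :: "(nat \<Rightarrow> nat) \<Rightarrow> (nat \<Rightarrow> real) \<Rightarrow> real" where
  "jac_density lam x = schur n lam (double_nodes x) *
    (\<Prod>i<n div 2. \<Prod>j\<in>{i<..<n div 2}. (x i - x j) ^ 4) *
    (if odd n then \<Prod>i<n div 2. (1 - x i)\<^sup>2 else 1)"

definition ordered_density :: "(nat \<Rightarrow> nat) \<Rightarrow> (nat \<Rightarrow> real) \<Rightarrow> ennreal" where
  "ordered_density lam x = ennreal (of_bool (nodes_ok (extend_nodes x)) * jac_density lam x)"

lemma node_eq: "node u = extend_nodes (\<lambda>i. u (2 * i + 1))"
  by (auto simp: node_def extend_nodes_def fun_eq_iff)

lemma extend_nodes_cong: "(\<And>i. i < n div 2 \<Longrightarrow> x i = y i) \<Longrightarrow> extend_nodes x = extend_nodes y"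
  by (auto simp: extend_nodes_def fun_eq_iff)

lemma jac_density_cong:
  assumes "\<And>i. i < n div 2 \<Longrightarrow> x i = y i"
  shows "jac_density lam x = jac_density lam y"
proof -
  have "double_nodes x = double_nodes y"
  proof
    fix i
    have "i div 2 < n div 2" if "i < 2 * (n div 2)" using that by presburger
    then show "double_nodes x i = double_nodes y i" using assms by (simp add: double_nodes_def)
  qed
  then show ?thesis using assms by (simp add: jac_density_def)
qed

lemma params_iff:
  "u \<in> params \<longleftrightarrow> u \<in> {..<n} \<rightarrow>\<^sub>E UNIV \<and> ((\<forall>i<num_nodes. 0 < u (2 * i)) \<and> (\<Sum>i<num_nodes. u (2 * i)) \<le> 1) \<and>
    nodes_ok (extend_nodes (\<lambda>i. u (2 * i + 1)))"
  unfolding params_def node_eq[symmetric] mem_Collect_eq by blast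

lemma half_le_num_nodes: "n div 2 \<le> num_nodes"
  by (simp add: num_nodes_def)

text \<open>The odd rows of the divided difference matrix become powers of perturbed nodes \<open>x + t\<close>; the
  confluent determinant is the limit \<open>t \<rightarrow> 0\<close> of a Schur polynomial times a Vandermonde product from
  which the vanishing factors \<open>(x + t) - x\<close> have been cancelled.\<close>

lemma detN_jac_eq:
  assumes lam: "\<And>j. j < n \<Longrightarrow> lam j + n - 1 - j = e j"
  shows "detN n (jac u u) = of_int (sign (rev_perm n)) *
    ((\<Prod>i<n div 2. u (2 * i)) * jac_density lam (\<lambda>i. u (2 * i + 1)))"
proof -
  define h where "h = n div 2"
  define sg where "sg = real_of_int (sign (rev_perm n))"
  define U where "U = (\<Prod>i<h. u (2 * i))"
  \<comment> \<open>Each free node occurs in two consecutive rows, the second time shifted by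
    \<open>t\<close>. For odd \<open>n\<close> the last row carries the node 1 without a
    shift.\<close>
  define z where "z t a = node u (a div 2) + (if odd a then t else 0)" for t a
  define v where "v t l = (if odd l then u l + t else u l)" for t l
  \<comment> \<open>The Vandermonde factors of row \<open>b\<close> against all earlier pairs. The
    one factor within a pair is exactly \<open>t\<close>, and it is split off to be
    cancelled.\<close>
  define f where "f t b = (\<Prod>a<2 * (b div 2). z t b - z t a)" for t b
  define R where "R t = (\<Prod>i<h. f t (2 * i) * f t (2 * i + 1)) * (if odd n then f t (2 * h) else 1)" for t
  have V: "(\<Prod>b<n. \<Prod>a<b. z t b - z t a) = t ^ h * R t" for t
  proof -
    have "(\<Prod>b<n. \<Prod>a<b. z t b - z t a) = (\<Prod>b<n. (if odd b then t else 1) * f t b)"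
    proof (intro prod.cong refl)
      fix b
      show "(\<Prod>a<b. z t b - z t a) = (if odd b then t else 1) * f t b"
      proof (cases "odd b")
        case True
        then obtain i where "b = 2 * i + 1" by (rule oddE)
        then show ?thesis by (simp add: f_def z_def)
      qed (simp add: f_def)
    qed
    also have "\<dots> = t ^ h * R t"
      unfolding prod.distrib prod_pairs[of "\<lambda>b. if odd b then t else 1"] prod_pairs[of "f t"]
      by (simp add: h_def R_def prod.distrib)
    finally show ?thesis .
  qed
  have det_z: "detN n (\<lambda>a j. z t a ^ e j) = sg * (schur n lam (z t) * (t ^ h * R t))" for t
  proof -
    have "detN n (\<lambda>a j. z t a ^ e j) = detN n (\<lambda>a j. z t a ^ (lam j + n - 1 - j))"
      by (rule detN_cong) (simp only: lam)
    also have "\<dots> = schur n lam (z t) * (sg * (t ^ h * R t))"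
      unfolding schur_mult_Vandermonde[symmetric] detN_reverse_cols[of n "\<lambda>a j. z t a ^ j"]
        detN_Vandermonde V sg_def ..
    finally show ?thesis by (simp add: mult_ac)
  qed
  have scaled: "t ^ h * detN n (jac u (v t)) = U * detN n (\<lambda>a j. z t a ^ e j)" for t
  proof -
    \<comment> \<open>Multiplying the odd rows by \<open>t\<close> turns divided differences into
      differences of powers, with the weights \<open>?w\<close> as row factors. Subtracting the
      preceding row is multiplication by the unitriangular \<open>?L\<close>, so the determinant is
      that of the plain powers.\<close>
    let ?r = "\<lambda>a::nat. if odd a then t else 1" and ?w = "\<lambda>a. if odd a then u (a - 1) else 1"
    let ?M = "\<lambda>a j. if odd a then z t a ^ e j - z t (a - 1) ^ e j else z t a ^ e j"
    have "(\<Prod>a<n. ?r a) = t ^ h" unfolding prod_pairs[of ?r] by (simp add: h_def)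
    moreover have "(\<Prod>a<n. ?w a) = U" unfolding prod_pairs[of ?w] by (simp add: h_def U_def)
    moreover have "detN n (\<lambda>a j. ?r a * jac u (v t) a j) = detN n (\<lambda>a j. ?w a * ?M a j)"
    proof (rule detN_cong)
      fix a j assume "a < n" "j < n"
      show "?r a * jac u (v t) a j = ?w a * ?M a j"
      proof (cases "odd a")
        case True
        then obtain i where i: "a = 2 * i + 1" by (rule oddE)
        have nv: "node (v t) i = node u i + t" using \<open>a < n\<close> i by (simp add: node_def v_def)
        have "t * pdd [node u i, node u i + t] (e j) = (node u i + t) ^ e j - node u i ^ e j"
          using power_diff_pdd[of "node u i" "e j" "node u i + t"] by (simp add: algebra_simps)
        then have "t * (u (2 * i) * pdd [node u i, node u i + t] (e j)) =
            u (2 * i) * ((node u i + t) ^ e j - node u i ^ e j)"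
          by (simp add: mult.left_commute)
        then show ?thesis using i nv by (simp add: jac_def z_def v_def)
      qed (simp add: jac_def z_def)
    qed
    moreover have "detN n ?M = detN n (\<lambda>a j. z t a ^ e j)"
    proof -
      let ?L = "\<lambda>a k. if k = a then 1 else if odd a \<and> Suc k = a then - 1 else 0 :: real"
      have "?M a j = (\<Sum>k<n. ?L a k * z t k ^ e j)" if "a < n" for a j
      proof -
        have "(\<Sum>k<n. ?L a k * z t k ^ e j) = (\<Sum>k\<in>{a, a - 1}. ?L a k * z t k ^ e j)"
          by (rule sum.mono_neutral_right) (use that in auto)
        also have "\<dots> = ?M a j" by (cases "odd a"; cases a) auto
        finally show ?thesis ..
      qed
      then have "detN n ?M = detN n (\<lambda>a j. \<Sum>k<n. ?L a k * z t k ^ e j)" by (intro detN_cong) auto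
      also have "\<dots> = detN n ?L * detN n (\<lambda>a j. z t a ^ e j)" by (rule detN_mult)
      also have "detN n ?L = 1" by (subst detN_lower_triangular) auto
      finally show ?thesis by simp
    qed
    ultimately show ?thesis using detN_mult_rows[of n ?r "jac u (v t)"] detN_mult_rows[of n ?w ?M] by simp
  qed
  have eq: "detN n (jac u (v t)) = sg * (U * (schur n lam (z t) * R t))" if "t \<noteq> 0" for t
  proof -
    have "t ^ h * detN n (jac u (v t)) = t ^ h * (sg * (U * (schur n lam (z t) * R t)))"
      unfolding scaled det_z by (simp only: mult_ac)
    then show ?thesis using that by simp
  qed
  have cz: "continuous_on UNIV (\<lambda>t. z t a)" for a
    unfolding z_def by (cases "odd a") (auto intro!: continuous_intros)
  have cv: "continuous_on UNIV v"
  proof (rule continuous_on_fun)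
    show "continuous_on UNIV (\<lambda>t. v t l)" for l
      unfolding v_def by (cases "odd l") (auto intro!: continuous_intros)
  qed
  have cz': "continuous_on UNIV z" by (rule continuous_on_fun) (rule cz)
  have cL: "continuous_on UNIV (\<lambda>t. detN n (jac u (v t)))"
    by (rule continuous_on_detN_jac[OF continuous_on_const cv])
  have cS: "continuous_on UNIV (\<lambda>t. schur n lam (z t))"
    by (rule continuous_on_compose2[OF poly_fun_continuous[OF poly_fun_schur] cz']) simp
  have cR: "continuous_on UNIV R"
    unfolding R_def[abs_def] f_def
    by (cases "odd n") (simp_all, (intro continuous_on_mult continuous_on_prod continuous_on_diff cz)+)
  have cRHS: "continuous_on UNIV (\<lambda>t. sg * (U * (schur n lam (z t) * R t)))"
    by (intro continuous_on_mult continuous_on_const cS cR)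
  have lim1: "((\<lambda>t. detN n (jac u (v t))) \<longlongrightarrow> detN n (jac u (v 0))) (at 0)"
    using cL by (simp add: continuous_on_eq_continuous_at isCont_def)
  have lim2: "((\<lambda>t. sg * (U * (schur n lam (z t) * R t))) \<longlongrightarrow> sg * (U * (schur n lam (z 0) * R 0))) (at 0)"
    using cRHS by (simp add: continuous_on_eq_continuous_at isCont_def)
  have "detN n (jac u (v 0)) = sg * (U * (schur n lam (z 0) * R 0))"
  proof (rule tendsto_unique[OF _ lim1])
    show "((\<lambda>t. detN n (jac u (v t))) \<longlongrightarrow> sg * (U * (schur n lam (z 0) * R 0))) (at 0)"
      by (rule Lim_transform_eventually[OF lim2]) (auto simp: eventually_at_filter eq)
  qed simp
  moreover have "v 0 = u" by (simp add: v_def fun_eq_iff)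
  moreover have "schur n lam (z 0) = schur n lam (double_nodes (\<lambda>i. u (2 * i + 1)))"
  proof (rule schur_cong)
    fix i assume "i < n"
    have "i < 2 * (n div 2) \<longleftrightarrow> 2 * (i div 2) + 1 < n" using \<open>i < n\<close> by presburger
    then show "z 0 i = double_nodes (\<lambda>i. u (2 * i + 1)) i"
      by (simp add: z_def double_nodes_def node_def)
  qed
  moreover have "R 0 = (\<Prod>i<h. \<Prod>j\<in>{i<..<h}. (u (2 * i + 1) - u (2 * j + 1)) ^ 4) *
      (if odd n then \<Prod>i<h. (1 - u (2 * i + 1))\<^sup>2 else 1)"
  proof -
    have sq: "(\<Prod>a<2 * i. c - z 0 a) = (\<Prod>l<i. (c - u (2 * l + 1))\<^sup>2)" if "i \<le> h" for i c
    proof -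
      have "(\<Prod>a<2 * i. c - z 0 a) = (\<Prod>l<i. (c - z 0 (2 * l)) * (c - z 0 (2 * l + 1)))"
        using prod_pairs[of "\<lambda>a. c - z 0 a" "2 * i"] by simp
      also have "\<dots> = (\<Prod>l<i. (c - u (2 * l + 1))\<^sup>2)"
        using that by (intro prod.cong) (auto simp: z_def node_def h_def power2_eq_square)
      finally show ?thesis .
    qed
    have "(\<Prod>i<h. f 0 (2 * i) * f 0 (2 * i + 1)) = (\<Prod>i<h. \<Prod>l<i. (u (2 * l + 1) - u (2 * i + 1)) ^ 4)"
    proof (intro prod.cong refl)
      fix i assume i: "i \<in> {..<h}"
      have zi: "z 0 (2 * i) = u (2 * i + 1)" "z 0 (2 * i + 1) = u (2 * i + 1)"
        using i by (auto simp: z_def node_def h_def)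
      have "(x - y)\<^sup>2 * (x - y)\<^sup>2 = (y - x) ^ 4" for x y :: real
        by (simp add: power4_eq_xxxx power2_eq_square algebra_simps)
      then show "f 0 (2 * i) * f 0 (2 * i + 1) = (\<Prod>l<i. (u (2 * l + 1) - u (2 * i + 1)) ^ 4)"
        using i zi by (simp add: f_def sq prod.distrib[symmetric])
    qed
    also have "\<dots> = (\<Prod>i<h. \<Prod>j\<in>{i<..<h}. (u (2 * i + 1) - u (2 * j + 1)) ^ 4)"
      by (rule prod_pairs_swap[symmetric])
    moreover have "f 0 (2 * h) = (\<Prod>i<h. (1 - u (2 * i + 1))\<^sup>2)" if "odd n"
    proof -
      have "n = 2 * h + 1" using that by (simp add: h_def)
      then have "\<not> 2 * h + 1 < n" by simp
      then have "z 0 (2 * h) = 1" by (simp add: z_def node_def)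
      then show ?thesis by (simp add: f_def sq)
    qed
    ultimately show ?thesis unfolding R_def by simp
  qed
  ultimately show ?thesis by (simp add: jac_density_def U_def sg_def h_def mult.assoc)
qed

lemma jac_density_nonneg:
  assumes lam: "\<And>j. j < n \<Longrightarrow> lam j + n - 1 - j = e j" and x: "\<And>i. i < n div 2 \<Longrightarrow> 0 \<le> x i"
  shows "0 \<le> jac_density lam x"
proof -
  have "0 \<le> schur n lam (double_nodes x)"
  proof (rule schur_nonneg)
    show "lam j + n - 1 - j < lam i + n - 1 - i" if "i < j" "j < n" for i j
      using e_dec[OF that] lam that by simp
    fix i assume "i < n"
    have "i div 2 < n div 2" if "i < 2 * (n div 2)" using that by presburger
    then show "0 \<le> double_nodes x i" using x by (simp add: double_nodes_def)
  qed
  moreover have "0 \<le> (\<Prod>i<n div 2. \<Prod>j\<in>{i<..<n div 2}. (x i - x j) ^ 4)"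
    by (intro prod_nonneg ballI) simp
  moreover have "0 \<le> (if odd n then \<Prod>i<n div 2. (1 - x i)\<^sup>2 else 1)"
    by (auto intro!: prod_nonneg)
  ultimately show ?thesis by (simp add: jac_density_def)
qed

text \<open>A permutation of the free nodes lifts to the permutation \<open>P\<close> of the doubled
  list that moves pairs as blocks, under which the Schur polynomial is invariant. The remaining
  products are symmetric; the Vandermonde sign disappears in the fourth power.\<close>

lemma jac_density_permute:
  assumes p: "p permutes {..<n div 2}"
  shows "jac_density lam (\<lambda>i. x (p i)) = jac_density lam x"
proof -
  define h where "h = n div 2"
  note p = p[folded h_def]
  define P where "P a = (if a < 2 * h then 2 * p (a div 2) + a mod 2 else a)" for a
  have ph: "p i < h \<longleftrightarrow> i < h" for i using permutes_in_image[OF p, of i] by simp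
  have div: "a div 2 < h \<longleftrightarrow> a < 2 * h" for a by presburger
  have P2: "P a < 2 * h \<longleftrightarrow> a < 2 * h" "a < 2 * h \<Longrightarrow> P a div 2 = p (a div 2)" "a < 2 * h \<Longrightarrow> P a mod 2 = a mod 2" for a
    using ph[of "a div 2"] div[of a] by (auto simp: P_def)
  have inj: "inj_on P {..<n}"
  proof (rule inj_onI)
    fix a b assume "P a = P b"
    show "a = b"
    proof (cases "a < 2 * h")
      case True
      then have b: "b < 2 * h" using P2(1)[of a] P2(1)[of b] \<open>P a = P b\<close> by simp
      have "p (a div 2) = p (b div 2)" "a mod 2 = b mod 2"
        using P2(2,3)[OF True] P2(2,3)[OF b] \<open>P a = P b\<close> by auto
      then have "a div 2 = b div 2" "a mod 2 = b mod 2" using permutes_inj[OF p] by (auto dest: injD)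
      then show ?thesis by (metis div_mult_mod_eq)
    next
      case False
      then have "\<not> b < 2 * h" using P2(1)[of a] P2(1)[of b] \<open>P a = P b\<close> by simp
      then show ?thesis using False \<open>P a = P b\<close> by (simp add: P_def)
    qed
  qed
  have h2: "2 * h \<le> n" by (simp add: h_def)
  have sub: "P ` {..<n} \<subseteq> {..<n}"
  proof (rule image_subsetI)
    fix a assume "a \<in> {..<n}"
    then show "P a \<in> {..<n}"
      using P2(1)[of a] h2 by (cases "a < 2 * h") (auto simp: P_def)
  qed
  have "bij_betw P {..<n} {..<n}"
    unfolding bij_betw_def using inj endo_inj_surj[OF _ sub inj] by simp
  then have P: "P permutes {..<n}" by (rule bij_imp_permutes) (use h2 in \<open>auto simp: P_def\<close>)
  have "double_nodes (\<lambda>i. x (p i)) = (\<lambda>a. double_nodes x (P a))"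
    using P2 by (auto simp: double_nodes_def fun_eq_iff h_def[symmetric])
  then have 1: "schur n lam (double_nodes (\<lambda>i. x (p i))) = schur n lam (double_nodes x)"
    using schur_permute[OF P, of lam "double_nodes x"] by simp
  have vdm: "(\<Prod>i<h. \<Prod>j\<in>{i<..<h}. (y i - y j) ^ 4) = (detN h (\<lambda>i j. y i ^ j)) ^ 4" for y :: "nat \<Rightarrow> real"
  proof -
    have "(a - b) ^ 4 = (b - a) ^ 4" for a b :: real
      by (simp add: power4_eq_xxxx algebra_simps)
    then show ?thesis
      unfolding prod_pairs_swap detN_Vandermonde prod_power_distrib by (intro prod.cong refl)
  qed
  have "(real_of_int (sign p)) ^ 4 = 1" by (simp add: sign_def)
  then have 2: "(\<Prod>i<h. \<Prod>j\<in>{i<..<h}. (x (p i) - x (p j)) ^ 4) = (\<Prod>i<h. \<Prod>j\<in>{i<..<h}. (x i - x j) ^ 4)"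
    unfolding vdm vdm[of "\<lambda>i. x (p i)"] detN_permute_rows[OF p, of "\<lambda>i j. x i ^ j"]
    by (simp add: power_mult_distrib)
  have 3: "(\<Prod>i<h. (1 - x (p i))\<^sup>2) = (\<Prod>i<h. (1 - x i)\<^sup>2)"
    using prod.permute[OF p, of "\<lambda>i. (1 - x i)\<^sup>2"] by (simp add: o_def)
  show ?thesis unfolding jac_density_def h_def[symmetric] 1 2 3 ..
qed

lemma continuous_on_jac_density: "continuous_on UNIV (jac_density lam)"
proof -
  have "continuous_on UNIV double_nodes"
  proof (rule continuous_on_fun)
    show "continuous_on UNIV (\<lambda>x. double_nodes x i)" for i
      unfolding double_nodes_def by (cases "i < 2 * (n div 2)") (simp_all add: continuous_on_coordinate)
  qed
  then have "continuous_on UNIV (\<lambda>x. schur n lam (double_nodes x))"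
    by (rule continuous_on_compose2[OF poly_fun_continuous[OF poly_fun_schur]]) simp
  moreover have "continuous_on UNIV (\<lambda>x. if odd n then \<Prod>i<n div 2. (1 - x i)\<^sup>2 else 1 :: real)"
    by (cases "odd n") (simp_all, intro continuous_on_prod continuous_on_power continuous_on_diff
        continuous_on_const continuous_on_coordinate)
  ultimately show ?thesis
    unfolding jac_density_def[abs_def]
    by (intro continuous_on_mult continuous_on_prod continuous_on_power continuous_on_diff continuous_on_coordinate)
qed

lemma borel_measurable_ordered_density:
  "ordered_density lam \<in> borel_measurable borel"
proof -
  have c: "continuous_on UNIV (\<lambda>x. extend_nodes x i)" for i
    unfolding extend_nodes_def by (cases "i < n div 2") (simp_all add: continuous_on_coordinate)
  have [measurable]: "(\<lambda>x. extend_nodes x i) \<in> borel_measurable borel" for i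
    by (rule borel_measurable_continuous_onI[OF c])
  have [measurable]: "jac_density lam \<in> borel_measurable borel"
    by (rule borel_measurable_continuous_onI[OF continuous_on_jac_density])
  have [measurable]: "Measurable.pred borel (\<lambda>x. \<forall>i\<in>{i. Suc i < num_nodes}. extend_nodes x i < extend_nodes x (Suc i))"
    by (rule pred_intros_finite)
      (auto intro: finite_subset[of _ "{..<num_nodes}"])
  have "Measurable.pred borel (\<lambda>x. 0 < extend_nodes x 0 \<and>
      (\<forall>i\<in>{i. Suc i < num_nodes}. extend_nodes x i < extend_nodes x (Suc i)) \<and> extend_nodes x (num_nodes - 1) \<le> 1)"
    by measurable
  then have [measurable]: "Measurable.pred borel (\<lambda>x. nodes_ok (extend_nodes x))"
    by (simp add: nodes_ok_def)
  show ?thesis unfolding ordered_density_def[abs_def] by measurable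
qed

text \<open>Odd coordinates are nodes, even ones are weights, and the integrand factors accordingly.
  All weights (\<open>I\<close>) lie in the simplex, only those of free nodes (\<open>I'\<close>)
  occur in the Jacobian; their numbers add up to \<open>n\<close>, so the Dirichlet integral is
  \<open>1 / fact n\<close>.\<close>

lemma nn_integral_params:
  assumes lam: "\<And>j. j < n \<Longrightarrow> lam j + n - 1 - j = e j"
  shows "(\<integral>\<^sup>+u. ennreal \<bar>detN n (jac u u)\<bar> * indicator params u \<partial>lebN n) =
    (\<integral>\<^sup>+x. ordered_density lam x \<partial>lebN (n div 2)) * ennreal (1 / fact n)"
proof -
  interpret product_sigma_finite "\<lambda>_::nat. lborel :: real measure" by standard
  define h where "h = n div 2"
  define I where "I = (\<lambda>i. 2 * i) ` {..<num_nodes}"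
  define I' where "I' = (\<lambda>i. 2 * i) ` {..<h}"
  define J where "J = (\<lambda>i. 2 * i + 1) ` {..<h}"
  have split: "{..<n} = J \<union> I" "J \<inter> I = {}" "finite I" "finite J" "I' \<subseteq> I"
  proof -
    show "{..<n} = J \<union> I"
    proof (intro equalityI subsetI)
      fix a assume a: "a \<in> {..<n}"
      show "a \<in> J \<union> I"
      proof (cases "even a")
        case True
        then have "a = 2 * (a div 2)" "a div 2 < num_nodes" using a by (auto simp: num_nodes_def)
        then show ?thesis unfolding I_def by blast
      next
        case False
        then have "a = 2 * (a div 2) + 1" "a div 2 < h" using a by (auto simp: h_def) presburger+
        then show ?thesis unfolding J_def by blast
      qed
    qed (auto simp: I_def J_def h_def num_nodes_def)
    show "J \<inter> I = {}" by (auto simp: I_def J_def) presburger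
  qed (auto simp: I_def I'_def J_def h_def num_nodes_def)
  have cards: "card I + card I' = n"
    unfolding I_def I'_def h_def num_nodes_def by (subst (1 2) card_image) (auto simp: inj_on_def)
  define W where "W w = ennreal (of_bool ((\<forall>i\<in>I. 0 < w i) \<and> sum w I \<le> 1) * (\<Prod>i\<in>I'. w i))" for w :: "nat \<Rightarrow> real"
  define V where "V = ordered_density lam"
  define odds where "odds u = (\<lambda>i\<in>{..<h}. u (2 * i + 1))" for u :: "nat \<Rightarrow> real"
  have sum_I: "sum w I = (\<Sum>i<num_nodes. w (2 * i))" for w :: "nat \<Rightarrow> real"
    unfolding I_def by (subst sum.reindex) (auto simp: inj_on_def)
  have prod_I': "(\<Prod>i\<in>I'. w i) = (\<Prod>i<h. w (2 * i))" for w :: "nat \<Rightarrow> real"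
    unfolding I'_def by (subst prod.reindex) (auto simp: inj_on_def)
  have density: "ennreal \<bar>detN n (jac u u)\<bar> * indicator params u = V (odds u) * W u"
    if u: "u \<in> {..<n} \<rightarrow>\<^sub>E UNIV" for u
  proof -
    let ?x = "\<lambda>i. u (2 * i + 1)"
    have ext: "extend_nodes (odds u) = extend_nodes ?x"
      by (rule extend_nodes_cong) (simp add: odds_def h_def)
    have jd: "jac_density lam (odds u) = jac_density lam ?x"
      by (rule jac_density_cong) (simp add: odds_def h_def)
    have weights: "((\<forall>i\<in>I. 0 < u i) \<and> sum u I \<le> 1) \<longleftrightarrow> (\<forall>i<num_nodes. 0 < u (2 * i)) \<and> (\<Sum>i<num_nodes. u (2 * i)) \<le> 1"
      unfolding sum_I unfolding I_def by auto
    have iff: "u \<in> params \<longleftrightarrow> ((\<forall>i\<in>I. 0 < u i) \<and> sum u I \<le> 1) \<and> nodes_ok (extend_nodes (odds u))"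
      unfolding params_iff ext weights using u by blast
    show ?thesis
    proof (cases "u \<in> params")
      case True
      have upos: "0 < u (2 * i)" if "i < h" for i
        using True that half_le_num_nodes by (auto simp: params_iff h_def)
      have "0 \<le> jac_density lam ?x"
      proof (rule jac_density_nonneg[OF lam])
        fix i assume "i < n div 2"
        then have "2 * i + 1 < n" "i < num_nodes" using half_le_num_nodes by auto
        then show "0 \<le> u (2 * i + 1)"
          using node_bounds(1)[OF True, of i] by (simp add: node_def)
      qed
      moreover have "0 \<le> (\<Prod>i<h. u (2 * i))" using upos by (intro prod_nonneg) (auto intro: less_imp_le)
      moreover have "\<bar>real_of_int (sign (rev_perm n))\<bar> = 1" by (simp add: sign_def)
      ultimately have "\<bar>detN n (jac u u)\<bar> = jac_density lam ?x * (\<Prod>i<h. u (2 * i))"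
        by (simp add: detN_jac_eq[OF lam] abs_mult h_def)
      then show ?thesis
        using True iff \<open>0 \<le> jac_density lam ?x\<close>
        by (simp add: V_def ordered_density_def W_def jd prod_I' ennreal_mult')
    next
      case False
      then show ?thesis using iff by (auto simp: V_def ordered_density_def W_def)
    qed
  qed
  let ?f = "\<lambda>u. ennreal \<bar>detN n (jac u u)\<bar> * indicator params u"
  have f: "?f \<in> borel_measurable (lebN n)"
  proof -
    have "(\<lambda>u. \<bar>detN n (jac u u)\<bar>) \<in> borel_measurable borel"
      by (intro borel_measurable_continuous_onI continuous_intros continuous_on_detN_jac continuous_on_id)
    then have "(\<lambda>u. ennreal \<bar>detN n (jac u u)\<bar>) \<in> borel_measurable borel"
      by (rule measurable_compose[OF _ measurable_ennreal])
    moreover have "params \<in> sets borel"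
      unfolding params_UN using compact_params_margin by (intro sets.countable_UN) (auto intro: borel_compact)
    ultimately have "?f \<in> borel_measurable borel" by simp
    then show ?thesis by (rule borel_measurable_lebN)
  qed
  have W_int: "(\<integral>\<^sup>+w. W w \<partial>lebP I) = ennreal (1 / fact n)"
    unfolding W_def using simplex_integral[OF split(3,5), of 1] cards by simp
  have W_meas: "W \<in> borel_measurable (lebP I)"
    unfolding W_def[abs_def] by (rule borel_measurable_simplex_integrand[OF split(3,5)])
  have V_meas: "V \<in> borel_measurable (lebN h)"
    unfolding V_def by (rule borel_measurable_lebN[OF borel_measurable_ordered_density])
  have bij: "bij_betw (\<lambda>i. 2 * i + 1) {..<h} J"
    unfolding J_def by (rule inj_on_imp_bij_betw) (auto simp: inj_on_def)
  have odds_meas: "odds \<in> measurable (lebP J) (lebN h)"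
    unfolding odds_def[abs_def] by (intro measurable_restrict measurable_component_singleton) (simp add: J_def)
  have "(\<integral>\<^sup>+u. ?f u \<partial>lebN n) =
      (\<integral>\<^sup>+x. \<integral>\<^sup>+y. ?f (merge J I (x, y)) \<partial>lebP I \<partial>lebP J)"
    unfolding split(1) by (rule product_nn_integral_fold[OF split(2,4,3)]) (use f in \<open>simp add: split(1)\<close>)
  also have "\<dots> = (\<integral>\<^sup>+x. V (odds x) * ennreal (1 / fact n) \<partial>lebP J)"
  proof (rule nn_integral_cong)
    fix x :: "nat \<Rightarrow> real" assume "x \<in> space (lebP J)"
    have "(\<integral>\<^sup>+y. ?f (merge J I (x, y)) \<partial>lebP I) = (\<integral>\<^sup>+y. V (odds x) * W y \<partial>lebP I)"
    proof (rule nn_integral_cong)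
      fix y :: "nat \<Rightarrow> real" assume "y \<in> space (lebP I)"
      let ?u = "merge J I (x, y)"
      have uI: "?u i = y i" if "i \<in> I" for i using that split(2) by (auto simp: merge_def)
      have uJ: "?u i = x i" if "i \<in> J" for i using that by (simp add: merge_def)
      have "odds ?u = odds x" unfolding odds_def by (rule restrict_ext) (rule uJ, simp add: J_def)
      moreover have "W ?u = W y"
      proof -
        have "(\<forall>i\<in>I. 0 < ?u i) \<longleftrightarrow> (\<forall>i\<in>I. 0 < y i)" using uI by simp
        moreover have "sum ?u I = sum y I" by (rule sum.cong) (use uI in auto)
        moreover have "(\<Prod>i\<in>I'. ?u i) = (\<Prod>i\<in>I'. y i)" by (rule prod.cong) (use uI split(5) in auto)
        ultimately show ?thesis by (simp only: W_def)
      qed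
      moreover have "?u \<in> {..<n} \<rightarrow>\<^sub>E UNIV" unfolding split(1) by (auto simp: PiE_def extensional_def merge_def)
      ultimately show "?f ?u = V (odds x) * W y" using density[of ?u] by simp
    qed
    also have "\<dots> = V (odds x) * (\<integral>\<^sup>+y. W y \<partial>lebP I)" by (rule nn_integral_cmult[OF W_meas])
    finally show "(\<integral>\<^sup>+y. ?f (merge J I (x, y)) \<partial>lebP I) = V (odds x) * ennreal (1 / fact n)"
      by (simp only: W_int)
  qed
  also have "\<dots> = (\<integral>\<^sup>+x. V (odds x) \<partial>lebP J) * ennreal (1 / fact n)"
    by (rule nn_integral_multc) (rule measurable_compose[OF odds_meas V_meas])
  also have "(\<integral>\<^sup>+x. V (odds x) \<partial>lebP J) = (\<integral>\<^sup>+x. V x \<partial>lebN h)"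
    unfolding odds_def by (rule nn_integral_PiM_reindex[OF bij _ V_meas, symmetric]) simp
  finally show ?thesis by (simp only: V_def h_def)
qed

text \<open>The density is symmetric and relabelling preserves the measure, so each ordering of the
  free nodes contributes the same integral. Almost everywhere on the cube either exactly one
  permutation sorts the nodes admissibly or the density is 0.\<close>

lemma nn_integral_symmetrise:
  "(\<integral>\<^sup>+x. ennreal (indicator ({..<n div 2} \<rightarrow>\<^sub>E {0..1}) x * jac_density lam x) \<partial>lebN (n div 2)) =
    ennreal (fact (n div 2)) *
    (\<integral>\<^sup>+x. ordered_density lam x \<partial>lebN (n div 2))"
proof -
  define h where "h = n div 2"
  define S where "S = {p. p permutes {..<h}}"
  define Od where "Od = ordered_density lam"
  define perm where "perm p x = (\<lambda>i\<in>{..<h}. x (p i))" for p :: "nat \<Rightarrow> nat" and x :: "nat \<Rightarrow> real"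
  have Od_meas: "Od \<in> borel_measurable (lebN h)"
    unfolding Od_def by (rule borel_measurable_lebN[OF borel_measurable_ordered_density])
  have S: "finite S" "card S = fact h"
    unfolding S_def by (auto simp: finite_permutations card_permutations)
  \<comment> \<open>The values 0 and 1 are excluded because \<open>nodes_ok\<close> is strict at 0
    and, when the fixed node 1 is present, also at 1.\<close>
  have pointwise: "ennreal (indicator ({..<h} \<rightarrow>\<^sub>E {0..1}) x * jac_density lam x) = (\<Sum>p\<in>S. Od (perm p x))"
    if xs: "x \<in> space (lebN h)" and x01: "\<And>i. i < h \<Longrightarrow> x i \<noteq> 0 \<and> x i \<noteq> 1" for x
  proof -
    define ok where "ok p \<longleftrightarrow> nodes_ok (extend_nodes (perm p x))" for p
    have jd: "jac_density lam (perm p x) = jac_density lam x" if "p \<in> S" for p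
    proof -
      have "jac_density lam (perm p x) = jac_density lam (\<lambda>i. x (p i))"
        by (rule jac_density_cong) (simp add: perm_def h_def)
      also have "\<dots> = jac_density lam x"
        by (rule jac_density_permute) (use that in \<open>simp add: S_def h_def\<close>)
      finally show ?thesis .
    qed
    have en: "extend_nodes (perm p x) i = x (p i)" if "i < h" for p i
      using that by (simp add: extend_nodes_def perm_def h_def)
    have en1: "extend_nodes y i = 1" if "\<not> i < h" for y i
      using that by (simp add: extend_nodes_def h_def)
    have hM: "i < num_nodes" if "i < h" for i using that half_le_num_nodes by (simp add: h_def)
    have sorted: "x (p i) < x (p j)" if "ok p" "i < j" "j < h" for p i j
      using nodes_ok_mono[OF that(1)[unfolded ok_def] that(2) hM[OF that(3)]] that en by simp
    have bounds: "0 < x i \<and> x i \<le> 1" if "p \<in> S" "ok p" "i < h" for p i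
    proof -
      have "i \<in> p ` {..<h}" using permutes_image[of p "{..<h}"] that by (simp add: S_def)
      then obtain l where "l < h" "i = p l" by auto
      then show ?thesis using nodes_ok_bounds[OF that(2)[unfolded ok_def] hM, of l] en[of l p] by simp
    qed
    have Od_eq: "Od (perm p x) = ennreal (of_bool (ok p) * jac_density lam x)"
      if "p \<in> S" for p using jd[OF that] by (simp add: Od_def ordered_density_def ok_def)
    show ?thesis
    proof (cases "x \<in> {..<h} \<rightarrow>\<^sub>E {0..1}")
      case False
      have "\<exists>i<h. x i \<notin> {0..1}"
      proof (rule ccontr)
        assume "\<not> (\<exists>i<h. x i \<notin> {0..1})"
        then have "x \<in> {..<h} \<rightarrow>\<^sub>E {0..1}" using xs by (auto simp: space_PiM PiE_iff)
        then show False using False by simp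
      qed
      then obtain i where i: "i < h" "x i \<notin> {0..1}" by blast
      have "Od (perm p x) = 0" if "p \<in> S" for p
        using bounds[OF that _ i(1)] i(2) Od_eq[OF that] by (auto simp: less_imp_le)
      then show ?thesis using False by simp
    next
      case cube: True
      have x_open: "0 < x i" "x i < 1" if "i < h" for i
        using PiE_mem[OF cube, of i] x01[OF that] that by (auto simp: less_le)
      show ?thesis
      proof (cases "inj_on x {..<h}")
        case False
        \<comment> \<open>If two nodes coincide, the factor \<open>(x i - x j) ^ 4\<close> makes
          both sides 0.\<close>
        then obtain i j where ij: "i < h" "j < h" "i < j" "x i = x j"
          by (auto simp: inj_on_def) (metis linorder_neqE_nat)
        have P: "(\<Prod>j\<in>{i<..<h}. (x i - x j) ^ 4) = 0"
          by (rule prod_zero, simp, rule bexI[of _ j]) (use ij in simp_all)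
        have "(\<Prod>i<h. \<Prod>j\<in>{i<..<h}. (x i - x j) ^ 4) = 0"
          by (rule prod_zero[OF finite_lessThan bexI[of _ i]]) (simp_all only: P lessThan_iff ij(1))
        then have "jac_density lam x = 0" by (simp add: jac_density_def h_def)
        then show ?thesis using Od_eq by simp
      next
        case inj: True
        obtain q where q: "q permutes {..<h}" "\<And>i j. i < j \<Longrightarrow> j < h \<Longrightarrow> x (q i) < x (q j)"
          using ex_sorting_permutation[OF inj] by blast
        have qh: "q i < h \<longleftrightarrow> i < h" for i using permutes_in_image[OF q(1), of i] by simp
        have ok_q: "ok q"
          unfolding ok_def nodes_ok_def
        proof (intro conjI allI impI)
          show "0 < extend_nodes (perm q x) 0"
            using x_open qh en[of 0 q] en1[of 0] by (cases "0 < h") auto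
          show "extend_nodes (perm q x) (num_nodes - 1) \<le> 1"
            using x_open(2)[of "q (num_nodes - 1)"] qh[of "num_nodes - 1"] en[of "num_nodes - 1" q] en1[of "num_nodes - 1"]
            by (cases "num_nodes - 1 < h") auto
          fix i assume "Suc i < num_nodes"
          then have "i < h" by (auto simp: num_nodes_def h_def)
          then show "extend_nodes (perm q x) i < extend_nodes (perm q x) (Suc i)"
            using q(2)[of i "Suc i"] x_open(2)[of "q i"] qh[of i] en[of i q] en[of "Suc i" q] en1[of "Suc i"]
            by (cases "Suc i < h") auto
        qed
        have unique: "p = q" if p: "p \<in> S" "ok p" for p
        proof -
          have pp: "p permutes {..<h}" using p by (simp add: S_def)
          have "map (\<lambda>i. x (p i)) [0..<h] = map (\<lambda>i. x (q i)) [0..<h]"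
          proof (rule sorted_distinct_set_unique)
            show "sorted (map (\<lambda>i. x (p i)) [0..<h])" "sorted (map (\<lambda>i. x (q i)) [0..<h])"
              using sorted[OF p(2)] q(2) by (auto simp: sorted_iff_nth_mono_less less_imp_le)
            show "distinct (map (\<lambda>i. x (p i)) [0..<h])" "distinct (map (\<lambda>i. x (q i)) [0..<h])"
              using sorted[OF p(2)] q(2) by (auto simp: distinct_map inj_on_def) (metis less_irrefl linorder_neqE_nat)+
            have "(\<lambda>i. x (p i)) ` {..<h} = x ` (p ` {..<h})" "(\<lambda>i. x (q i)) ` {..<h} = x ` (q ` {..<h})" by auto
            then show "set (map (\<lambda>i. x (p i)) [0..<h]) = set (map (\<lambda>i. x (q i)) [0..<h])"
              using permutes_image[OF pp] permutes_image[OF q(1)] by (simp add: lessThan_atLeast0)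
          qed
          then have eq: "x (p i) = x (q i)" if "i < h" for i using that by simp
          show "p = q"
          proof
            fix i
            show "p i = q i"
            proof (cases "i < h")
              case True
              then show ?thesis
                using inj_onD[OF inj eq[OF True]] qh[of i] permutes_in_image[OF pp, of i] by simp
            next
              case False
              then show ?thesis using permutes_not_in[OF pp, of i] permutes_not_in[OF q(1), of i] by simp
            qed
          qed
        qed
        have "(\<Sum>p\<in>S. Od (perm p x)) = (\<Sum>p\<in>S. if p = q then ennreal (jac_density lam x) else 0)"
        proof (rule sum.cong[OF refl])
          fix p assume "p \<in> S"
          show "Od (perm p x) = (if p = q then ennreal (jac_density lam x) else 0)"
          proof (cases "p = q")
            case True
            show ?thesis unfolding Od_eq[OF \<open>p \<in> S\<close>] unfolding True by (simp only: ok_q of_bool_eq mult_1 if_True refl)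
          next
            case False
            then have "ok p = False" using unique[OF \<open>p \<in> S\<close>] by blast
            then show ?thesis unfolding Od_eq[OF \<open>p \<in> S\<close>]
              using False by (simp only: of_bool_eq mult_zero_left ennreal_0 if_False)
          qed
        qed
        also have "\<dots> = ennreal (jac_density lam x)" using S q(1) by (simp add: S_def)
        finally show ?thesis using cube by simp
      qed
    qed
  qed
  have "(\<integral>\<^sup>+x. ennreal (indicator ({..<h} \<rightarrow>\<^sub>E {0..1}) x * jac_density lam x) \<partial>lebN h) =
      (\<integral>\<^sup>+x. (\<Sum>p\<in>S. Od (perm p x)) \<partial>lebN h)"
  proof (rule nn_integral_cong_AE)
    have "AE x in lebN h. \<forall>i\<in>{..<h}. x i \<noteq> 0 \<and> x i \<noteq> 1"
      by (rule AE_finite_allI) (auto intro: AE_conjI AE_lebN_coordinate_neq)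
    then show "AE x in lebN h. ennreal (indicator ({..<h} \<rightarrow>\<^sub>E {0..1}) x * jac_density lam x) =
        (\<Sum>p\<in>S. Od (perm p x))"
      using AE_space by eventually_elim (rule pointwise, auto)
  qed
  also have "\<dots> = (\<Sum>p\<in>S. (\<integral>\<^sup>+x. Od (perm p x) \<partial>lebN h))"
  proof (rule nn_integral_sum)
    fix p assume "p \<in> S"
    then have "p i < h" if "i < h" for i using permutes_in_image[of p "{..<h}" i] that by (simp add: S_def)
    then have "perm p \<in> measurable (lebN h) (lebN h)"
      unfolding perm_def[abs_def] by (intro measurable_restrict measurable_component_singleton) simp
    then show "(\<lambda>x. Od (perm p x)) \<in> borel_measurable (lebN h)" by (rule measurable_compose[OF _ Od_meas])
  qed
  also have "\<dots> = (\<Sum>p\<in>S. (\<integral>\<^sup>+x. Od x \<partial>lebN h))"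
  proof (rule sum.cong[OF refl])
    fix p assume "p \<in> S"
    then have "bij_betw p {..<h} {..<h}" by (simp add: S_def permutes_imp_bij)
    then show "(\<integral>\<^sup>+x. Od (perm p x) \<partial>lebN h) = (\<integral>\<^sup>+x. Od x \<partial>lebN h)"
      unfolding perm_def by (rule nn_integral_PiM_reindex[OF _ _ Od_meas, symmetric]) simp
  qed
  also have "\<dots> = ennreal (fact h) * (\<integral>\<^sup>+x. Od x \<partial>lebN h)"
    using ennreal_of_nat_eq_real_of_nat[of "fact h"] by (simp add: S)
  finally show ?thesis by (simp only: Od_def h_def)
qed

theorem measure_curve_hull:
  assumes lam: "\<And>j. j < n \<Longrightarrow> lam j + n - 1 - j = e j"
  shows "measure (lebN n) (curve_hull (curve_pts n e)) =
    1 / (fact n * fact (n div 2)) * (LINT x : ({..<n div 2} \<rightarrow>\<^sub>E {0..1}) | lebN (n div 2). jac_density lam x)"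
proof -
  define h where "h = n div 2"
  let ?c = "{..<h} \<rightarrow>\<^sub>E {0..1} :: (nat \<Rightarrow> real) set"
  let ?O = "\<integral>\<^sup>+x. ordered_density lam x \<partial>lebN h"
  have "emeasure (lebN n) (curve_hull (curve_pts n e)) = ?O * ennreal (1 / fact n)"
    unfolding h_def by (rule trans[OF emeasure_curve_hull nn_integral_params[OF lam]])
  then have "measure (lebN n) (curve_hull (curve_pts n e)) = enn2real (?O * ennreal (1 / fact n))"
    by (simp only: Sigma_Algebra.measure_def)
  also have "\<dots> = enn2real ?O / fact n" by (simp add: enn2real_mult)
  finally have 1: "measure (lebN n) (curve_hull (curve_pts n e)) = enn2real ?O / fact n" .
  have c: "?c \<in> sets (lebN h)" by (intro sets_PiM_I_finite) auto
  have "jac_density lam \<in> borel_measurable (lebN h)"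
    by (intro borel_measurable_lebN borel_measurable_continuous_onI continuous_on_jac_density)
  then have m: "(\<lambda>x. indicator ?c x * jac_density lam x) \<in> borel_measurable (lebN h)"
    using c by simp
  have nn: "0 \<le> indicator ?c x * jac_density lam x" for x
  proof (cases "x \<in> ?c")
    case True
    have "0 \<le> x i" if "i < n div 2" for i using PiE_mem[OF True, of i] that by (simp add: h_def)
    then have "0 \<le> jac_density lam x" using jac_density_nonneg[OF lam] by simp
    then show ?thesis by simp
  qed simp
  have "(LINT x : ?c | lebN h. jac_density lam x) =
      enn2real (\<integral>\<^sup>+x. ennreal (indicator ?c x * jac_density lam x) \<partial>lebN h)"
    unfolding set_lebesgue_integral_def real_scaleR_def
    by (rule integral_eq_nn_integral[OF m]) (simp add: nn)
  also have "\<dots> = fact h * enn2real ?O"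
    unfolding h_def nn_integral_symmetrise by (simp add: enn2real_mult)
  finally show ?thesis using 1 by (simp add: h_def)
qed

end

theorem theorem3p4:
  fixes m :: nat
  assumes "m > 1"
  shows
   "(\<forall>(F :: nat \<Rightarrow> 'a set \<times> 'a set set).
      (\<forall>i<2*m. fin_graph (F i) \<and> num_edges (F i) > 0) \<and>
      (\<forall>i<2*m. \<forall>j<2*m. i \<noteq> j \<longrightarrow> F i \<noteq> F j) \<and>
      (\<forall>i. Suc i < 2*m \<longrightarrow> num_edges (F i) > num_edges (F (Suc i))) \<longrightarrow>
      (let e = (\<lambda>i. num_edges (F i));
           lam = (\<lambda>i. e i + i + 1 - 2*m)
       in measure (lebN (2*m)) (curve_hull (curve_pts (2*m) e)) =
          1 / (fact (2*m) * fact m) *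
          (LINT x : ({..<m} \<rightarrow>\<^sub>E {0..1}) | lebN m.
             schur (2*m) lam (\<lambda>i. x (i div 2)) *
             (\<Prod>i<m. \<Prod>j\<in>{i<..<m}. (x i - x j) ^ 4))))
    \<and>
   (\<forall>(F :: nat \<Rightarrow> 'a set \<times> 'a set set).
      (\<forall>i<2*m+1. fin_graph (F i) \<and> num_edges (F i) > 0) \<and>
      (\<forall>i<2*m+1. \<forall>j<2*m+1. i \<noteq> j \<longrightarrow> F i \<noteq> F j) \<and>
      (\<forall>i. Suc i < 2*m+1 \<longrightarrow> num_edges (F i) > num_edges (F (Suc i))) \<longrightarrow>
      (let e = (\<lambda>i. num_edges (F i));
           lam = (\<lambda>i. e i + i + 1 - (2*m+1))
       in measure (lebN (2*m+1)) (curve_hull (curve_pts (2*m+1) e)) =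
          1 / (fact (2*m+1) * fact m) *
          (LINT x : ({..<m} \<rightarrow>\<^sub>E {0..1}) | lebN m.
             schur (2*m+1) lam (\<lambda>i. if i < 2*m then x (i div 2) else 1) *
             (\<Prod>i<m. \<Prod>j\<in>{i<..<m}. (x i - x j) ^ 4) *
             (\<Prod>i<m. (1 - x i) ^ 2))))"
proof -
  have strict: "e j < e i" if "\<And>i. Suc i < n \<Longrightarrow> e (Suc i) < e i" "i < j" "j < n" for e :: "nat \<Rightarrow> nat" and i j n
    using that(2,3)
  proof (induction j)
    case (Suc j)
    have "e (Suc j) < e j" using that(1) Suc.prems by simp
    then show ?case using Suc by (cases "i = j") auto
  qed simp
  \<comment> \<open>This bound makes the truncated subtraction in \<open>e i + i + 1 - n\<close>
    exact, so that \<open>lam j + n - 1 - j\<close> is \<open>e j\<close>. The \<open>+ 1\<close>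
    reflects indices that start at 0.\<close>
  have lower: "n - j \<le> e j" if "\<And>i. Suc i < n \<Longrightarrow> e (Suc i) < e i" "\<And>i. i < n \<Longrightarrow> 0 < e i" "j \<le> n"
    for e :: "nat \<Rightarrow> nat" and j n
    using that(3)
  proof (induction rule: inc_induct)
    case (step j)
    have "e (Suc j) < e j" if "Suc j < n" using \<open>\<And>i. Suc i < n \<Longrightarrow> e (Suc i) < e i\<close> that .
    then show ?case using step that(2)[of j] by (cases "Suc j < n") auto
  qed simp
  have curve: "measure (lebN n) (curve_hull (curve_pts n e)) = 1 / (fact n * fact (n div 2)) *
      (LINT x : ({..<n div 2} \<rightarrow>\<^sub>E {0..1}) | lebN (n div 2).
        monomial_curve.jac_density n (\<lambda>i. e i + i + 1 - n) x)"
    and curve_locale: "monomial_curve n e"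
    if n: "0 < n" and "\<forall>i. Suc i < n \<longrightarrow> e (Suc i) < e i" and "\<forall>i<n. 0 < e i"
    for n and e :: "nat \<Rightarrow> nat"
  proof -
    from that have dec: "\<And>i. Suc i < n \<Longrightarrow> e (Suc i) < e i" and pos: "\<And>i. i < n \<Longrightarrow> 0 < e i"
      by auto
    show "monomial_curve n e"
      by standard (use n pos strict[of n e] dec in auto)
    then interpret monomial_curve n e .
    have "e j + j + 1 - n + n - 1 - j = e j" if "j < n" for j
      using lower[of n e j] dec pos that by fastforce
    then show "measure (lebN n) (curve_hull (curve_pts n e)) = 1 / (fact n * fact (n div 2)) *
      (LINT x : ({..<n div 2} \<rightarrow>\<^sub>E {0..1}) | lebN (n div 2). jac_density (\<lambda>i. e i + i + 1 - n) x)"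
      by (rule measure_curve_hull)
  qed
  show ?thesis
    unfolding Let_def
  proof (intro conjI allI impI, goal_cases)
    case (1 F)
    let ?e = "\<lambda>i. num_edges (F i)" and ?lam = "\<lambda>i. num_edges (F i) + i + 1 - 2 * m"
    have *: "0 < 2 * m" "\<forall>i. Suc i < 2 * m \<longrightarrow> ?e (Suc i) < ?e i" "\<forall>i<2 * m. 0 < ?e i"
      using 1 assms by auto
    interpret monomial_curve "2 * m" ?e by (rule curve_locale[OF *])
    have "schur (2 * m) ?lam (double_nodes x) = schur (2 * m) ?lam (\<lambda>i. x (i div 2))" for x
      by (rule schur_cong) (simp add: double_nodes_def)
    then show ?case using curve[OF *] by (simp add: jac_density_def)
  next
    case (2 F)
    let ?e = "\<lambda>i. num_edges (F i)"
    have *: "0 < 2 * m + 1" "\<forall>i. Suc i < 2 * m + 1 \<longrightarrow> ?e (Suc i) < ?e i" "\<forall>i<2 * m + 1. 0 < ?e i"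
      using 2 by auto
    interpret monomial_curve "2 * m + 1" ?e by (rule curve_locale[OF *])
    have h: "(2 * m + 1) div 2 = m" by simp
    have "double_nodes x = (\<lambda>i. if i < 2 * m then x (i div 2) else 1)" for x
      unfolding double_nodes_def h ..
    then show ?case using curve[OF *] unfolding h jac_density_def by simp
  qed
qed

end
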